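(* Let $\kappa\ge0$. Assume that there exists a germ $\Psi$ which for every $m\ge0$ defines a real-analytic germ $\Psi:H_0^m\to h^{m+1/2}$, with $d\Psi(0)=T$, such that: (a) for each $m\ge0$, $\Psi-T$ defines a germ of an analytic mapping $H^m_0\to h^{m+1/2+\kappa}$; (b) the hamiltonian $h_{KdV}$ of the KdV equation is a function of the variables $\frac12|\Psi^j(u)|^2$, $j\ge1$, only. Then $\kappa\le 3/2$.
   Context: $H^m_0$ is the Sobolev space of real-valued functions on $S^1=\mathbb R/2\pi\mathbb Z$ with zero mean value, with norm $\|u\|_m=|(-\Delta)^{m/2}u|_{L_2}$. For $r\in\mathbb R$, $h^r$ is the real Hilbert space of complex sequences $v=(v_j)_{j\ge1}$, $v_j=v_j^++iv_j^-\in\mathbb C\simeq\mathbb R^2$, with $\|v\|_r^2=\sum_jj^{2r}|v_j|^2<\infty$. Germs are germs at the origin, mapping $0$ to $0$; the neighbourhood of definition may depend on $m$. $\Psi=(\Psi^1,\Psi^2,\dots)$ denotes components. Writing $u(x)=\pi^{-1/2}\sum_{s\ge1}(u_s^+\cos sx-u_s^-\sin sx)$, the map $T:u\mapsto v$, $v_j^\pm=j^{-1/2}u_j^\pm$, is an isomorphism $H^m_0\to h^{m+1/2}$ for every $m$. The KdV hamiltonian, defined on $H^m_0$ for $m\ge1$, is $h_{KdV}(u)=\int_0^{2\pi}\big(-\frac18u_x^2+u^3\big)dx$. *)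

theory Defs
  imports "HOL-Analysis.Analysis"
begin

text \<open>Functions on the circle are $2\pi$-periodic functions on the line. Elements of
  $L_2$ and of the Sobolev spaces are represented by functions rather than by classes modulo
  equality almost everywhere, so \<open>H0_norm m\<close> below is a seminorm whose kernel consists of the
  functions vanishing almost everywhere. Maps that are analytic with respect to it do not
  distinguish, near the origin, between functions that agree almost everywhere.\<close>

definition L2_circle :: "(real \<Rightarrow> real) set" where
  "L2_circle = {u. (\<forall>x. u (x + 2 * pi) = u x) \<and> u \<in> borel_measurable lebesgue \<and>
     set_integrable lebesgue {0..2 * pi} (\<lambda>x. (u x)\<^sup>2)}"

definition L2_circle0 :: "(real \<Rightarrow> real) set" where
  "L2_circle0 = {u \<in> L2_circle. (LINT x:{0..2 * pi}|lebesgue. u x) = 0}"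

definition circle_L2_norm :: "(real \<Rightarrow> real) \<Rightarrow> real" where
  "circle_L2_norm u = sqrt (LINT x:{0..2 * pi}|lebesgue. (u x)\<^sup>2)"

text \<open>The coefficients $u_s = u_s^+ + i u_s^-$ ($s \ge 1$) in
  $u(x) = \pi^{-1/2}\sum_{s\ge1}(u_s^+\cos sx - u_s^-\sin sx)$.\<close>

definition fourier_coeff :: "(real \<Rightarrow> real) \<Rightarrow> nat \<Rightarrow> complex" where
  "fourier_coeff u s = Complex
     ((LINT x:{0..2 * pi}|lebesgue. u x * cos (real s * x)) / sqrt pi)
     (- (LINT x:{0..2 * pi}|lebesgue. u x * sin (real s * x)) / sqrt pi)"

text \<open>\<open>is_laplacian_power m u w\<close>: the function $w \in L_2$ is $(-\Delta)^{m/2}u$, where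
  $-\Delta$ multiplies the $s$-th Fourier mode by $s^2$. This determines $w$ up to equality
  almost everywhere.\<close>

definition is_laplacian_power :: "real \<Rightarrow> (real \<Rightarrow> real) \<Rightarrow> (real \<Rightarrow> real) \<Rightarrow> bool" where
  "is_laplacian_power m u w \<longleftrightarrow> w \<in> L2_circle0 \<and>
     (\<forall>s\<ge>1. fourier_coeff w s = complex_of_real (real s powr m) * fourier_coeff u s)"

definition H0 :: "real \<Rightarrow> (real \<Rightarrow> real) set" where
  "H0 m = {u \<in> L2_circle0. \<exists>w. is_laplacian_power m u w}"

definition H0_norm :: "real \<Rightarrow> (real \<Rightarrow> real) \<Rightarrow> real" where
  "H0_norm m u = circle_L2_norm (SOME w. is_laplacian_power m u w)"

text \<open>Sequences $(v_j)_{j\ge1}$ are functions on \<^typ>\<open>nat\<close> with the unused entry at \<open>0\<close> set to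
  zero.\<close>

definition hseq :: "real \<Rightarrow> (nat \<Rightarrow> complex) set" where
  "hseq r = {v. v 0 = 0 \<and> summable (\<lambda>j. real j powr (2 * r) * (cmod (v j))\<^sup>2)}"

definition hseq_norm :: "real \<Rightarrow> (nat \<Rightarrow> complex) \<Rightarrow> real" where
  "hseq_norm r v = sqrt (\<Sum>j. real j powr (2 * r) * (cmod (v j))\<^sup>2)"

definition T_map :: "(real \<Rightarrow> real) \<Rightarrow> nat \<Rightarrow> complex" where
  "T_map u j = (if j = 0 then 0
     else complex_of_real (real j powr (- 1 / 2)) * fourier_coeff u j)"

text \<open>The weak derivative of a function on the circle, tested against smooth periodic
  functions; it is unique up to equality almost everywhere.\<close>

definition smooth_periodic :: "(real \<Rightarrow> real) \<Rightarrow> bool" where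
  "smooth_periodic \<phi> \<longleftrightarrow> (\<forall>x. \<phi> (x + 2 * pi) = \<phi> x) \<and>
     (\<forall>n x. (deriv ^^ n) \<phi> differentiable at x)"

definition has_weak_deriv :: "(real \<Rightarrow> real) \<Rightarrow> (real \<Rightarrow> real) \<Rightarrow> bool" where
  "has_weak_deriv u w \<longleftrightarrow> w \<in> L2_circle \<and>
     (\<forall>\<phi>. smooth_periodic \<phi> \<longrightarrow>
        (LINT x:{0..2 * pi}|lebesgue. u x * deriv \<phi> x) =
        - (LINT x:{0..2 * pi}|lebesgue. w x * \<phi> x))"

definition weak_deriv :: "(real \<Rightarrow> real) \<Rightarrow> real \<Rightarrow> real" where
  "weak_deriv u = (SOME w. has_weak_deriv u w)"

definition h_KdV :: "(real \<Rightarrow> real) \<Rightarrow> real" where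
  "h_KdV u = (LINT x:{0..2 * pi}|lebesgue. - (1 / 8) * (weak_deriv u x)\<^sup>2 + (u x) ^ 3)"

text \<open>Multilinear maps, derivatives and analytic germs between (semi)normed spaces of functions,
  each given by a carrier set \<open>X\<close> and a norm \<open>nX\<close> on it, with pointwise vector operations.
  An $n$-linear map takes the list of its $n$ arguments.\<close>

definition multilinear_on ::
  "nat \<Rightarrow> ('a \<Rightarrow> 'b::real_vector) set \<Rightarrow> ('c \<Rightarrow> 'd::real_vector) set \<Rightarrow>
     (('a \<Rightarrow> 'b) list \<Rightarrow> 'c \<Rightarrow> 'd) \<Rightarrow> bool" where
  "multilinear_on n X Y M \<longleftrightarrow>
     (\<forall>xs. length xs = n \<and> set xs \<subseteq> X \<longrightarrow> M xs \<in> Y \<and>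
        (\<forall>i<n. \<forall>y\<in>X. \<forall>z\<in>X. \<forall>a b.
           M (xs[i := (\<lambda>t. a *\<^sub>R y t + b *\<^sub>R z t)]) =
           (\<lambda>t. a *\<^sub>R M (xs[i := y]) t + b *\<^sub>R M (xs[i := z]) t)))"

text \<open>Germs at the origin that map \<open>0\<close> to \<open>0\<close> and are sums of power series
  $\sum_n M_n(u,\dots,u)$ with bounded $n$-linear $M_n$ and positive radius of convergence.\<close>

definition analytic_germ ::
  "('a \<Rightarrow> 'b::real_vector) set \<Rightarrow> (('a \<Rightarrow> 'b) \<Rightarrow> real) \<Rightarrow>
   ('c \<Rightarrow> 'd::real_vector) set \<Rightarrow> (('c \<Rightarrow> 'd) \<Rightarrow> real) \<Rightarrow>
   (('a \<Rightarrow> 'b) \<Rightarrow> 'c \<Rightarrow> 'd) \<Rightarrow> bool" where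
  "analytic_germ X nX Y nY F \<longleftrightarrow>
     F (\<lambda>_. 0) = (\<lambda>_. 0) \<and>
     (\<exists>M C R \<delta>. R > 0 \<and> \<delta> > 0 \<and>
        (\<forall>n. multilinear_on n X Y (M n)) \<and>
        (\<forall>n xs. length xs = n \<and> set xs \<subseteq> X \<longrightarrow>
           nY (M n xs) \<le> C * R ^ n * prod_list (map nX xs)) \<and>
        (\<forall>u\<in>X. nX u < \<delta> \<longrightarrow> F u \<in> Y \<and>
           (\<lambda>N. nY (\<lambda>t. F u t - (\<Sum>n<N. M n (replicate n u) t))) \<longlonglongrightarrow> 0))"

definition has_deriv_at_0 ::
  "('a \<Rightarrow> 'b::real_vector) set \<Rightarrow> (('a \<Rightarrow> 'b) \<Rightarrow> real) \<Rightarrow>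
   ('c \<Rightarrow> 'd::real_vector) set \<Rightarrow> (('c \<Rightarrow> 'd) \<Rightarrow> real) \<Rightarrow>
   (('a \<Rightarrow> 'b) \<Rightarrow> 'c \<Rightarrow> 'd) \<Rightarrow> (('a \<Rightarrow> 'b) \<Rightarrow> 'c \<Rightarrow> 'd) \<Rightarrow> bool" where
  "has_deriv_at_0 X nX Y nY F L \<longleftrightarrow>
     (\<forall>u\<in>X. L u \<in> Y) \<and>
     (\<forall>u\<in>X. \<forall>w\<in>X. \<forall>a b.
        L (\<lambda>t. a *\<^sub>R u t + b *\<^sub>R w t) = (\<lambda>t. a *\<^sub>R L u t + b *\<^sub>R L w t)) \<and>
     (\<exists>C. \<forall>u\<in>X. nY (L u) \<le> C * nX u) \<and>
     (\<forall>\<epsilon>>0. \<exists>\<delta>>0. \<forall>u\<in>X. nX u < \<delta> \<longrightarrow>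
        (\<lambda>t. F u t - F (\<lambda>_. 0) t - L u t) \<in> Y \<and>
        nY (\<lambda>t. F u t - F (\<lambda>_. 0) t - L u t) \<le> \<epsilon> * nX u)"

end

theory Submission
  imports Defs
begin

text \<open>Since \<open>h_KdV\<close> depends on the moduli \<open>|\<Psi>\<^sup>j|\<close> only, it takes the same value at \<open>u\<close> and at a
  point \<open>w\<close> with \<open>\<Psi>(w) = - \<Psi>(u)\<close>. Let \<open>Q\<close> be the quadratic part of \<open>\<Psi>\<close>, so that
  \<open>\<Psi> = T + Q + O(u\<^sup>3)\<close>. Then \<open>w = - u - 2 T\<^sup>-\<^sup>1 Q(u) + O(u\<^sup>3)\<close>, and comparing the terms of degree three in
  \<open>h_KdV w = h_KdV u\<close> gives the identity (lemma \<open>cubic_identity\<close>)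

  \<open>\<integral> u\<^sup>3 = - 1/4 \<Sum>\<^sub>s s\<^sup>5\<^sup>/\<^sup>2 Re (u\<^sub>s cnj (Q\<^sub>s(u)))\<close>.

  By hypothesis (a) with \<open>m = 0\<close> the quadratic map \<open>Q\<close> is bounded from \<open>L\<^sub>2\<close> to \<open>h\<^sup>1\<^sup>/\<^sup>2\<^sup>+\<^sup>\<kappa>\<close>. The
  Cauchy-Schwarz inequality, with the weight split as \<open>5/2 = (2 - \<kappa>) + (1/2 + \<kappa>)\<close>, turns the identity
  into (lemma \<open>cubic_form_estimate\<close>)

  \<open>\<integral> u\<^sup>3 \<le> C \<cdot> |u|\<^sub>0\<^sup>2 \<cdot> |u|\<^sub>2\<^sub>-\<^sub>\<kappa>\<close>  for all trigonometric polynomials \<open>u\<close>.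

  The function \<open>u = \<Sum>\<^sub>s\<^sub>\<le>\<^sub>N cos(s x)\<close> is a bump of height \<open>N\<close> and width of order \<open>1/N\<close>. Its cubic
  integral is of order \<open>N\<^sup>2\<close>, while \<open>|u|\<^sub>0\<^sup>2\<close> is of order \<open>N\<close> and \<open>|u|\<^sub>2\<^sub>-\<^sub>\<kappa>\<close> is at most of order
  \<open>N\<^sup>1\<^sup>/\<^sup>2\<^sup>+\<^sup>\<theta>\<close> with \<open>\<theta> = max 0 (2 - \<kappa>)\<close>. Hence \<open>\<theta> \<ge> 1/2\<close>, that is, \<open>\<kappa> \<le> 3/2\<close>.

  Two points need care. The function of the actions through which \<open>h_KdV\<close> factors is arbitrary, not
  even continuous, so \<open>w\<close> must solve \<open>\<Psi>(w) = - \<Psi>(u)\<close> exactly; for \<open>\<kappa> > 1\<close> it is found by the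
  contraction principle, \<open>\<Psi> - T\<close> being Lipschitz with a small constant near the origin (lemma
  \<open>antipodal_solution\<close>). And the Sobolev norms and the weak derivative in \<open>h_KdV\<close> are
  defined by choosing a function with prescribed Fourier coefficients or test integrals; that the
  choice does not matter is the completeness of the trigonometric system (lemma
  \<open>trigonometric_system_complete\<close>).\<close>

section \<open>Completeness of the trigonometric system\<close>

abbreviation circ :: "real measure" where
  "circ \<equiv> lebesgue_on {0..2 * pi}"

lemma LINT_circ: "(LINT x:{0..2 * pi}|lebesgue. f x) = integral\<^sup>L circ f" for f :: "real \<Rightarrow> real"
  by (simp add: set_lebesgue_integral_def integral_restrict_space)

lemma set_integrable_circ: "set_integrable lebesgue {0..2 * pi} f \<longleftrightarrow> integrable circ f" for f :: "real \<Rightarrow> real"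
  by (simp add: set_integrable_def integrable_restrict_space)

lemma integrable_circ_continuous:
  fixes f :: "real \<Rightarrow> real"
  assumes "continuous_on {0..2 * pi} f"
  shows "integrable circ f"
  using absolutely_integrable_continuous_real[OF assms] by (simp add: set_integrable_circ)

lemma integrable_circ_mult_bounded:
  fixes f g :: "real \<Rightarrow> real"
  assumes "integrable circ g" "f \<in> borel_measurable circ" "\<And>x. x \<in> {0..2 * pi} \<Longrightarrow> \<bar>f x\<bar> \<le> B"
  shows "integrable circ (\<lambda>x. g x * f x)"
proof (rule Bochner_Integration.integrable_bound)
  show "integrable circ (\<lambda>x. \<bar>B\<bar> * g x)" using assms by simp
  show "(\<lambda>x. g x * f x) \<in> borel_measurable circ" using assms by measurable
  show "AE x in circ. norm (g x * f x) \<le> norm (\<bar>B\<bar> * g x)"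
  proof (rule AE_I2)
    fix x assume "x \<in> space circ"
    then have "\<bar>f x\<bar> \<le> B" using assms by simp
    then have "\<bar>f x\<bar> \<le> \<bar>B\<bar>" by linarith
    then show "norm (g x * f x) \<le> norm (\<bar>B\<bar> * g x)"
      by (simp add: abs_mult mult.commute mult_right_mono)
  qed
qed

lemma integrable_circ_mult_continuous:
  fixes f g :: "real \<Rightarrow> real"
  assumes "integrable circ g" "continuous_on {0..2 * pi} f"
  shows "integrable circ (\<lambda>x. g x * f x)"
proof -
  have "compact (f ` {0..2 * pi})" using assms compact_continuous_image by blast
  then have "bounded (f ` {0..2 * pi})" by (rule compact_imp_bounded)
  then obtain B where "\<forall>x\<in>{0..2 * pi}. \<bar>f x\<bar> \<le> B"
    unfolding bounded_iff by auto
  moreover have "f \<in> borel_measurable circ"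
    using integrable_circ_continuous[OF assms(2)] by blast
  ultimately show ?thesis using integrable_circ_mult_bounded assms by blast
qed

text \<open>The functions \<open>\<phi>\<close> for which \<open>g \<cdot> \<phi>\<close> is again orthogonal to all cosines and sines form a space
  that is stable under multiplication by \<open>cos\<close> and \<open>sin\<close>, because of the product formulas. It is
  therefore stable under multiplication by every polynomial in \<open>cos\<close> and \<open>sin\<close>, and it contains \<open>1\<close>.\<close>

lemma orthogonal_trig_imp_orthogonal_polynomial:
  fixes g :: "real \<Rightarrow> real" and p :: "complex \<Rightarrow> real"
  assumes g: "integrable circ g"
    and c: "\<And>k::nat. integral\<^sup>L circ (\<lambda>x. g x * cos (real k * x)) = 0"
    and s: "\<And>k::nat. integral\<^sup>L circ (\<lambda>x. g x * sin (real k * x)) = 0"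
    and p: "real_polynomial_function p"
  shows "integral\<^sup>L circ (\<lambda>x. g x * p (cis x)) = 0"
proof -
  define V where "V = {\<phi>. continuous_on UNIV \<phi> \<and>
    (\<forall>k::int. integral\<^sup>L circ (\<lambda>x. g x * (\<phi> x * cos (k * x))) = 0 \<and>
             integral\<^sup>L circ (\<lambda>x. g x * (\<phi> x * sin (k * x))) = 0)}"
  have int: "integrable circ (\<lambda>x. g x * f x)" if "continuous_on UNIV f" for f
    using g continuous_on_subset[OF that] by (intro integrable_circ_mult_continuous) auto
  have V_lin: "(\<lambda>x. a * \<phi> x + b * \<psi> x) \<in> V" if "\<phi> \<in> V" "\<psi> \<in> V" for a b \<phi> \<psi>
  proof -
    have cont: "continuous_on UNIV \<phi>" "continuous_on UNIV \<psi>" using that by (auto simp: V_def)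
    have *: "integral\<^sup>L circ (\<lambda>x. g x * ((a * \<phi> x + b * \<psi> x) * h x)) =
        a * integral\<^sup>L circ (\<lambda>x. g x * (\<phi> x * h x)) + b * integral\<^sup>L circ (\<lambda>x. g x * (\<psi> x * h x))"
      if "continuous_on UNIV h" for h
    proof -
      have "integrable circ (\<lambda>x. g x * (\<phi> x * h x))" "integrable circ (\<lambda>x. g x * (\<psi> x * h x))"
        by (intro int continuous_intros cont that)+
      moreover have "g x * ((a * \<phi> x + b * \<psi> x) * h x) =
          a * (g x * (\<phi> x * h x)) + b * (g x * (\<psi> x * h x))" for x
        by (simp add: algebra_simps)
      ultimately show ?thesis by simp
    qed
    have "continuous_on UNIV (\<lambda>x. a * \<phi> x + b * \<psi> x)" by (intro continuous_intros cont)
    moreover have "integral\<^sup>L circ (\<lambda>x. g x * ((a * \<phi> x + b * \<psi> x) * cos (real_of_int k * x))) = 0"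
      "integral\<^sup>L circ (\<lambda>x. g x * ((a * \<phi> x + b * \<psi> x) * sin (real_of_int k * x))) = 0" for k
      using that by (simp_all add: V_def * continuous_intros)
    ultimately show ?thesis by (simp add: V_def)
  qed
  have V_cos: "(\<lambda>x. \<phi> x * cos x) \<in> V" if "\<phi> \<in> V" for \<phi>
  proof -
    have cont: "continuous_on UNIV \<phi>" using that by (auto simp: V_def)
    have e: "g x * (\<phi> x * cos x * cos (real_of_int k * x)) =
       (1/2) * (g x * (\<phi> x * cos (real_of_int (k + 1) * x))) + (1/2) * (g x * (\<phi> x * cos (real_of_int (k - 1) * x)))"
      "g x * (\<phi> x * cos x * sin (real_of_int k * x)) =
       (1/2) * (g x * (\<phi> x * sin (real_of_int (k + 1) * x))) + (1/2) * (g x * (\<phi> x * sin (real_of_int (k - 1) * x)))"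
      for k x
      by (auto simp: algebra_simps cos_add cos_diff sin_add sin_diff)
    have i: "integrable circ (\<lambda>x. g x * (\<phi> x * cos (real_of_int k * x)))"
       "integrable circ (\<lambda>x. g x * (\<phi> x * sin (real_of_int k * x)))" for k
      by (intro int continuous_intros cont)+
    have z: "integral\<^sup>L circ (\<lambda>x. g x * (\<phi> x * cos (real_of_int k * x))) = 0"
       "integral\<^sup>L circ (\<lambda>x. g x * (\<phi> x * sin (real_of_int k * x))) = 0" for k
      using that by (auto simp: V_def)
    have "continuous_on UNIV (\<lambda>x. \<phi> x * cos x)" by (intro continuous_intros cont)
    then show ?thesis unfolding V_def mem_Collect_eq e
      by (simp add: i z del: of_int_add of_int_diff)
  qed
  have V_sin: "(\<lambda>x. \<phi> x * sin x) \<in> V" if "\<phi> \<in> V" for \<phi>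
  proof -
    have cont: "continuous_on UNIV \<phi>" using that by (auto simp: V_def)
    have e: "g x * (\<phi> x * sin x * cos (real_of_int k * x)) =
       (1/2) * (g x * (\<phi> x * sin (real_of_int (k + 1) * x))) - (1/2) * (g x * (\<phi> x * sin (real_of_int (k - 1) * x)))"
      "g x * (\<phi> x * sin x * sin (real_of_int k * x)) =
       (1/2) * (g x * (\<phi> x * cos (real_of_int (k - 1) * x))) - (1/2) * (g x * (\<phi> x * cos (real_of_int (k + 1) * x)))"
      for k x
      by (auto simp: algebra_simps cos_add cos_diff sin_add sin_diff)
    have i: "integrable circ (\<lambda>x. g x * (\<phi> x * cos (real_of_int k * x)))"
       "integrable circ (\<lambda>x. g x * (\<phi> x * sin (real_of_int k * x)))" for k
      by (intro int continuous_intros cont)+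
    have z: "integral\<^sup>L circ (\<lambda>x. g x * (\<phi> x * cos (real_of_int k * x))) = 0"
       "integral\<^sup>L circ (\<lambda>x. g x * (\<phi> x * sin (real_of_int k * x))) = 0" for k
      using that by (auto simp: V_def)
    have "continuous_on UNIV (\<lambda>x. \<phi> x * sin x)" by (intro continuous_intros cont)
    then show ?thesis unfolding V_def mem_Collect_eq e
      by (simp add: i z del: of_int_add of_int_diff)
  qed
  have "(\<forall>\<phi>\<in>V. (\<lambda>x. \<phi> x * p (cis x)) \<in> V)" using p
  proof induction
    case (linear f)
    have "f (cis x) = f 1 * cos x + f \<i> * sin x" for x
    proof -
      have "cis x = cos x *\<^sub>R 1 + sin x *\<^sub>R \<i>" by (auto simp: complex_eq_iff)
      then have "f (cis x) = f (cos x *\<^sub>R 1 + sin x *\<^sub>R \<i>)" by simp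
      also have "\<dots> = cos x *\<^sub>R f 1 + sin x *\<^sub>R f \<i>"
        by (simp only: linear_add[OF bounded_linear.linear[OF linear]]
            linear_scale[OF bounded_linear.linear[OF linear]])
      finally show ?thesis by simp
    qed
    then have *: "\<phi> x * f (cis x) = f 1 * (\<phi> x * cos x) + f \<i> * (\<phi> x * sin x)" for \<phi> x
      by (simp add: algebra_simps)
    show ?case unfolding * using V_lin V_cos V_sin by blast
  next
    case (const c)
    show ?case using V_lin[where b=0 and a=c] by (auto simp: mult.commute)
  next
    case (add f h)
    show ?case using add V_lin[where a=1 and b=1] by (auto simp: distrib_left)
  next
    case (mult f h)
    show ?case using mult by (auto simp: mult.assoc[symmetric])
  qed
  moreover have "(\<lambda>x. 1) \<in> V"
  proof -
    have "integral\<^sup>L circ (\<lambda>x. g x * cos (real_of_int k * x)) = 0 \<and>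
      integral\<^sup>L circ (\<lambda>x. g x * sin (real_of_int k * x)) = 0" for k
      using c[of "nat k"] s[of "nat k"] c[of "nat (-k)"] s[of "nat (-k)"]
      by (cases "k \<ge> 0") auto
    then show ?thesis by (auto simp: V_def)
  qed
  ultimately have "(\<lambda>x. 1 * p (cis x)) \<in> V" by (rule bspec)
  then show ?thesis unfolding V_def by (auto dest: spec[of _ 0])
qed

text \<open>Polynomials in \<open>cos\<close> and \<open>sin\<close> separate the points of the circle but not those of the interval, so
  uniform approximation takes place on the circle. The lifted function is continuous because the
  preimage of a closed set is the image under \<^const>\<open>cis\<close> of a compact subset of the interval.\<close>

lemma continuous_on_circle_lift:
  fixes \<psi> :: "real \<Rightarrow> real"
  assumes "continuous_on {0..2 * pi} \<psi>" "\<psi> 0 = \<psi> (2 * pi)"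
  shows "continuous_on (sphere 0 1) (\<lambda>z. \<psi> (Arg2pi z))"
    "\<And>x. x \<in> {0..2 * pi} \<Longrightarrow> \<psi> (Arg2pi (cis x)) = \<psi> x"
proof -
  show *: "\<psi> (Arg2pi (cis x)) = \<psi> x" if "x \<in> {0..2 * pi}" for x
  proof (cases "x = 2 * pi")
    case True
    then show ?thesis using assms Arg2pi_of_real[of 1] by (simp)
  next
    case False
    then have "Arg2pi (cis x) = x"
      using that by (intro Arg2pi_unique[of 1]) (auto simp: cis_conv_exp)
    then show ?thesis by simp
  qed
  show "continuous_on (sphere 0 1) (\<lambda>z. \<psi> (Arg2pi z))"
    unfolding continuous_on_closed_vimage[OF closed_sphere]
  proof (intro allI impI)
    fix K :: "real set" assume K: "closed K"
    have "(\<lambda>z. \<psi> (Arg2pi z)) -` K \<inter> sphere 0 1 = cis ` (\<psi> -` K \<inter> {0..2 * pi})" (is "?L = ?R")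
    proof (intro set_eqI iffI)
      fix z assume z: "z \<in> ?L"
      then have "z = cis (Arg2pi z)" using Arg2pi_eq[of z] by (simp add: cis_conv_exp)
      moreover have "Arg2pi z \<in> \<psi> -` K \<inter> {0..2 * pi}"
        using z Arg2pi_ge_0[of z] Arg2pi_lt_2pi[of z] by auto
      ultimately show "z \<in> ?R" by blast
    next
      fix z assume "z \<in> ?R"
      then show "z \<in> ?L" using * by (auto simp: norm_cis)
    qed
    moreover have "closed (\<psi> -` K \<inter> {0..2 * pi})"
      using assms(1) K continuous_on_closed_vimage[of "{0..2 * pi}" \<psi>] by auto
    then have "compact (\<psi> -` K \<inter> {0..2 * pi})"
      by (metis closed_Int_compact compact_Icc inf.right_idem)
    then have "compact (cis ` (\<psi> -` K \<inter> {0..2 * pi}))"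
      by (intro compact_continuous_image continuous_intros)
    ultimately show "closed ((\<lambda>z. \<psi> (Arg2pi z)) -` K \<inter> sphere 0 1)"
      by (metis compact_imp_closed)
  qed
qed

text \<open>Stone-Weierstrass: a uniform approximation of \<open>\<psi>\<close> by polynomials in \<open>cos\<close> and \<open>sin\<close> changes the
  integral by at most its error times the \<open>L\<^sub>1\<close> norm of \<open>g\<close>.\<close>

lemma orthogonal_trig_imp_orthogonal_continuous:
  fixes g \<psi> :: "real \<Rightarrow> real"
  assumes g: "integrable circ g"
    and c: "\<And>k::nat. integral\<^sup>L circ (\<lambda>x. g x * cos (real k * x)) = 0"
    and s: "\<And>k::nat. integral\<^sup>L circ (\<lambda>x. g x * sin (real k * x)) = 0"
    and \<psi>: "continuous_on {0..2 * pi} \<psi>" "\<psi> 0 = \<psi> (2 * pi)"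
  shows "integral\<^sup>L circ (\<lambda>x. g x * \<psi> x) = 0"
proof (rule ccontr)
  define I where "I = \<bar>integral\<^sup>L circ (\<lambda>x. g x * \<psi> x)\<bar>"
  define G where "G = integral\<^sup>L circ (\<lambda>x. \<bar>g x\<bar>)"
  assume "integral\<^sup>L circ (\<lambda>x. g x * \<psi> x) \<noteq> 0"
  then have I: "I > 0" by (simp add: I_def)
  have G: "G \<ge> 0" by (simp add: G_def)
  define e where "e = I / (2 * (G + 1))"
  have e: "e > 0" using I G by (simp add: e_def)
  obtain p where p: "real_polynomial_function p"
    and pe: "\<And>z. z \<in> sphere 0 1 \<Longrightarrow> \<bar>\<psi> (Arg2pi z) - p z\<bar> < e"
    using Stone_Weierstrass_real_polynomial_function[OF compact_sphere continuous_on_circle_lift(1)[OF \<psi>] e]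
    by metis
  have "continuous_on UNIV p"
    using p continuous_on_polymonial_function real_polynomial_function_eq by blast
  then have contp: "continuous_on {0..2 * pi} (\<lambda>x. p (cis x))"
    by (rule continuous_on_compose2) (auto intro: continuous_intros)
  have i1: "integrable circ (\<lambda>x. g x * \<psi> x)" "integrable circ (\<lambda>x. g x * p (cis x))"
    using g \<psi> contp by (auto intro!: integrable_circ_mult_continuous)
  have "I = \<bar>integral\<^sup>L circ (\<lambda>x. g x * \<psi> x - g x * p (cis x))\<bar>"
    using i1 orthogonal_trig_imp_orthogonal_polynomial[OF g c s p] by (simp add: I_def)
  also have "\<dots> \<le> integral\<^sup>L circ (\<lambda>x. \<bar>g x * \<psi> x - g x * p (cis x)\<bar>)"
    using integral_norm_bound[of circ "\<lambda>x. g x * \<psi> x - g x * p (cis x)"] by simp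
  also have "\<dots> \<le> integral\<^sup>L circ (\<lambda>x. e * \<bar>g x\<bar>)"
  proof (rule integral_mono)
    fix x assume "x \<in> space circ"
    then have "\<bar>\<psi> x - p (cis x)\<bar> \<le> e"
      using pe[of "cis x"] continuous_on_circle_lift(2)[OF \<psi>, of x] by (simp add: norm_cis)
    then show "\<bar>g x * \<psi> x - g x * p (cis x)\<bar> \<le> e * \<bar>g x\<bar>"
      by (metis abs_ge_zero abs_mult mult.commute mult_right_mono right_diff_distrib)
  qed (use i1 g in auto)
  also have "\<dots> = e * G" by (simp add: G_def)
  also have "\<dots> \<le> e * (G + 1)" using e by simp
  also have "\<dots> = I / 2" using G by (simp add: e_def field_simps)
  also have "\<dots> < I" using I by simp
  finally show False by simp
qed

text \<open>These cutoffs vanish at both ends of the interval, so a continuous function multiplied by one of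
  them has equal end values.\<close>

lemma tendsto_cutoff:
  fixes x :: real
  assumes "0 < x" "x < 2 * pi"
  shows "(\<lambda>n. min 1 (real n * min x (2 * pi - x))) \<longlonglongrightarrow> 1"
proof (rule tendsto_eventually)
  define d where "d = min x (2 * pi - x)"
  have d: "d > 0" using assms by (simp add: d_def)
  obtain N where "1 < real N * d" using reals_Archimedean3[OF d] by blast
  then have "1 \<le> real n * d" if "n \<ge> N" for n
    using that d by (smt (verit) mult_right_mono of_nat_le_iff)
  then have "eventually (\<lambda>n. 1 \<le> real n * d) sequentially"
    unfolding eventually_sequentially by blast
  then show "\<forall>\<^sub>F n in sequentially. min 1 (real n * min x (2 * pi - x)) = 1"
    by (auto simp: d_def[symmetric] elim!: eventually_mono)
qed

text \<open>The sign of \<open>g\<close> is an almost everywhere limit of continuous functions, which can be taken bounded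
  by \<open>1\<close> and with equal end values. Since \<open>g\<close> is orthogonal to each of them, dominated convergence
  gives \<open>\<integral> |g| = 0\<close>.\<close>

lemma trigonometric_system_complete:
  fixes g :: "real \<Rightarrow> real"
  assumes g: "integrable circ g" and gm: "g \<in> borel_measurable lebesgue"
    and c: "\<And>k::nat. integral\<^sup>L circ (\<lambda>x. g x * cos (real k * x)) = 0"
    and s: "\<And>k::nat. integral\<^sup>L circ (\<lambda>x. g x * sin (real k * x)) = 0"
  shows "AE x in circ. g x = 0"
proof -
  have "(\<lambda>x. sgn (g x)) \<in> borel_measurable lebesgue" using gm by measurable
  then have "(\<lambda>x. sgn (g x)) measurable_on UNIV"
    by (intro lebesgue_measurable_imp_measurable_on) auto
  then obtain N h where N: "negligible N" and h: "\<And>n. continuous_on UNIV (h n)"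
    and lim: "\<And>x. x \<notin> N \<Longrightarrow> (\<lambda>n. h n x) \<longlonglongrightarrow> sgn (g x)"
    unfolding measurable_on_def by force
  define \<psi> where "\<psi> n x = max (-1) (min 1 (h n x)) * max 0 (min 1 (real n * min x (2 * pi - x)))"
    for n :: nat and x
  have contk: "continuous_on {0..2 * pi} (\<psi> n)" for n
    unfolding \<psi>_def by (intro continuous_intros continuous_on_subset[OF h]) auto
  have zero: "integral\<^sup>L circ (\<lambda>x. g x * \<psi> n x) = 0" for n
    by (rule orthogonal_trig_imp_orthogonal_continuous[OF g c s contk]) (simp add: \<psi>_def)
  have bd: "\<bar>\<psi> n x\<bar> \<le> 1" for n x
    unfolding \<psi>_def abs_mult by (intro mult_le_one) auto
  have AE1: "AE x in circ. (\<lambda>n. g x * \<psi> n x) \<longlonglongrightarrow> g x * sgn (g x)"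
  proof -
    have "negligible (N \<union> {0, 2 * pi})" using N by (simp add: negligible_Un)
    then have "AE x in lebesgue. x \<notin> N \<union> {0, 2 * pi}"
      using negligible_iff_null_sets AE_not_in by blast
    then have "AE x in circ. x \<notin> N \<union> {0, 2 * pi}"
      by (subst AE_restrict_space_iff) auto
    moreover have conv: "(\<lambda>n. g x * \<psi> n x) \<longlonglongrightarrow> g x * sgn (g x)"
      if "x \<in> space circ" "x \<notin> N \<union> {0, 2 * pi}" for x
    proof -
      have "(\<lambda>n. \<psi> n x) \<longlonglongrightarrow> max (-1) (min 1 (sgn (g x))) * max 0 1"
        unfolding \<psi>_def using that
        by (intro tendsto_intros lim tendsto_cutoff) auto
      then show ?thesis by (intro tendsto_intros) (auto simp: sgn_if)
    qed
    ultimately show ?thesis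
      by - (erule AE_mp, rule AE_I2, rule impI, rule conv)
  qed
  have gmc: "g \<in> borel_measurable circ" using g by blast
  have "(\<lambda>n. integral\<^sup>L circ (\<lambda>x. g x * \<psi> n x)) \<longlonglongrightarrow> integral\<^sup>L circ (\<lambda>x. g x * sgn (g x))"
  proof (rule integral_dominated_convergence[where w = "\<lambda>x. \<bar>g x\<bar>"])
    show "(\<lambda>x. g x * sgn (g x)) \<in> borel_measurable circ" using gmc by measurable
    show "(\<lambda>x. g x * \<psi> n x) \<in> borel_measurable circ" for n
      using integrable_circ_mult_continuous[OF g contk] by blast
    show "AE x in circ. norm (g x * \<psi> n x) \<le> \<bar>g x\<bar>" for n
      using bd by (auto simp: abs_mult intro!: AE_I2 mult_left_le)
  qed (use g AE1 in auto)
  then have "integral\<^sup>L circ (\<lambda>x. g x * sgn (g x)) = 0"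
    by (simp add: zero LIMSEQ_const_iff)
  moreover have "g x * sgn (g x) = \<bar>g x\<bar>" for x by (simp add: sgn_if)
  ultimately show ?thesis
    using integral_nonneg_eq_0_iff_AE[of circ "\<lambda>x. \<bar>g x\<bar>"] g by simp
qed

section \<open>Absolutely convergent Fourier series\<close>

lemma integral_circ_cos_int: "integral\<^sup>L circ (\<lambda>x. cos (real_of_int k * x)) = (if k = 0 then 2 * pi else 0)"
proof (cases "k = 0")
  case True
  then show ?thesis by (simp add: measure_restrict_space)
next
  case False
  have "((\<lambda>x. cos (real_of_int k * x)) has_integral
     (sin (real_of_int k * (2 * pi)) / k - sin (real_of_int k * 0) / k)) {0..2 * pi}"
    using False by (intro fundamental_theorem_of_calculus)
      (auto intro!: derivative_eq_intros simp flip: has_real_derivative_iff_has_vector_derivative)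
  moreover have "sin (real_of_int k * (2 * pi)) = 0"
    using sin_int_2pin[of k] by (simp add: mult_ac)
  ultimately have "integral {0..2 * pi} (\<lambda>x. cos (real_of_int k * x)) = 0"
    by (simp add: integral_unique)
  moreover have "set_integrable lebesgue {0..2 * pi} (\<lambda>x. cos (real_of_int k * x))"
    by (intro absolutely_integrable_continuous_real continuous_intros)
  ultimately show ?thesis
    using False set_lebesgue_integral_eq_integral(2) LINT_circ by metis
qed

lemma integral_circ_sin_int: "integral\<^sup>L circ (\<lambda>x. sin (real_of_int k * x)) = 0"
proof (cases "k = 0")
  case True
  then show ?thesis by simp
next
  case False
  have "((\<lambda>x. sin (real_of_int k * x)) has_integral
     (- cos (real_of_int k * (2 * pi)) / k - (- cos (real_of_int k * 0) / k))) {0..2 * pi}"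
    using False by (intro fundamental_theorem_of_calculus)
      (auto intro!: derivative_eq_intros simp flip: has_real_derivative_iff_has_vector_derivative)
  moreover have "cos (real_of_int k * (2 * pi)) = 1"
    using cos_int_2pin[of k] by (simp add: mult_ac)
  ultimately have "integral {0..2 * pi} (\<lambda>x. sin (real_of_int k * x)) = 0"
    by (simp add: integral_unique)
  moreover have "set_integrable lebesgue {0..2 * pi} (\<lambda>x. sin (real_of_int k * x))"
    by (intro absolutely_integrable_continuous_real continuous_intros)
  ultimately show ?thesis
    using set_lebesgue_integral_eq_integral(2) LINT_circ by metis
qed

text \<open>The inverse of \<open>u \<mapsto> (fourier_coeff u s)\<^sub>s\<close> on absolutely summable coefficients that vanish at
  \<open>s = 0\<close>: the real part of \<open>c\<^sub>s exp(i s x)\<close> is \<open>c\<^sub>s\<^sup>+ cos(s x) - c\<^sub>s\<^sup>- sin(s x)\<close>.\<close>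

definition trig_series :: "(nat \<Rightarrow> complex) \<Rightarrow> real \<Rightarrow> real" where
  "trig_series c x = (\<Sum>s. Re (c s * cis (real s * x))) / sqrt pi"

lemma abs_Re_mult_cis_le: "\<bar>Re (a * cis y)\<bar> \<le> cmod a"
  using abs_Re_le_cmod[of "a * cis y"] by (simp add: norm_mult)

lemma summable_trig_series:
  assumes "summable (\<lambda>s. cmod (c s))"
  shows "summable (\<lambda>s. Re (c s * cis (real s * x)))"
  by (rule summable_comparison_test'[OF assms]) (simp only: real_norm_def abs_Re_mult_cis_le)

lemma trig_series_bound:
  assumes "summable (\<lambda>s. cmod (c s))"
  shows "\<bar>trig_series c x\<bar> \<le> (\<Sum>s. cmod (c s)) / sqrt pi"
proof -
  have "summable (\<lambda>s. \<bar>Re (c s * cis (real s * x))\<bar>)"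
    by (rule summable_comparison_test'[OF assms]) (simp only: real_norm_def abs_Re_mult_cis_le abs_abs)
  then have "\<bar>\<Sum>s. Re (c s * cis (real s * x))\<bar> \<le> (\<Sum>s. \<bar>Re (c s * cis (real s * x))\<bar>)"
    by (rule summable_rabs)
  also have "\<dots> \<le> (\<Sum>s. cmod (c s))"
    by (intro suminf_le abs_Re_mult_cis_le) fact+
  finally show ?thesis by (simp add: trig_series_def divide_right_mono)
qed

lemma trig_series_add:
  assumes "summable (\<lambda>s. cmod (c s))" "summable (\<lambda>s. cmod (d s))"
  shows "trig_series (\<lambda>s. c s + d s) x = trig_series c x + trig_series d x"
  using suminf_add[OF summable_trig_series[OF assms(1)] summable_trig_series[OF assms(2)], of x x]
  unfolding trig_series_def distrib_right plus_complex.sel add_divide_distrib[symmetric]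
  by simp

lemma trig_series_scale:
  assumes "summable (\<lambda>s. cmod (c s))"
  shows "trig_series (\<lambda>s. complex_of_real t * c s) x = t * trig_series c x"
  using suminf_mult[OF summable_trig_series[OF assms], of t x]
  by (simp add: trig_series_def mult.assoc)

lemma trig_series_periodic: "trig_series c (x + 2 * pi) = trig_series c x"
proof -
  have "cis (real s * (x + 2 * pi)) = cis (real s * x)" for s
    using cis_multiple_2pi[of "real s"] by (simp add: distrib_left cis_mult[symmetric] mult_ac)
  then show ?thesis by (simp add: trig_series_def)
qed

lemma uniformly_convergent_trig_series:
  assumes "summable (\<lambda>s. cmod (c s))"
  shows "uniformly_convergent_on UNIV (\<lambda>n x. \<Sum>s<n. Re (c s * cis (real s * x)))"
  by (rule Weierstrass_m_test'[OF _ assms]) (simp only: real_norm_def abs_Re_mult_cis_le)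

lemma continuous_trig_series:
  assumes "summable (\<lambda>s. cmod (c s))"
  shows "continuous_on S (trig_series c)"
proof -
  have "uniform_limit UNIV (\<lambda>n x. \<Sum>s<n. Re (c s * cis (real s * x))) (\<lambda>x. \<Sum>s. Re (c s * cis (real s * x))) sequentially"
    by (rule Weierstrass_m_test[OF _ assms]) (simp only: real_norm_def abs_Re_mult_cis_le)
  then have "continuous_on UNIV (\<lambda>x. \<Sum>s. Re (c s * cis (real s * x)))"
    by (rule uniform_limit_theorem[rotated])
       (auto intro!: always_eventually continuous_intros)
  then have "continuous_on UNIV (trig_series c)"
    unfolding trig_series_def by (intro continuous_intros) auto
  then show ?thesis using continuous_on_subset by blast
qed

lemma trig_series_has_derivative:
  assumes "summable (\<lambda>s. real s * cmod (c s))"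
  shows "(trig_series c has_real_derivative trig_series (\<lambda>s. \<i> * real s * c s) x) (at x)"
proof -
  have s: "summable (\<lambda>s. cmod (c s))"
    by (rule summable_comparison_test'[OF assms, of 1]) (simp add: mult_le_cancel_right1)
  have s': "summable (\<lambda>s. cmod (\<i> * real s * c s))" using assms by (simp add: norm_mult)
  have "((\<lambda>x. \<Sum>s. Re (c s * cis (real s * x))) has_real_derivative
      (\<Sum>s. Re (\<i> * real s * c s * cis (real s * x)))) (at x)"
  proof (rule has_field_derivative_series'(2)[where S = UNIV and ?x0.0 = 0])
    show "((\<lambda>x. Re (c n * cis (real n * x))) has_real_derivative Re (\<i> * real n * c n * cis (real n * y)))
        (at y within UNIV)" for n y
      by (auto intro!: derivative_eq_intros simp: algebra_simps)
    show "uniformly_convergent_on UNIV (\<lambda>n x. \<Sum>i<n. Re (\<i> * real i * c i * cis (real i * x)))"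
      by (rule uniformly_convergent_trig_series[OF s'])
    show "summable (\<lambda>n. Re (c n * cis (real n * 0)))" by (rule summable_trig_series[OF s])
  qed auto
  then show ?thesis unfolding trig_series_def by (rule DERIV_cdivide)
qed

lemma fourier_coeff_circ:
  "Re (fourier_coeff u s) = integral\<^sup>L circ (\<lambda>x. u x * cos (real s * x)) / sqrt pi"
  "Im (fourier_coeff u s) = - integral\<^sup>L circ (\<lambda>x. u x * sin (real s * x)) / sqrt pi"
  by (simp_all add: fourier_coeff_def LINT_circ)

text \<open>Term-by-term integration. For trigonometric \<open>\<phi>\<close> it gives the Fourier coefficients of the series,
  and for another series its scalar product with the first one.\<close>

lemma trig_series_pairing:
  assumes c: "summable (\<lambda>s. cmod (c s))" and \<phi>: "continuous_on {0..2 * pi} \<phi>"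
  shows "(\<lambda>s. Re (c s * cnj (fourier_coeff \<phi> s))) sums integral\<^sup>L circ (\<lambda>x. trig_series c x * \<phi> x)"
proof -
  define f where "f s x = Re (c s * cis (real s * x)) * \<phi> x / sqrt pi" for s x
  have fint: "integrable circ (f s)" for s
    unfolding f_def by (intro integrable_circ_continuous continuous_intros \<phi>) auto
  have bound: "norm (f s x) \<le> cmod (c s) * (\<bar>\<phi> x\<bar> / sqrt pi)" for s x
  proof -
    have "norm (f s x) = \<bar>Re (c s * cis (real s * x))\<bar> * (\<bar>\<phi> x\<bar> / sqrt pi)"
      unfolding f_def real_norm_def abs_mult abs_divide by simp
    also have "\<dots> \<le> cmod (c s) * (\<bar>\<phi> x\<bar> / sqrt pi)"
      by (intro mult_right_mono abs_Re_mult_cis_le) simp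
    finally show ?thesis .
  qed
  have absphi: "integrable circ (\<lambda>x. \<bar>\<phi> x\<bar> / sqrt pi)"
    by (intro integrable_circ_continuous continuous_intros \<phi>) auto
  have "(\<lambda>s. integral\<^sup>L circ (f s)) sums integral\<^sup>L circ (\<lambda>x. \<Sum>s. f s x)"
  proof (rule sums_integral[OF fint])
    show "AE x in circ. summable (\<lambda>s. norm (f s x))"
    proof (rule AE_I2)
      fix x
      show "summable (\<lambda>s. norm (f s x))"
        by (rule summable_comparison_test'[OF summable_mult2[OF c, of "\<bar>\<phi> x\<bar> / sqrt pi"]])
           (use bound[of _ x] in simp)
    qed
    show "summable (\<lambda>s. integral\<^sup>L circ (\<lambda>x. norm (f s x)))"
    proof (rule summable_comparison_test'[OF summable_mult2[OF c]])
      fix s :: nat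
      have "integral\<^sup>L circ (\<lambda>x. norm (f s x)) \<le> integral\<^sup>L circ (\<lambda>x. cmod (c s) * (\<bar>\<phi> x\<bar> / sqrt pi))"
        using bound by (intro integral_mono integrable_norm fint integrable_mult_right absphi)
      then show "norm (integral\<^sup>L circ (\<lambda>x. norm (f s x))) \<le> cmod (c s) * integral\<^sup>L circ (\<lambda>x. \<bar>\<phi> x\<bar> / sqrt pi)"
        by simp
    qed
  qed
  moreover have "integral\<^sup>L circ (f s) = Re (c s * cnj (fourier_coeff \<phi> s))" for s
  proof -
    define a b where "a = Re (c s) / sqrt pi" and "b = Im (c s) / sqrt pi"
    have f: "f s = (\<lambda>x. a * (\<phi> x * cos (real s * x)) - b * (\<phi> x * sin (real s * x)))"
      by (auto simp: f_def a_def b_def field_simps)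
    have i: "integrable circ (\<lambda>x. \<phi> x * cos (real s * x))" "integrable circ (\<lambda>x. \<phi> x * sin (real s * x))"
      by (intro integrable_circ_continuous continuous_intros \<phi>)+
    have "integral\<^sup>L circ (f s) = a * integral\<^sup>L circ (\<lambda>x. \<phi> x * cos (real s * x))
        - b * integral\<^sup>L circ (\<lambda>x. \<phi> x * sin (real s * x))"
      unfolding f using i by (simp only: Bochner_Integration.integral_diff integrable_mult_right integral_mult_right_zero)
    then show ?thesis by (simp add: fourier_coeff_circ a_def b_def)
  qed
  moreover have "(\<Sum>s. f s x) = trig_series c x * \<phi> x" for x
    using suminf_mult2[OF summable_trig_series[OF c], of x "\<phi> x / sqrt pi"]
    by (simp add: f_def trig_series_def)
  ultimately show ?thesis by simp
qed

lemma fourier_coeff_cos: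
  "fourier_coeff (\<lambda>x. cos (real k * x)) s = (if s = k then (if k = 0 then 2 * sqrt pi else sqrt pi) else 0)"
proof -
  have "2 * pi / sqrt pi = 2 * sqrt pi" by (metis pi_ge_zero real_div_sqrt times_divide_eq_right)
  have "cos (real k * x) * cos (real s * x) = (1/2) * cos (real_of_int (int k + int s) * x) + (1/2) * cos (real_of_int (int k - int s) * x)"
   "cos (real k * x) * sin (real s * x) = (1/2) * sin (real_of_int (int k + int s) * x) - (1/2) * sin (real_of_int (int k - int s) * x)" for x
    by (simp_all add: algebra_simps cos_add cos_diff sin_add sin_diff)
  moreover have "integrable circ (\<lambda>x. cos (real_of_int j * x))" "integrable circ (\<lambda>x. sin (real_of_int j * x))" for j
    by (intro integrable_circ_continuous continuous_intros)+
  ultimately show ?thesis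
    using \<open>2 * pi / sqrt pi = 2 * sqrt pi\<close>
    by (auto simp: complex_eq_iff fourier_coeff_circ integral_circ_cos_int integral_circ_sin_int real_div_sqrt
         simp del: of_int_add of_int_diff)
qed

lemma fourier_coeff_sin:
  "fourier_coeff (\<lambda>x. sin (real k * x)) s = (if s = k \<and> k \<noteq> 0 then - \<i> * sqrt pi else 0)"
proof -
  have "sin (real k * x) * sin (real s * x) = (1/2) * cos (real_of_int (int k - int s) * x) - (1/2) * cos (real_of_int (int k + int s) * x)"
   "sin (real k * x) * cos (real s * x) = (1/2) * sin (real_of_int (int k + int s) * x) + (1/2) * sin (real_of_int (int k - int s) * x)" for x
    by (simp_all add: algebra_simps cos_add cos_diff sin_add sin_diff)
  moreover have "integrable circ (\<lambda>x. cos (real_of_int j * x))" "integrable circ (\<lambda>x. sin (real_of_int j * x))" for j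
    by (intro integrable_circ_continuous continuous_intros)+
  ultimately show ?thesis
    by (auto simp: complex_eq_iff fourier_coeff_circ integral_circ_cos_int integral_circ_sin_int real_div_sqrt
         simp del: of_int_add of_int_diff)
qed

lemma fourier_coeff_trig_series:
  assumes c: "summable (\<lambda>s. cmod (c s))" and s: "s \<ge> 1"
  shows "fourier_coeff (trig_series c) s = c s"
proof -
  have "(\<lambda>k. Re (c k * cnj (fourier_coeff (\<lambda>x. cos (real s * x)) k))) sums integral\<^sup>L circ (\<lambda>x. trig_series c x * cos (real s * x))"
    by (intro trig_series_pairing c continuous_intros)
  moreover have "(\<lambda>k. Re (c k * cnj (fourier_coeff (\<lambda>x. cos (real s * x)) k))) = (\<lambda>k. if k = s then sqrt pi * Re (c k) else 0)"
    using s by (auto simp: fourier_coeff_cos)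
  moreover note sums_single[of s "\<lambda>k. sqrt pi * Re (c k)"]
  ultimately have 1: "integral\<^sup>L circ (\<lambda>x. trig_series c x * cos (real s * x)) = sqrt pi * Re (c s)"
    by (simp add: sums_unique2)
  have "(\<lambda>k. Re (c k * cnj (fourier_coeff (\<lambda>x. sin (real s * x)) k))) sums integral\<^sup>L circ (\<lambda>x. trig_series c x * sin (real s * x))"
    by (intro trig_series_pairing c continuous_intros)
  moreover have "(\<lambda>k. Re (c k * cnj (fourier_coeff (\<lambda>x. sin (real s * x)) k))) = (\<lambda>k. if k = s then - sqrt pi * Im (c k) else 0)"
    using s by (auto simp: fourier_coeff_sin)
  moreover note sums_single[of s "\<lambda>k. - sqrt pi * Im (c k)"]
  ultimately have 2: "integral\<^sup>L circ (\<lambda>x. trig_series c x * sin (real s * x)) = - sqrt pi * Im (c s)"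
    by (simp add: sums_unique2)
  show ?thesis using 1 2 by (simp add: complex_eq_iff fourier_coeff_circ)
qed

lemma integral_trig_series:
  assumes c: "summable (\<lambda>s. cmod (c s))" and "c 0 = 0"
  shows "integral\<^sup>L circ (trig_series c) = 0"
proof -
  have "(\<lambda>k. Re (c k * cnj (fourier_coeff (\<lambda>x. cos (real 0 * x)) k))) sums integral\<^sup>L circ (\<lambda>x. trig_series c x * cos (real 0 * x))"
    by (intro trig_series_pairing c continuous_intros)
  moreover have "(\<lambda>k. Re (c k * cnj (fourier_coeff (\<lambda>x. cos (real 0 * x)) k))) = (\<lambda>k. 0)"
    unfolding fourier_coeff_cos using assms by auto
  ultimately show ?thesis using sums_unique2[OF sums_zero] by fastforce
qed

lemma parseval_trig_series:
  assumes "summable (\<lambda>s. cmod (c s))" "summable (\<lambda>s. cmod (d s))" "c 0 = 0"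
  shows "(\<lambda>s. Re (c s * cnj (d s))) sums integral\<^sup>L circ (\<lambda>x. trig_series c x * trig_series d x)"
proof -
  have "Re (c s * cnj (fourier_coeff (trig_series d) s)) = Re (c s * cnj (d s))" for s
    using assms fourier_coeff_trig_series[OF assms(2), of s] by (cases "s = 0") auto
  then show ?thesis
    using trig_series_pairing[OF assms(1) continuous_trig_series[OF assms(2)]] by simp
qed

section \<open>Sobolev norms and the KdV hamiltonian of a Fourier series\<close>

lemma L2_circle_integrable:
  assumes "u \<in> L2_circle"
  shows "integrable circ u" "integrable circ (\<lambda>x. (u x)\<^sup>2)" "u \<in> borel_measurable lebesgue"
proof -
  show m: "u \<in> borel_measurable lebesgue" using assms by (simp add: L2_circle_def)
  show sq: "integrable circ (\<lambda>x. (u x)\<^sup>2)"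
    using assms by (simp add: L2_circle_def set_integrable_circ)
  have mc: "u \<in> borel_measurable circ" using m by (simp add: measurable_restrict_space1)
  show "integrable circ u"
  proof (rule Bochner_Integration.integrable_bound)
    show "integrable circ (\<lambda>x. 1 + (u x)\<^sup>2)"
      by (rule Bochner_Integration.integrable_add[OF integrable_circ_continuous sq]) simp
    show "AE x in circ. norm (u x) \<le> norm (1 + (u x)\<^sup>2)"
    proof (rule AE_I2)
      fix x
      have "0 \<le> (\<bar>u x\<bar> - 1)\<^sup>2" by simp
      then have "2 * \<bar>u x\<bar> \<le> 1 + (u x)\<^sup>2" by (simp add: power2_diff)
      then show "norm (u x) \<le> norm (1 + (u x)\<^sup>2)" by simp
    qed
  qed (rule mc)
qed

text \<open>Completeness in the form in which it is used: the Fourier coefficients and the mean value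
  determine every integral over the circle.\<close>

lemma same_fourier_coeff_imp_AE_eq:
  assumes u: "u \<in> L2_circle" and w: "w \<in> L2_circle"
    and mean: "integral\<^sup>L circ u = integral\<^sup>L circ w"
    and eq: "\<And>s. s \<ge> 1 \<Longrightarrow> fourier_coeff u s = fourier_coeff w s"
  shows "AE x in circ. u x = w x"
proof -
  note iu = L2_circle_integrable[OF u] and iw = L2_circle_integrable[OF w]
  have ic: "integrable circ (\<lambda>x. v x * cos (real k * x))" "integrable circ (\<lambda>x. v x * sin (real k * x))"
    if "integrable circ v" for v and k :: nat
    using that by (auto intro!: integrable_circ_mult_continuous continuous_intros)
  have c: "integral\<^sup>L circ (\<lambda>x. u x * cos (real k * x)) = integral\<^sup>L circ (\<lambda>x. w x * cos (real k * x))"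
    "integral\<^sup>L circ (\<lambda>x. u x * sin (real k * x)) = integral\<^sup>L circ (\<lambda>x. w x * sin (real k * x))" for k :: nat
  proof -
    have "Re (fourier_coeff u k) = Re (fourier_coeff w k) \<and> Im (fourier_coeff u k) = Im (fourier_coeff w k)"
      if "k \<noteq> 0" using eq[of k] that by simp
    then show "integral\<^sup>L circ (\<lambda>x. u x * cos (real k * x)) = integral\<^sup>L circ (\<lambda>x. w x * cos (real k * x))"
      "integral\<^sup>L circ (\<lambda>x. u x * sin (real k * x)) = integral\<^sup>L circ (\<lambda>x. w x * sin (real k * x))"
      using mean by (auto simp: fourier_coeff_circ) (cases "k = 0"; simp)+
  qed
  have "AE x in circ. u x - w x = 0"
    by (rule trigonometric_system_complete)
       (use iu iw ic[OF iu(1)] ic[OF iw(1)] c in \<open>auto simp: left_diff_distrib\<close>)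
  then show ?thesis by simp
qed

lemma circle_L2_norm_circ: "circle_L2_norm u = sqrt (integral\<^sup>L circ (\<lambda>x. (u x)\<^sup>2))"
  by (simp add: circle_L2_norm_def LINT_circ)

lemma integral_sq_cong_AE:
  assumes "u \<in> L2_circle" "w \<in> L2_circle" "AE x in circ. u x = w x"
  shows "integral\<^sup>L circ (\<lambda>x. (u x)\<^sup>2) = integral\<^sup>L circ (\<lambda>x. (w x)\<^sup>2)"
  using assms L2_circle_integrable(2)[THEN borel_measurable_integrable]
  by (intro integral_cong_AE) auto

text \<open>Any representative of \<open>(-\<Delta>)\<^sup>m\<^sup>/\<^sup>2 u\<close> computes the norm, since two of them agree almost everywhere.\<close>

lemma H0_norm_eq:
  assumes "is_laplacian_power m u w"
  shows "H0_norm m u = circle_L2_norm w"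
proof -
  define w' where "w' = (SOME w. is_laplacian_power m u w)"
  have w': "is_laplacian_power m u w'" unfolding w'_def using someI[of "is_laplacian_power m u", OF assms] .
  have "AE x in circ. w' x = w x"
    using assms w' by (intro same_fourier_coeff_imp_AE_eq)
      (auto simp: is_laplacian_power_def L2_circle0_def LINT_circ)
  then have "circle_L2_norm w' = circle_L2_norm w"
    using assms w' integral_sq_cong_AE[of w' w]
    by (auto simp: circle_L2_norm_circ is_laplacian_power_def L2_circle0_def)
  then show ?thesis by (simp add: H0_norm_def w'_def)
qed

lemma continuous_periodic_L2_circle:
  assumes "continuous_on UNIV u" "\<And>x. u (x + 2 * pi) = u x"
  shows "u \<in> L2_circle"
proof -
  have "integrable circ (\<lambda>x. (u x)\<^sup>2)"
    by (intro integrable_circ_continuous continuous_intros continuous_on_subset[OF assms(1)]) auto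
  moreover have "u \<in> borel_measurable lebesgue"
    using assms(1) by (simp add: borel_measurable_continuous_onI measurable_completion)
  ultimately show ?thesis using assms(2) by (simp add: L2_circle_def set_integrable_circ)
qed

lemma trig_series_L2_circle:
  assumes "summable (\<lambda>s. cmod (c s))"
  shows "trig_series c \<in> L2_circle"
  using continuous_periodic_L2_circle continuous_trig_series[OF assms] trig_series_periodic by blast

lemma trig_series_L2_circle0:
  assumes "summable (\<lambda>s. cmod (c s))" "c 0 = 0"
  shows "trig_series c \<in> L2_circle0"
  using trig_series_L2_circle integral_trig_series assms by (simp add: L2_circle0_def LINT_circ)

lemma weighted_summable_imp_summable:
  fixes c :: "nat \<Rightarrow> complex"
  assumes "m \<ge> 0" "c 0 = 0" "summable (\<lambda>s. real s powr m * cmod (c s))"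
  shows "summable (\<lambda>s. cmod (c s))"
proof (rule summable_comparison_test'[OF assms(3)])
  fix s :: nat
  have "1 * cmod (c s) \<le> real s powr m * cmod (c s)" if "s \<noteq> 0"
    using that assms(1) by (intro mult_right_mono ge_one_powr_ge_zero) auto
  then show "norm (cmod (c s)) \<le> real s powr m * cmod (c s)"
    using assms(2) by (cases "s = 0") auto
qed

lemma laplacian_power_trig_series:
  fixes c :: "nat \<Rightarrow> complex"
  assumes "m \<ge> 0" "c 0 = 0" "summable (\<lambda>s. real s powr m * cmod (c s))"
  shows "is_laplacian_power m (trig_series c) (trig_series (\<lambda>s. real s powr m * c s))"
  using assms weighted_summable_imp_summable[OF assms]
  by (auto simp: is_laplacian_power_def norm_mult fourier_coeff_trig_series intro!: trig_series_L2_circle0)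

lemma trig_series_in_H0:
  fixes c :: "nat \<Rightarrow> complex"
  assumes "m \<ge> 0" "c 0 = 0" "summable (\<lambda>s. real s powr m * cmod (c s))"
  shows "trig_series c \<in> H0 m"
  using laplacian_power_trig_series[OF assms] trig_series_L2_circle0[OF weighted_summable_imp_summable[OF assms] assms(2)]
  by (auto simp: H0_def)

text \<open>The \<open>L\<^sub>2\<close> norm is at most \<open>(2\<pi>)\<^sup>1\<^sup>/\<^sup>2\<close> times the supremum, which the sum of the moduli of the
  coefficients bounds.\<close>

lemma H0_norm_trig_series_le:
  fixes c :: "nat \<Rightarrow> complex"
  assumes "m \<ge> 0" "c 0 = 0" "summable (\<lambda>s. real s powr m * cmod (c s))"
  shows "H0_norm m (trig_series c) \<le> sqrt 2 * (\<Sum>s. real s powr m * cmod (c s))"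
proof -
  define d where "d s = complex_of_real (real s powr m) * c s" for s
  define S where "S = (\<Sum>s. real s powr m * cmod (c s))"
  have nd: "cmod (d s) = real s powr m * cmod (c s)" for s by (simp add: d_def norm_mult)
  have sd: "summable (\<lambda>s. cmod (d s))" using assms by (simp add: nd)
  have S0: "S \<ge> 0" unfolding S_def by (intro suminf_nonneg assms) auto
  have "(trig_series d x)\<^sup>2 \<le> S\<^sup>2 / pi" for x
  proof -
    have "\<bar>trig_series d x\<bar> \<le> S / sqrt pi" using trig_series_bound[OF sd] by (simp add: nd S_def)
    then have "(trig_series d x)\<^sup>2 \<le> (S / sqrt pi)\<^sup>2" by (metis abs_ge_zero power2_abs power_mono)
    then show ?thesis by (simp add: power_divide)
  qed
  then have "integral\<^sup>L circ (\<lambda>x. (trig_series d x)\<^sup>2) \<le> integral\<^sup>L circ (\<lambda>x. S\<^sup>2 / pi)"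
    by (intro integral_mono L2_circle_integrable(2)[OF trig_series_L2_circle[OF sd]] integrable_circ_continuous continuous_on_const)
  also have "\<dots> = 2 * S\<^sup>2" by (simp add: measure_restrict_space)
  finally have "circle_L2_norm (trig_series d) \<le> sqrt (2 * S\<^sup>2)"
    by (simp add: circle_L2_norm_circ)
  also have "\<dots> = sqrt 2 * S" using S0 by (simp add: real_sqrt_mult)
  finally show ?thesis
    using H0_norm_eq[OF laplacian_power_trig_series[OF assms]] by (simp add: S_def d_def[abs_def])
qed

lemma H0_norm_0_trig_series:
  assumes "c 0 = 0" "summable (\<lambda>s. cmod (c s))"
  shows "H0_norm 0 (trig_series c) = sqrt (\<Sum>s. (cmod (c s))\<^sup>2)"
proof -
  have "is_laplacian_power 0 (trig_series c) (trig_series c)"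
    using assms by (auto simp: is_laplacian_power_def intro!: trig_series_L2_circle0)
  then have "H0_norm 0 (trig_series c) = circle_L2_norm (trig_series c)" by (rule H0_norm_eq)
  also have "\<dots> = sqrt (\<Sum>s. (cmod (c s))\<^sup>2)"
  proof -
    have "Re (c s * cnj (c s)) = (cmod (c s))\<^sup>2" for s
      by (metis Re_complex_of_real complex_norm_square)
    then show ?thesis using parseval_trig_series[OF assms(2) assms(2,1)] 
      by (simp add: circle_L2_norm_circ sums_iff power2_eq_square)
  qed
  finally show ?thesis .
qed

lemma smooth_periodic_trig:
  assumes "\<And>x. \<phi> x = a * cos (real k * x) + b * sin (real k * x)"
  shows "smooth_periodic \<phi>"
proof -
  have d: "\<exists>a b. \<forall>x. (deriv ^^ n) \<phi> x = a * cos (real k * x) + b * sin (real k * x)" for n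
  proof (induction n)
    case 0
    then show ?case using assms by auto
  next
    case (Suc n)
    then obtain a b where ab: "(deriv ^^ n) \<phi> = (\<lambda>x. a * cos (real k * x) + b * sin (real k * x))" by blast
    have "((deriv ^^ n) \<phi> has_real_derivative (b * k) * cos (real k * x) + (- a * k) * sin (real k * x)) (at x)" for x
      unfolding ab by (auto intro!: derivative_eq_intros simp: algebra_simps)
    then have "(deriv ^^ Suc n) \<phi> x = (b * k) * cos (real k * x) + (- a * k) * sin (real k * x)" for x
      by (simp add: DERIV_imp_deriv)
    then show ?case by blast
  qed
  have "(deriv ^^ n) \<phi> differentiable at x" for n x
  proof -
    obtain a b where ab: "(deriv ^^ n) \<phi> = (\<lambda>x. a * cos (real k * x) + b * sin (real k * x))" using d by blast
    have "((deriv ^^ n) \<phi> has_real_derivative (b * k) * cos (real k * x) + (- a * k) * sin (real k * x)) (at x)"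
      unfolding ab by (auto intro!: derivative_eq_intros simp: algebra_simps)
    then show ?thesis by (auto simp: real_differentiable_def)
  qed
  moreover have "\<phi> (x + 2 * pi) = \<phi> x" for x
  proof -
    have "cis (real k * (x + 2 * pi)) = cis (real k * x)"
      using cis_multiple_2pi[of "real k"] by (simp add: distrib_left cis_mult[symmetric] mult_ac)
    then show ?thesis by (simp add: assms cis.ctr)
  qed
  ultimately show ?thesis by (simp add: smooth_periodic_def)
qed

lemma smooth_periodic_C1:
  assumes "smooth_periodic \<phi>"
  shows "\<And>x. (\<phi> has_real_derivative deriv \<phi> x) (at x)" "continuous_on UNIV (deriv \<phi>)" "continuous_on UNIV \<phi>"
proof -
  have d: "\<phi> differentiable at x" "deriv \<phi> differentiable at x" for x
  proof -
    have "(deriv ^^ 0) \<phi> differentiable at x" "(deriv ^^ Suc 0) \<phi> differentiable at x"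
      using assms unfolding smooth_periodic_def by blast+
    then show "\<phi> differentiable at x" "deriv \<phi> differentiable at x" by simp_all
  qed
  show "(\<phi> has_real_derivative deriv \<phi> x) (at x)" for x
    using d(1) by (metis DERIV_deriv_iff_real_differentiable)
  show "continuous_on UNIV (deriv \<phi>)" "continuous_on UNIV \<phi>"
    using d by (auto intro!: continuous_at_imp_continuous_on differentiable_imp_continuous_within)
qed

text \<open>The series and its test function are both \<open>C\<^sup>1\<close>, so this is integration by parts over a period.\<close>

lemma trig_series_has_weak_deriv:
  assumes "summable (\<lambda>s. real s * cmod (c s))"
  shows "has_weak_deriv (trig_series c) (trig_series (\<lambda>s. \<i> * real s * c s))"
  unfolding has_weak_deriv_def LINT_circ
proof (intro conjI allI impI)
  define u' where "u' = trig_series (\<lambda>s. \<i> * real s * c s)"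
  have s': "summable (\<lambda>s. cmod (\<i> * real s * c s))" using assms by (simp add: norm_mult)
  show "trig_series (\<lambda>s. \<i> * real s * c s) \<in> L2_circle" by (rule trig_series_L2_circle[OF s'])
  fix \<phi> assume \<phi>: "smooth_periodic \<phi>"
  note C1 = smooth_periodic_C1[OF \<phi>]
  have u: "(trig_series c has_real_derivative u' x) (at x)" for x
    unfolding u'_def by (rule trig_series_has_derivative[OF assms])
  have cu: "continuous_on UNIV (trig_series c)"
    using u by (auto intro!: continuous_at_imp_continuous_on DERIV_isCont)
  have cu': "continuous_on UNIV u'" unfolding u'_def by (rule continuous_trig_series[OF s'])
  have per: "\<phi> (2 * pi) = \<phi> 0" "trig_series c (2 * pi) = trig_series c 0"
    using \<phi> trig_series_periodic[of c 0] by (auto simp: smooth_periodic_def dest: spec[of _ 0])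
  have "((\<lambda>x. trig_series c x * deriv \<phi> x + u' x * \<phi> x) has_integral (trig_series c (2 * pi) * \<phi> (2 * pi) - trig_series c 0 * \<phi> 0)) {0..2 * pi}"
  proof (rule fundamental_theorem_of_calculus)
    fix x
    have "((\<lambda>x. trig_series c x * \<phi> x) has_real_derivative (trig_series c x * deriv \<phi> x + u' x * \<phi> x)) (at x)"
      using DERIV_mult[OF u C1(1)] by (simp add: add.commute mult.commute)
    then show "((\<lambda>x. trig_series c x * \<phi> x) has_vector_derivative (trig_series c x * deriv \<phi> x + u' x * \<phi> x)) (at x within {0..2 * pi})"
      by (simp add: has_real_derivative_iff_has_vector_derivative has_vector_derivative_at_within)
  qed simp
  then have 0: "integral {0..2 * pi} (\<lambda>x. trig_series c x * deriv \<phi> x + u' x * \<phi> x) = 0"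
    using per by (simp add: integral_unique)
  have cc: "continuous_on {0..2 * pi} (\<lambda>x. trig_series c x * deriv \<phi> x)" "continuous_on {0..2 * pi} (\<lambda>x. u' x * \<phi> x)"
    by (intro continuous_intros continuous_on_subset[OF cu] continuous_on_subset[OF cu']
        continuous_on_subset[OF C1(2)] continuous_on_subset[OF C1(3)]; simp)+
  have "set_integrable lebesgue {0..2 * pi} (\<lambda>x. trig_series c x * deriv \<phi> x + u' x * \<phi> x)"
    by (intro absolutely_integrable_continuous_real continuous_on_add cc)
  then have "integral\<^sup>L circ (\<lambda>x. trig_series c x * deriv \<phi> x + u' x * \<phi> x) = 0"
    using 0 set_lebesgue_integral_eq_integral(2) LINT_circ by metis
  then show "integral\<^sup>L circ (\<lambda>x. trig_series c x * deriv \<phi> x) =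
      - integral\<^sup>L circ (\<lambda>x. trig_series (\<lambda>s. \<i> * real s * c s) x * \<phi> x)"
    using cc[THEN integrable_circ_continuous] by (simp add: u'_def)
qed

text \<open>Constants, cosines and sines are admissible test functions, so all Fourier coefficients and the
  mean value of a weak derivative are determined.\<close>

lemma weak_deriv_unique:
  assumes v: "has_weak_deriv u v" and w: "has_weak_deriv u w"
  shows "AE x in circ. v x = w x"
proof (rule same_fourier_coeff_imp_AE_eq)
  have eq: "integral\<^sup>L circ (\<lambda>x. v x * \<phi> x) = integral\<^sup>L circ (\<lambda>x. w x * \<phi> x)" if "smooth_periodic \<phi>" for \<phi>
  proof -
    have "integral\<^sup>L circ (\<lambda>x. u x * deriv \<phi> x) = - integral\<^sup>L circ (\<lambda>x. v x * \<phi> x)"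
      using v that unfolding has_weak_deriv_def LINT_circ by blast
    moreover have "integral\<^sup>L circ (\<lambda>x. u x * deriv \<phi> x) = - integral\<^sup>L circ (\<lambda>x. w x * \<phi> x)"
      using w that unfolding has_weak_deriv_def LINT_circ by blast
    ultimately show ?thesis by linarith
  qed
  show "v \<in> L2_circle" "w \<in> L2_circle" using v w by (auto simp: has_weak_deriv_def)
  have "smooth_periodic (\<lambda>x. 1)" by (rule smooth_periodic_trig[where k=0 and a=1 and b=0]) simp
  from eq[OF this] show "integral\<^sup>L circ v = integral\<^sup>L circ w" by simp
  fix s :: nat
  have "smooth_periodic (\<lambda>x. cos (real s * x))" by (rule smooth_periodic_trig[where k=s and a=1 and b=0]) simp
  moreover have "smooth_periodic (\<lambda>x. sin (real s * x))" by (rule smooth_periodic_trig[where k=s and a=0 and b=1]) simp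
  ultimately show "fourier_coeff v s = fourier_coeff w s"
    by (simp add: complex_eq_iff fourier_coeff_circ eq)
qed

lemma h_KdV_trig_series:
  assumes "summable (\<lambda>s. real s * cmod (c s))" "c 0 = 0"
  shows "h_KdV (trig_series c) = - (1 / 8) * integral\<^sup>L circ (\<lambda>x. (trig_series (\<lambda>s. \<i> * real s * c s) x)\<^sup>2)
     + integral\<^sup>L circ (\<lambda>x. (trig_series c x) ^ 3)"
proof -
  define w where "w = trig_series (\<lambda>s. \<i> * real s * c s)"
  have w: "has_weak_deriv (trig_series c) w" unfolding w_def by (rule trig_series_has_weak_deriv[OF assms(1)])
  have wd: "has_weak_deriv (trig_series c) (weak_deriv (trig_series c))"
    unfolding weak_deriv_def using someI[of "has_weak_deriv (trig_series c)", OF w] .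
  have AE: "AE x in circ. weak_deriv (trig_series c) x = w x" by (rule weak_deriv_unique[OF wd w])
  have L2: "w \<in> L2_circle" "weak_deriv (trig_series c) \<in> L2_circle" using w wd by (auto simp: has_weak_deriv_def)
  have "summable (\<lambda>s. cmod (c s))"
    using assms by (intro weighted_summable_imp_summable[of 1]) auto
  then have i3: "integrable circ (\<lambda>x. (trig_series c x) ^ 3)"
    by (intro integrable_circ_continuous continuous_intros continuous_trig_series)
  note i2 = L2_circle_integrable(2)[OF L2(1)] L2_circle_integrable(2)[OF L2(2)]
  have "h_KdV (trig_series c) = - (1 / 8) * integral\<^sup>L circ (\<lambda>x. (weak_deriv (trig_series c) x)\<^sup>2) + integral\<^sup>L circ (\<lambda>x. (trig_series c x) ^ 3)"
    unfolding h_KdV_def LINT_circ using i3 i2 by (subst Bochner_Integration.integral_add) auto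
  then show ?thesis using integral_sq_cong_AE[OF L2(2,1) AE] by (simp add: w_def)
qed

section \<open>Power series expansions of analytic germs, coordinate by coordinate\<close>

lemma hseq_component_le:
  assumes "v \<in> hseq r"
  shows "real j powr r * cmod (v j) \<le> hseq_norm r v"
proof -
  have s: "summable (\<lambda>j. real j powr (2 * r) * (cmod (v j))\<^sup>2)" using assms by (simp add: hseq_def)
  have "(real j powr r * cmod (v j))\<^sup>2 = real j powr (2 * r) * (cmod (v j))\<^sup>2"
    by (simp add: power_mult_distrib power2_eq_square powr_add[symmetric])
  also have "\<dots> \<le> (\<Sum>j. real j powr (2 * r) * (cmod (v j))\<^sup>2)"
    using sum_le_suminf[OF s, of "{j}"] by simp
  finally show ?thesis unfolding hseq_norm_def by (rule real_le_rsqrt)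
qed

lemma hseq_diff:
  assumes "v \<in> hseq r" "w \<in> hseq r"
  shows "(\<lambda>j. v j - w j) \<in> hseq r"
proof -
  have "summable (\<lambda>j. 2 * (real j powr (2 * r) * (cmod (v j))\<^sup>2) + 2 * (real j powr (2 * r) * (cmod (w j))\<^sup>2))"
    using assms by (intro summable_add summable_mult) (auto simp: hseq_def)
  then have "summable (\<lambda>j. real j powr (2 * r) * (cmod (v j - w j))\<^sup>2)"
  proof (rule summable_comparison_test')
    fix j :: nat
    have "(cmod (v j - w j))\<^sup>2 \<le> (cmod (v j) + cmod (w j))\<^sup>2"
      by (intro power_mono norm_triangle_ineq4) auto
    also have "\<dots> \<le> 2 * (cmod (v j))\<^sup>2 + 2 * (cmod (w j))\<^sup>2"
      using zero_le_power2[of "cmod (v j) - cmod (w j)"] by (simp add: power2_sum power2_diff)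
    finally have "real j powr (2 * r) * (cmod (v j - w j))\<^sup>2 \<le> real j powr (2 * r) * (2 * (cmod (v j))\<^sup>2 + 2 * (cmod (w j))\<^sup>2)"
      by (intro mult_left_mono) auto
    then show "norm (real j powr (2 * r) * (cmod (v j - w j))\<^sup>2)
        \<le> 2 * (real j powr (2 * r) * (cmod (v j))\<^sup>2) + 2 * (real j powr (2 * r) * (cmod (w j))\<^sup>2)"
      by (simp add: algebra_simps)
  qed
  then show ?thesis using assms by (simp add: hseq_def)
qed

lemma hseq_diff_sum:
  fixes w :: "nat \<Rightarrow> nat \<Rightarrow> complex"
  assumes "v \<in> hseq r" "\<And>n. w n \<in> hseq r"
  shows "(\<lambda>j. v j - (\<Sum>n<N. w n j)) \<in> hseq r"
proof (induction N)
  case (Suc N)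
  then show ?case using hseq_diff[OF Suc assms(2)[of N]] by (simp add: algebra_simps)
qed (use assms in simp)

text \<open>The weight \<open>w\<close> will be the weight of one coordinate in the norm of \<open>h\<^sup>r\<close>. The constant \<open>2\<close> bounds
  \<open>1 / (1 - q)\<close>.\<close>

lemma geometric_tail_bound:
  fixes a :: "nat \<Rightarrow> complex"
  assumes a: "a sums s" and bd: "\<And>n. w * cmod (a n) \<le> B * q ^ n"
    and w: "w \<ge> 0" and q: "0 \<le> q" "q \<le> 1/2" and B: "B \<ge> 0"
  shows "w * cmod (s - (\<Sum>n<k. a n)) \<le> 2 * B * q ^ k"
proof -
  have "(\<lambda>n. a (n + k)) sums (s - (\<Sum>n<k. a n))" using a by (simp add: sums_iff_shift)
  then have s: "(\<lambda>n. w *\<^sub>R a (n + k)) sums (w *\<^sub>R (s - (\<Sum>n<k. a n)))" by (rule sums_scaleR_right)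
  have g: "(\<lambda>n. B * q ^ k * q ^ n) sums (B * q ^ k * (1 / (1 - q)))"
    using q by (intro sums_mult geometric_sums) auto
  have "norm (\<Sum>n. w *\<^sub>R a (n + k)) \<le> (\<Sum>n. B * q ^ k * q ^ n)"
  proof (rule norm_suminf_le)
    show "norm (w *\<^sub>R a (n + k)) \<le> B * q ^ k * q ^ n" for n
      using bd[of "n + k"] w by (simp add: power_add mult_ac)
  qed (use g in \<open>auto simp: sums_iff\<close>)
  then have "w * cmod (s - (\<Sum>n<k. a n)) \<le> B * q ^ k * (1 / (1 - q))"
    using s g w by (simp add: sums_iff)
  also have "\<dots> \<le> B * q ^ k * 2"
    using q B by (intro mult_left_mono) (auto simp: field_simps)
  finally show ?thesis by simp
qed

lemma multilinear_on_combination: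
  assumes M: "multilinear_on n X Y M" and n: "length ps + length qs + 1 = n"
    and X: "set ps \<subseteq> X" "set qs \<subseteq> X" "y \<in> X" "z \<in> X"
  shows "M (ps @ (\<lambda>t. a *\<^sub>R y t + b *\<^sub>R z t) # qs) =
    (\<lambda>t. a *\<^sub>R M (ps @ y # qs) t + b *\<^sub>R M (ps @ z # qs) t)"
proof -
  have "length (ps @ y # qs) = n \<and> set (ps @ y # qs) \<subseteq> X" "length ps < n" using n X by auto
  then have "M ((ps @ y # qs)[length ps := (\<lambda>t. a *\<^sub>R y t + b *\<^sub>R z t)]) =
     (\<lambda>t. a *\<^sub>R M ((ps @ y # qs)[length ps := y]) t + b *\<^sub>R M ((ps @ y # qs)[length ps := z]) t)"
    using M X unfolding multilinear_on_def by blast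
  then show ?thesis by simp
qed

lemma multilinear_on_replicate_scale:
  fixes M :: "('a \<Rightarrow> real) list \<Rightarrow> 'c \<Rightarrow> 'd::real_vector"
  assumes M: "multilinear_on n X Y M" and u: "u \<in> X" "(\<lambda>x. t * u x) \<in> X"
  shows "M (replicate n (\<lambda>x. t * u x)) = (\<lambda>j. t ^ n *\<^sub>R M (replicate n u) j)"
proof -
  have "i \<le> n \<Longrightarrow> M (replicate i (\<lambda>x. t * u x) @ replicate (n - i) u) = (\<lambda>j. t ^ i *\<^sub>R M (replicate n u) j)" for i
  proof (induction i)
    case (Suc i)
    have e: "replicate (n - i) u = u # replicate (n - Suc i) u"
      using Suc.prems by (metis Suc_diff_Suc Suc_le_lessD replicate_Suc)
    have "M (replicate (Suc i) (\<lambda>x. t * u x) @ replicate (n - Suc i) u) =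
      M (replicate i (\<lambda>x. t * u x) @ (\<lambda>x. t *\<^sub>R u x + 0 *\<^sub>R u x) # replicate (n - Suc i) u)"
      by (simp add: replicate_append_same[symmetric])
    also have "\<dots> = (\<lambda>j. t *\<^sub>R M (replicate i (\<lambda>x. t * u x) @ u # replicate (n - Suc i) u) j +
         0 *\<^sub>R M (replicate i (\<lambda>x. t * u x) @ u # replicate (n - Suc i) u) j)"
      by (rule multilinear_on_combination[OF M]) (use Suc.prems u in auto)
    also have "\<dots> = (\<lambda>j. t ^ Suc i *\<^sub>R M (replicate n u) j)"
      using Suc by (simp add: e[symmetric])
    finally show ?case .
  qed simp
  from this[of n] show ?thesis by simp
qed

text \<open>An analytic germ into \<open>h\<^sup>r\<close>, with the convergence of its power series read one coordinate at a
  time. The norm bounds on the \<open>n\<close>-linear terms control the coordinate \<open>j\<close> with weight \<open>j\<^sup>r\<close>, which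
  makes each coordinate a numerical series dominated by a geometric one.\<close>

locale germ_expansion =
  fixes X :: "(real \<Rightarrow> real) set" and nX :: "(real \<Rightarrow> real) \<Rightarrow> real" and r :: real
    and F :: "(real \<Rightarrow> real) \<Rightarrow> nat \<Rightarrow> complex"
    and M :: "nat \<Rightarrow> (real \<Rightarrow> real) list \<Rightarrow> nat \<Rightarrow> complex" and B R \<delta> :: real
  assumes nX_nonneg: "\<And>u. u \<in> X \<Longrightarrow> nX u \<ge> 0"
    and zero_X: "(\<lambda>_. 0) \<in> X" "nX (\<lambda>_. 0) = 0"
    and F_zero: "F (\<lambda>_. 0) = (\<lambda>_. 0)"
    and pos: "B \<ge> 0" "R > 0" "\<delta> > 0"
    and multilinear: "\<And>n. multilinear_on n X (hseq r) (M n)"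
    and M_norm: "\<And>n xs. length xs = n \<Longrightarrow> set xs \<subseteq> X \<Longrightarrow> hseq_norm r (M n xs) \<le> B * R ^ n * prod_list (map nX xs)"
    and F_hseq: "\<And>u. u \<in> X \<Longrightarrow> nX u < \<delta> \<Longrightarrow> F u \<in> hseq r"
    and expansion: "\<And>u j. u \<in> X \<Longrightarrow> nX u < \<delta> \<Longrightarrow> (\<lambda>n. M n (replicate n u) j) sums F u j"
begin

lemma M_hseq: "length xs = n \<Longrightarrow> set xs \<subseteq> X \<Longrightarrow> M n xs \<in> hseq r"
  using multilinear[of n] unfolding multilinear_on_def by blast

lemma M_component:
  assumes "length xs = n" "set xs \<subseteq> X"
  shows "real j powr r * cmod (M n xs j) \<le> B * R ^ n * prod_list (map nX xs)"
  using hseq_component_le[OF M_hseq[OF assms], of j] M_norm[OF assms] by linarith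

lemma M_0_index: "length xs = n \<Longrightarrow> set xs \<subseteq> X \<Longrightarrow> M n xs 0 = 0"
  using M_hseq by (auto simp: hseq_def)

lemma tail_bound:
  assumes u: "u \<in> X" "nX u < \<delta>" "R * nX u \<le> 1/2"
  shows "real j powr r * cmod (F u j - (\<Sum>n<k. M n (replicate n u) j)) \<le> 2 * B * (R * nX u) ^ k"
proof (rule geometric_tail_bound[OF expansion[OF u(1,2)]])
  show "real j powr r * cmod (M n (replicate n u) j) \<le> B * (R * nX u) ^ n" for n
    using M_component[of "replicate n u" n j] u
    by (simp add: map_replicate_const power_mult_distrib set_replicate_conv_if mult.assoc split: if_splits)
qed (use u pos nX_nonneg[OF u(1)] in auto)

lemma M0_eq_0: "M 0 [] j = 0"
proof (cases "j = 0")
  case True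
  then show ?thesis using M_0_index[of "[]" 0] by simp
next
  case False
  have "real j powr r * cmod (M 0 [] j) \<le> 0"
    using tail_bound[OF zero_X(1), of j 1] zero_X pos F_zero by (simp add: fun_eq_iff)
  then show ?thesis using False by (simp add: mult_le_0_iff not_le)
qed

text \<open>The linear term of the expansion is the derivative at the origin, so it vanishes along a line on
  which \<open>F\<close> is of smaller order than its argument. Both orders are compared in the single
  coordinate \<open>j\<close>.\<close>

lemma M1_eq_0:
  assumes u: "u \<in> X" "\<And>t. (\<lambda>x. t * u x) \<in> X" "\<And>t. nX (\<lambda>x. t * u x) \<le> \<bar>t\<bar> * K"
    and small: "\<And>\<epsilon>. \<epsilon> > 0 \<Longrightarrow> \<exists>\<eta>>0. \<forall>v\<in>X. nX v < \<eta> \<longrightarrow> cmod (F v j) \<le> \<epsilon> * nX v"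
  shows "M 1 [u] j = 0"
proof (cases "j = 0")
  case True
  then show ?thesis using M_0_index[of "[u]" 1] u by simp
next
  case False
  define w where "w = real j powr r"
  have w: "w > 0" using False by (simp add: w_def)
  define K1 where "K1 = \<bar>K\<bar> + 1"
  have K1: "K1 > 0" by (simp add: K1_def)
  have nt: "nX (\<lambda>x. t * u x) \<le> t * K1" if "t > 0" for t
  proof -
    have "nX (\<lambda>x. t * u x) \<le> t * K" using u(3)[of t] that by simp
    also have "t * K \<le> t * K1" using that by (intro mult_left_mono) (auto simp: K1_def)
    finally show ?thesis .
  qed
  have "w * cmod (M 1 [u] j) \<le> 0 + e" if e: "e > 0" for e
  proof -
    define \<epsilon> where "\<epsilon> = e / (2 * w * K1)"
    have \<epsilon>: "\<epsilon> > 0" using e w K1 by (simp add: \<epsilon>_def)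
    obtain \<eta> where \<eta>: "\<eta> > 0" "\<And>v. v \<in> X \<Longrightarrow> nX v < \<eta> \<Longrightarrow> cmod (F v j) \<le> \<epsilon> * nX v" using small[OF \<epsilon>] by blast
    define D where "D = 2 * B * (R * K1)\<^sup>2 + 1"
    have D: "D > 0" using pos by (simp add: D_def add_nonneg_pos)
    \<comment> \<open>The first three entries keep \<open>t u\<close> where the smallness and the expansion apply, the last one
        makes the quadratic remainder small against \<open>e\<close>.\<close>
    define t where "t = Min {\<eta> / (2 * K1), \<delta> / (2 * K1), 1 / (2 * R * K1), e / (2 * D)}"
    have t: "t > 0" using \<eta> pos K1 e D by (simp add: t_def)
    have tle: "t \<le> \<eta> / (2 * K1)" "t \<le> \<delta> / (2 * K1)" "t \<le> 1 / (2 * R * K1)" "t \<le> e / (2 * D)"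
      by (simp_all add: t_def)
    have tle': "t * K1 < \<eta>" "t * K1 < \<delta>" "R * (t * K1) \<le> 1/2" "t * D \<le> e / 2"
      using tle \<eta> pos K1 D by (auto simp: field_simps)
    define v where "v x = t * u x" for x
    have v: "v \<in> X" "nX v \<le> t * K1" using u(2)[of t] nt[OF t] by (simp_all add: v_def[abs_def])
    have v0: "nX v \<ge> 0" using nX_nonneg[OF v(1)] .
    have Rv: "R * nX v \<le> R * (t * K1)" using v pos by simp
    have "M 1 [v] j = t *\<^sub>R M 1 [u] j"
      using fun_cong[OF multilinear_on_replicate_scale[OF multilinear[of 1] u(1) u(2)[of t]], of j]
      by (simp add: v_def[abs_def])
    then have "w * cmod (F v j - t *\<^sub>R M 1 [u] j) \<le> 2 * B * (R * nX v)\<^sup>2"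
      using tail_bound[OF v(1), of j 2] v Rv tle' M0_eq_0 by (simp add: w_def numeral_2_eq_2)
    also have "\<dots> \<le> 2 * B * (R * (t * K1))\<^sup>2"
      using Rv v0 pos by (intro mult_left_mono power_mono) auto
    also have "\<dots> \<le> t * (t * D)" using t by (simp add: D_def power_mult_distrib power2_eq_square algebra_simps)
    also have "\<dots> \<le> t * (e / 2)" using t tle' by (intro mult_left_mono) auto
    finally have 1: "w * cmod (F v j - t *\<^sub>R M 1 [u] j) \<le> t * (e / 2)" .
    have "cmod (F v j) \<le> \<epsilon> * nX v" using \<eta> v tle' by auto
    also have "\<dots> \<le> \<epsilon> * (t * K1)" using v \<epsilon> by simp
    finally have "w * cmod (F v j) \<le> w * (\<epsilon> * (t * K1))" using w by simp
    also have "\<dots> = t * (e / 2)" using w K1 by (simp add: \<epsilon>_def)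
    finally have 2: "w * cmod (F v j) \<le> t * (e / 2)" .
    have "cmod (t *\<^sub>R M 1 [u] j) \<le> cmod (F v j) + cmod (F v j - t *\<^sub>R M 1 [u] j)"
      using norm_triangle_ineq4[of "F v j" "F v j - t *\<^sub>R M 1 [u] j"] by simp
    then have "w * cmod (t *\<^sub>R M 1 [u] j) \<le> w * (cmod (F v j) + cmod (F v j - t *\<^sub>R M 1 [u] j))"
      using w by simp
    also have "\<dots> \<le> t * e" using 1 2 by (simp add: distrib_left)
    finally have "t * (w * cmod (M 1 [u] j)) \<le> t * e" using t by (simp add: mult_ac)
    then show ?thesis using t by simp
  qed
  then have "w * cmod (M 1 [u] j) \<le> 0" by (rule field_le_epsilon)
  then show ?thesis using w by (simp add: mult_le_0_iff not_le)
qed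

text \<open>The arguments \<open>a\<close> are replaced by \<open>b\<close> one at a time; each of the \<open>n + 1\<close> replacements puts
  \<open>a - b\<close> into one slot, which contributes the factor \<open>e\<close>. The count \<open>n + 1 \<le> 2\<^sup>n\<close> is absorbed into the geometric factor.\<close>

lemma M_diff_bound:
  assumes a: "a \<in> X" "nX a \<le> \<rho>" and b: "b \<in> X" "nX b \<le> \<rho>"
    and d: "(\<lambda>x. a x - b x) \<in> X" "nX (\<lambda>x. a x - b x) \<le> e"
  shows "real j powr r * cmod (M (Suc n) (replicate (Suc n) a) j - M (Suc n) (replicate (Suc n) b) j)
    \<le> (B * R * e) * (2 * (R * \<rho>)) ^ n"
proof -
  define d' where "d' x = a x - b x" for x
  have d': "d' \<in> X" "nX d' \<le> e" "nX d' \<ge> 0" using d nX_nonneg[OF d(1)] by (simp_all add: d'_def[abs_def])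
  have \<rho>: "\<rho> \<ge> 0" "e \<ge> 0" using nX_nonneg[OF a(1)] a(2) d' by linarith+
  define w where "w = real j powr r"
  define m where "m i = M (Suc n) (replicate i a @ replicate (Suc n - i) b) j" for i
  have step: "w * cmod (m (Suc i) - m i) \<le> B * R ^ Suc n * (\<rho> ^ n * e)" if "i \<le> n" for i
  proof -
    have l: "replicate (Suc n - i) b = b # replicate (n - i) b" using that by (simp add: Suc_diff_le)
    have l2: "replicate (Suc i) a = replicate i a @ [a]" by (simp add: replicate_append_same)
    have "M (Suc n) (replicate i a @ (\<lambda>x. 1 *\<^sub>R a x + (-1) *\<^sub>R b x) # replicate (n - i) b) =
      (\<lambda>j. 1 *\<^sub>R M (Suc n) (replicate i a @ a # replicate (n - i) b) j + (-1) *\<^sub>R M (Suc n) (replicate i a @ b # replicate (n - i) b) j)"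
      by (rule multilinear_on_combination[OF multilinear]) (use that a b in auto)
    then have "M (Suc n) (replicate i a @ d' # replicate (n - i) b) j = m (Suc i) - m i"
      unfolding m_def l l2 by (simp add: d'_def[abs_def] fun_eq_iff)
    then have "w * cmod (m (Suc i) - m i) \<le> B * R ^ Suc n * prod_list (map nX (replicate i a @ d' # replicate (n - i) b))"
      using M_component[of "replicate i a @ d' # replicate (n - i) b" "Suc n" j] that a b d'
      by (auto simp: w_def set_replicate_conv_if)
    also have "prod_list (map nX (replicate i a @ d' # replicate (n - i) b)) = nX a ^ i * (nX d' * nX b ^ (n - i))"
      by (simp add: map_replicate_const)
    also have "\<dots> \<le> \<rho> ^ i * (e * \<rho> ^ (n - i))"
      using a b d' nX_nonneg \<rho> by (intro mult_mono power_mono) auto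
    also have "\<dots> = \<rho> ^ n * e" using that by (simp add: mult_ac power_add[symmetric])
    finally show ?thesis using pos by (simp add: mult_left_mono)
  qed
  have "M (Suc n) (replicate (Suc n) a) j - M (Suc n) (replicate (Suc n) b) j = (\<Sum>i<Suc n. m (Suc i) - m i)"
    by (subst sum_lessThan_telescope) (simp add: m_def)
  then have "w * cmod (M (Suc n) (replicate (Suc n) a) j - M (Suc n) (replicate (Suc n) b) j)
      \<le> w * (\<Sum>i<Suc n. cmod (m (Suc i) - m i))"
    by (simp only:) (intro mult_left_mono norm_sum; simp add: w_def)
  also have "\<dots> \<le> (\<Sum>i<Suc n. B * R ^ Suc n * (\<rho> ^ n * e))"
    unfolding sum_distrib_left by (intro sum_mono step) auto
  also have "\<dots> = real (Suc n) * (B * R ^ Suc n * (\<rho> ^ n * e))" by simp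
  also have "\<dots> \<le> 2 ^ n * (B * R ^ Suc n * (\<rho> ^ n * e))"
  proof (rule mult_right_mono)
    have "Suc n \<le> 2 ^ n" by (induction n) auto
    then show "real (Suc n) \<le> 2 ^ n" by (metis of_nat_le_iff of_nat_numeral of_nat_power)
    show "0 \<le> B * R ^ Suc n * (\<rho> ^ n * e)" using pos \<rho> d' by simp
  qed
  also have "\<dots> = (B * R * e) * (2 * (R * \<rho>)) ^ n" by (simp add: power_mult_distrib mult_ac)
  finally show ?thesis by (simp add: w_def)
qed

text \<open>A germ without linear term is Lipschitz on the ball of radius \<open>\<rho>\<close>, with a constant proportional to
  \<open>\<rho>\<close>: this smallness drives the contraction argument.\<close>

lemma lipschitz_bound:
  assumes a: "a \<in> X" "nX a \<le> \<rho>" and b: "b \<in> X" "nX b \<le> \<rho>"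
    and d: "(\<lambda>x. a x - b x) \<in> X" "nX (\<lambda>x. a x - b x) \<le> e"
    and \<rho>: "\<rho> < \<delta>" "R * \<rho> \<le> 1/4" and lin: "M 1 [a] j = 0" "M 1 [b] j = 0"
  shows "real j powr r * cmod (F a j - F b j) \<le> 4 * B * R\<^sup>2 * \<rho> * e"
proof -
  have \<rho>0: "\<rho> \<ge> 0" "e \<ge> 0" using nX_nonneg[OF a(1)] a(2) nX_nonneg[OF d(1)] d(2) by linarith+
  define D where "D n = M n (replicate n a) j - M n (replicate n b) j" for n
  have "D sums (F a j - F b j)" unfolding D_def
    using a b \<rho> by (intro sums_diff expansion) auto
  moreover have "D 0 = 0" by (simp add: D_def)
  ultimately have "(\<lambda>n. D (Suc n)) sums (F a j - F b j)" by (simp add: sums_Suc_iff)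
  then have "real j powr r * cmod (F a j - F b j - (\<Sum>n<1. D (Suc n))) \<le> 2 * (B * R * e) * (2 * (R * \<rho>)) ^ 1"
    by (rule geometric_tail_bound)
       (use M_diff_bound[OF a b d] pos \<rho> \<rho>0 in \<open>auto simp: D_def\<close>)
  moreover have "D 1 = 0" using lin by (simp add: D_def)
  ultimately show ?thesis by (simp add: power2_eq_square mult_ac)
qed

end

lemma analytic_germ_expansion:
  assumes F: "analytic_germ X nX (hseq r) (hseq_norm r) F"
    and X: "\<And>u. u \<in> X \<Longrightarrow> nX u \<ge> 0" "(\<lambda>_. 0) \<in> X" "nX (\<lambda>_. 0) = 0"
  obtains M B R \<delta> where "germ_expansion X nX r F M B R \<delta>"
proof -
  from F[unfolded analytic_germ_def, THEN conjunct2] obtain M C R \<delta> where M: "R > 0 \<and> \<delta> > 0 \<and>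
        (\<forall>n. multilinear_on n X (hseq r) (M n)) \<and>
        (\<forall>n xs. length xs = n \<and> set xs \<subseteq> X \<longrightarrow>
           hseq_norm r (M n xs) \<le> C * R ^ n * prod_list (map nX xs)) \<and>
        (\<forall>u\<in>X. nX u < \<delta> \<longrightarrow> F u \<in> hseq r \<and>
           (\<lambda>N. hseq_norm r (\<lambda>t. F u t - (\<Sum>n<N. M n (replicate n u) t))) \<longlonglongrightarrow> 0)"
    by (elim exE)
  have pos: "R > 0" "\<delta> > 0" and ml: "\<And>n. multilinear_on n X (hseq r) (M n)"
    and nm: "\<And>n xs. length xs = n \<Longrightarrow> set xs \<subseteq> X \<Longrightarrow> hseq_norm r (M n xs) \<le> C * R ^ n * prod_list (map nX xs)"
    and F_in: "\<And>u. u \<in> X \<Longrightarrow> nX u < \<delta> \<Longrightarrow> F u \<in> hseq r"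
    and conv: "\<And>u. u \<in> X \<Longrightarrow> nX u < \<delta> \<Longrightarrow>
           (\<lambda>N. hseq_norm r (\<lambda>t. F u t - (\<Sum>n<N. M n (replicate n u) t))) \<longlonglongrightarrow> 0"
    using M by auto
  have F0: "F (\<lambda>_. 0) = (\<lambda>_. 0)" using F unfolding analytic_germ_def by (rule conjunct1)
  have "germ_expansion X nX r F M \<bar>C\<bar> R \<delta>"
  proof
    fix n xs assume xs: "length xs = n" "set xs \<subseteq> X"
    have "0 \<le> prod_list (map nX xs)" using xs(2) X(1) by (induction xs arbitrary: n) auto
    then have "C * (R ^ n * prod_list (map nX xs)) \<le> \<bar>C\<bar> * (R ^ n * prod_list (map nX xs))"
      using pos by (intro mult_right_mono) auto
    then show "hseq_norm r (M n xs) \<le> \<bar>C\<bar> * R ^ n * prod_list (map nX xs)"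
      using nm[OF xs] by (simp add: mult.assoc)
  next
    fix u j assume u: "u \<in> X" "nX u < \<delta>"
    have Min: "M n (replicate n u) \<in> hseq r" for n
      using ml[of n] u unfolding multilinear_on_def by (auto simp: set_replicate_conv_if)
    show "(\<lambda>n. M n (replicate n u) j) sums F u j"
    proof (cases "j = 0")
      case True
      then show ?thesis using F_in[OF u] Min by (simp add: hseq_def)
    next
      case False
      then have w: "real j powr r > 0" by simp
      have "(\<lambda>N. real j powr r * cmod (F u j - (\<Sum>n<N. M n (replicate n u) j))) \<longlonglongrightarrow> 0"
        by (rule tendsto_sandwich[OF _ _ tendsto_const conv[OF u]])
           (auto intro!: always_eventually hseq_component_le[OF hseq_diff_sum[OF F_in[OF u] Min]])
      then have "(\<lambda>N. inverse (real j powr r) * (real j powr r * cmod (F u j - (\<Sum>n<N. M n (replicate n u) j)))) \<longlonglongrightarrow> inverse (real j powr r) * 0"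
        by (intro tendsto_mult tendsto_const)
      moreover have "inverse (real j powr r) * (real j powr r * y) = y" for y using w by simp
      ultimately have "(\<lambda>N. cmod (F u j - (\<Sum>n<N. M n (replicate n u) j))) \<longlonglongrightarrow> 0" by simp
      then have "(\<lambda>N. F u j - (F u j - (\<Sum>n<N. M n (replicate n u) j))) \<longlonglongrightarrow> F u j - 0"
        by (intro tendsto_diff tendsto_const) (simp add: tendsto_norm_zero_iff)
      then show ?thesis by (simp add: sums_def)
    qed
  qed (use X pos ml F_in F0 in auto)
  then show ?thesis by (rule that)
qed

section \<open>The antipodal point and the cubic identity\<close>

text \<open>Coefficients whose series converges absolutely together with its derivative. The
  sum is a \<open>C\<^sup>1\<close> function, to which all the analysis on the circle applies pointwise.\<close>

definition C1_coeffs :: "(nat \<Rightarrow> complex) \<Rightarrow> bool" where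
  "C1_coeffs c \<longleftrightarrow> c 0 = 0 \<and> summable (\<lambda>s. real s * cmod (c s))"

definition C1_norm :: "(nat \<Rightarrow> complex) \<Rightarrow> real" where
  "C1_norm c = (\<Sum>s. real s * cmod (c s))"

lemma C1_coeffs_summable: "C1_coeffs c \<Longrightarrow> summable (\<lambda>s. cmod (c s))"
  using weighted_summable_imp_summable[of 1 c] by (simp add: C1_coeffs_def)

lemma C1_coeffs_summable_deriv: "C1_coeffs c \<Longrightarrow> summable (\<lambda>s. cmod (\<i> * real s * c s))"
  by (simp add: C1_coeffs_def norm_mult)

lemma C1_norm_nonneg: "C1_coeffs c \<Longrightarrow> C1_norm c \<ge> 0"
  unfolding C1_norm_def C1_coeffs_def by (intro suminf_nonneg) auto

lemma C1_coeffs_scale: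
  assumes "C1_coeffs c"
  shows "C1_coeffs (\<lambda>s. complex_of_real t * c s)" "C1_norm (\<lambda>s. complex_of_real t * c s) = \<bar>t\<bar> * C1_norm c"
proof -
  have e: "real s * cmod (complex_of_real t * c s) = \<bar>t\<bar> * (real s * cmod (c s))" for s
    by (simp add: norm_mult)
  show "C1_coeffs (\<lambda>s. complex_of_real t * c s)" using assms summable_mult[of _ "\<bar>t\<bar>"] by (simp add: C1_coeffs_def e)
  show "C1_norm (\<lambda>s. complex_of_real t * c s) = \<bar>t\<bar> * C1_norm c"
    using assms by (simp add: C1_norm_def e suminf_mult C1_coeffs_def)
qed

lemma C1_coeffs_add:
  assumes "C1_coeffs c" "C1_coeffs d"
  shows "C1_coeffs (\<lambda>s. c s + d s)" "C1_norm (\<lambda>s. c s + d s) \<le> C1_norm c + C1_norm d"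
proof -
  have b: "real s * cmod (c s + d s) \<le> real s * cmod (c s) + real s * cmod (d s)" for s
    by (simp add: distrib_left[symmetric] mult_left_mono norm_triangle_ineq)
  have s: "summable (\<lambda>s. real s * cmod (c s) + real s * cmod (d s))"
    using assms by (intro summable_add) (auto simp: C1_coeffs_def)
  have s2: "summable (\<lambda>s. real s * cmod (c s + d s))"
    by (rule summable_comparison_test'[OF s]) (use b in auto)
  then show "C1_coeffs (\<lambda>s. c s + d s)" using assms by (simp add: C1_coeffs_def)
  show "C1_norm (\<lambda>s. c s + d s) \<le> C1_norm c + C1_norm d"
    using suminf_le[OF b s2 s] suminf_add[of "\<lambda>s. real s * cmod (c s)" "\<lambda>s. real s * cmod (d s)"] assms
    by (simp add: C1_norm_def C1_coeffs_def)
qed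

lemma C1_coeffs_diff:
  assumes "C1_coeffs c" "C1_coeffs d"
  shows "C1_coeffs (\<lambda>s. c s - d s)"
  using C1_coeffs_add(1)[OF assms(1) C1_coeffs_scale(1)[OF assms(2), of "-1"]] by simp

text \<open>Bounded sequences \<open>z\<close> serve as coordinates on coefficients of size \<open>O(s\<^sup>-\<^sup>1\<^sup>-\<^sup>\<kappa>)\<close>. These include
  \<open>T\<^sup>-\<^sup>1\<close> of \<open>h\<^sup>3\<^sup>/\<^sup>2\<^sup>+\<^sup>\<kappa>\<close>, the target of \<open>\<Psi> - T\<close> at \<open>m = 1\<close>, and for \<open>\<kappa> > 1\<close> they have finite
  \<open>C1_norm\<close>, because \<open>\<Sum> s\<^sup>-\<^sup>\<kappa>\<close> converges.\<close>

definition weighted_coeffs :: "real \<Rightarrow> (nat \<Rightarrow>\<^sub>C complex) \<Rightarrow> nat \<Rightarrow> complex" where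
  "weighted_coeffs \<kappa> z s = complex_of_real (real s powr (- 1 - \<kappa>)) * apply_bcontfun z s"

lemma weighted_coeffs_C1:
  assumes \<kappa>: "\<kappa> > 1"
  shows "C1_coeffs (\<lambda>s. weighted_coeffs \<kappa> z s - weighted_coeffs \<kappa> z' s)"
    "C1_norm (\<lambda>s. weighted_coeffs \<kappa> z s - weighted_coeffs \<kappa> z' s) \<le> (\<Sum>s. real s powr (- \<kappa>)) * dist z z'"
proof -
  have sk: "summable (\<lambda>s. real s powr (- \<kappa>))" using \<kappa> by (simp add: summable_real_powr_iff)
  have b: "real s * cmod (weighted_coeffs \<kappa> z s - weighted_coeffs \<kappa> z' s) \<le> real s powr (- \<kappa>) * dist z z'" for s
  proof -
    have "real s * real s powr (- 1 - \<kappa>) = real s powr (- \<kappa>)"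
      by (cases "s = 0") (simp_all add: powr_mult_base)
    moreover have "cmod (weighted_coeffs \<kappa> z s - weighted_coeffs \<kappa> z' s) = real s powr (- 1 - \<kappa>) * dist (apply_bcontfun z s) (apply_bcontfun z' s)"
      by (simp add: weighted_coeffs_def dist_norm norm_mult right_diff_distrib[symmetric])
    ultimately have "real s * cmod (weighted_coeffs \<kappa> z s - weighted_coeffs \<kappa> z' s) = real s powr (- \<kappa>) * dist (apply_bcontfun z s) (apply_bcontfun z' s)"
      by (simp add: mult.assoc[symmetric])
    then show ?thesis by (simp add: mult_left_mono dist_bounded)
  qed
  have s: "summable (\<lambda>s. real s * cmod (weighted_coeffs \<kappa> z s - weighted_coeffs \<kappa> z' s))"
    by (rule summable_comparison_test'[OF summable_mult2[OF sk, of "dist z z'"]]) (use b in auto)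
  then show "C1_coeffs (\<lambda>s. weighted_coeffs \<kappa> z s - weighted_coeffs \<kappa> z' s)"
    by (simp add: C1_coeffs_def weighted_coeffs_def)
  show "C1_norm (\<lambda>s. weighted_coeffs \<kappa> z s - weighted_coeffs \<kappa> z' s) \<le> (\<Sum>s. real s powr (- \<kappa>)) * dist z z'"
    unfolding C1_norm_def using suminf_le[OF b s summable_mult2[OF sk]] suminf_mult2[OF sk, of "dist z z'"] by simp
qed

lemma weighted_coeffs_0: "weighted_coeffs \<kappa> 0 = (\<lambda>s. 0)"
  by (simp add: weighted_coeffs_def fun_eq_iff)

text \<open>The topology of \<^typ>\<open>nat\<close> is discrete, so that \<^typ>\<open>nat \<Rightarrow>\<^sub>C complex\<close> is the space of bounded
  complex sequences.\<close>

lemma complete_bounded_sequences: "complete (UNIV :: (nat \<Rightarrow>\<^sub>C complex) set)"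
proof (rule completeI)
  fix z :: "nat \<Rightarrow> nat \<Rightarrow>\<^sub>C complex" assume z: "Cauchy z"
  have "uniformly_Cauchy_on UNIV (\<lambda>n. apply_bcontfun (z n))"
    unfolding uniformly_Cauchy_on_def
  proof (intro allI impI)
    fix e :: real assume "e > 0"
    then obtain k where "\<And>m n. m \<ge> k \<Longrightarrow> n \<ge> k \<Longrightarrow> dist (z m) (z n) < e"
      using z[unfolded Cauchy_def] by meson
    then show "\<exists>k. \<forall>s\<in>UNIV. \<forall>m\<ge>k. \<forall>n\<ge>k. dist (apply_bcontfun (z m) s) (apply_bcontfun (z n) s) < e"
      by (intro exI[of _ k]) (auto intro: le_less_trans[OF dist_bounded])
  qed
  then obtain l where "uniform_limit UNIV (\<lambda>n. apply_bcontfun (z n)) l sequentially"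
    using Cauchy_uniformly_convergent uniformly_convergent_on_def by blast
  then show "\<exists>l\<in>UNIV. z \<longlonglongrightarrow> l"
    using uniform_limit_bcontfunE[OF _ sequentially_bot] by blast
qed

text \<open>In terms of coefficients, \<open>p\<close> is the map \<open>\<Psi> - T\<close>, and the equation on \<open>e\<close> says
  \<open>\<Psi>(- t c + e) = - \<Psi>(t c)\<close>. It is a fixed point equation for \<open>z\<close>, where \<open>e\<^sub>s = s\<^sup>-\<^sup>1\<^sup>-\<^sup>\<kappa> z\<^sub>s\<close>. On the ball of
  radius \<open>t\<close> all arguments of \<open>p\<close> have size of order \<open>t\<close>, so the map is a contraction for small \<open>t\<close>,
  and its values have size of order \<open>t\<^sup>2\<close>, which is the size of the solution.\<close>

lemma antipodal_solution:
  fixes p :: "(nat \<Rightarrow> complex) \<Rightarrow> nat \<Rightarrow> complex"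
  assumes \<kappa>: "\<kappa> > 1" and \<Lambda>: "\<Lambda> \<ge> 0" "\<rho>0 > 0" and p0: "\<And>j. p (\<lambda>_. 0) j = 0"
    and lip: "\<And>c d \<rho> j. C1_coeffs c \<Longrightarrow> C1_coeffs d \<Longrightarrow> C1_norm c \<le> \<rho> \<Longrightarrow> C1_norm d \<le> \<rho> \<Longrightarrow> \<rho> \<le> \<rho>0 \<Longrightarrow>
       real j powr (3/2 + \<kappa>) * cmod (p c j - p d j) \<le> \<Lambda> * \<rho> * C1_norm (\<lambda>s. c s - d s)"
    and c: "C1_coeffs c"
  obtains t0 L where "t0 > 0" "L \<ge> 0"
    "\<And>t. 0 < t \<Longrightarrow> t \<le> t0 \<Longrightarrow> \<exists>e. C1_coeffs e \<and> C1_norm e \<le> L * t\<^sup>2 \<and>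
       (\<forall>j\<ge>1. e j = - complex_of_real (real j powr (1/2)) *
          (p (\<lambda>s. complex_of_real t * c s) j + p (\<lambda>s. complex_of_real (- t) * c s + e s) j))"
proof -
  define \<sigma> where "\<sigma> = (\<Sum>s. real s powr (- \<kappa>))"
  have sk: "summable (\<lambda>s. real s powr (- \<kappa>))" using \<kappa> by (simp add: summable_real_powr_iff)
  have \<sigma>: "\<sigma> \<ge> 0" unfolding \<sigma>_def by (intro suminf_nonneg sk) auto
  define A where "A = C1_norm c + \<sigma> + 1"
  have A: "A > 0" using \<sigma> C1_norm_nonneg[OF c] by (simp add: A_def)
  define L where "L = 2 * \<Lambda> * A\<^sup>2"
  have L: "L \<ge> 0" using \<Lambda> by (simp add: L_def)
  define Q where "Q = \<Lambda> * A * \<sigma>"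
  have Q: "Q \<ge> 0" using \<Lambda> A \<sigma> by (simp add: Q_def)
  \<comment> \<open>In turn: the arguments stay in the domain of the Lipschitz bound, the ball of radius \<open>t\<close> is
      mapped into itself, and the contraction factor is at most \<open>1/2\<close>.\<close>
  define t0 where "t0 = Min {\<rho>0 / A, 1 / (L + 1), 1 / (2 * (Q + 1))}"
  have t0: "t0 > 0" using \<Lambda> A L Q by (simp add: t0_def)
  have main: "\<exists>e. C1_coeffs e \<and> C1_norm e \<le> (\<sigma> * L) * t\<^sup>2 \<and>
       (\<forall>j\<ge>1. e j = - complex_of_real (real j powr (1/2)) *
          (p (\<lambda>s. complex_of_real t * c s) j + p (\<lambda>s. complex_of_real (- t) * c s + e s) j))"
    if t: "0 < t" "t \<le> t0" for t
  proof -
    have tle: "t \<le> \<rho>0 / A" "t \<le> 1 / (L + 1)" "t \<le> 1 / (2 * (Q + 1))" using t(2) by (simp_all add: t0_def)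
    have t1: "t * A \<le> \<rho>0" using tle(1) A by (simp add: field_simps)
    have t2: "L * t \<le> 1"
    proof -
      have "t * (L + 1) \<le> 1" using tle(2) L by (simp add: field_simps)
      then show ?thesis using t by (simp add: algebra_simps)
    qed
    have t3: "Q * t \<le> 1/2"
    proof -
      have "t * (2 * (Q + 1)) \<le> 1" using tle(3) Q by (simp add: field_simps)
      then show ?thesis using t by (simp add: algebra_simps)
    qed
    define E where "E = weighted_coeffs \<kappa>"
    define w where "w z = (\<lambda>s. complex_of_real (- t) * c s + E z s)" for z
    define tc where "tc = (\<lambda>s. complex_of_real t * c s)"
    have E: "C1_coeffs (E z)" "C1_norm (E z) \<le> \<sigma> * norm z" for z
      using weighted_coeffs_C1[OF \<kappa>, of z 0] by (simp_all add: E_def weighted_coeffs_0 \<sigma>_def)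
    have tc: "C1_coeffs tc" "C1_norm tc \<le> t * A"
      using C1_coeffs_scale[OF c, of t] t \<sigma> by (simp_all add: tc_def A_def mult_left_mono)
    have w: "C1_coeffs (w z)" "norm z \<le> t \<Longrightarrow> C1_norm (w z) \<le> t * A" for z
    proof -
      show "C1_coeffs (w z)" unfolding w_def by (intro C1_coeffs_add C1_coeffs_scale c E)
      assume z: "norm z \<le> t"
      have "C1_norm (w z) \<le> \<bar>-t\<bar> * C1_norm c + C1_norm (E z)"
        unfolding w_def C1_coeffs_scale(2)[OF c, symmetric] by (intro C1_coeffs_add C1_coeffs_scale c E)
      also have "C1_norm (E z) \<le> \<sigma> * t" using E(2)[of z] \<sigma> z by (meson mult_left_mono order_trans)
      finally show "C1_norm (w z) \<le> t * A" using t \<sigma> by (simp add: A_def algebra_simps)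
    qed
    have zero: "C1_coeffs (\<lambda>_. 0)" "C1_norm (\<lambda>_. 0) \<le> t * A" using t A by (auto simp: C1_coeffs_def C1_norm_def)
    have quad: "real j powr (3/2 + \<kappa>) * cmod (p d j) \<le> \<Lambda> * (t * A)\<^sup>2" if "C1_coeffs d" "C1_norm d \<le> t * A" for d j
    proof -
      have "real j powr (3/2 + \<kappa>) * cmod (p d j) \<le> \<Lambda> * (t * A) * C1_norm d"
        using lip[OF that(1) zero(1) that(2) zero(2) t1, of j] by (simp add: p0)
      also have "\<dots> \<le> \<Lambda> * (t * A) * (t * A)" using that(2) \<Lambda> t A by (intro mult_left_mono) auto
      finally show ?thesis by (simp add: power2_eq_square mult.assoc)
    qed
    define g where "g z j = - complex_of_real (real j powr (3/2 + \<kappa>)) * (p tc j + p (w z) j)" for z j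
    have g_bound: "cmod (g z j) \<le> L * t\<^sup>2" if "norm z \<le> t" for z j
    proof -
      have "cmod (g z j) = real j powr (3/2 + \<kappa>) * cmod (p tc j + p (w z) j)" by (simp add: g_def norm_mult)
      also have "\<dots> \<le> real j powr (3/2 + \<kappa>) * (cmod (p tc j) + cmod (p (w z) j))"
        by (intro mult_left_mono norm_triangle_ineq) auto
      also have "\<dots> \<le> \<Lambda> * (t * A)\<^sup>2 + \<Lambda> * (t * A)\<^sup>2"
        unfolding distrib_left by (intro add_mono quad tc w that)
      finally show ?thesis by (simp add: L_def power_mult_distrib mult_ac)
    qed
    define G where "G z = Bcontfun (g z)" for z
    have G: "apply_bcontfun (G z) = g z" if "norm z \<le> t" for z
      unfolding G_def
    proof (rule Bcontfun_inverse)
      have "bounded (range (g z))" unfolding bounded_iff using g_bound[OF that] by auto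
      then show "g z \<in> bcontfun" by (simp add: bcontfun_def)
    qed
    have Lt: "L * t\<^sup>2 \<le> t" using t2 t by (simp add: power2_eq_square mult.assoc[symmetric])
    have G_norm: "norm (G z) \<le> L * t\<^sup>2" if "norm z \<le> t" for z
      by (rule norm_bound) (simp add: G[OF that] g_bound[OF that])
    have "\<exists>!z\<in>cball 0 t. G z = z"
    proof (rule Banach_fix[where c = "1/2"])
      show "complete (cball (0 :: nat \<Rightarrow>\<^sub>C complex) t)"
        by (rule complete_closed_subset[OF closed_cball subset_UNIV complete_bounded_sequences])
      show "cball (0 :: nat \<Rightarrow>\<^sub>C complex) t \<noteq> {}" using t by simp
      show "G ` cball 0 t \<subseteq> cball 0 t" using G_norm Lt by fastforce
      fix z z' :: "nat \<Rightarrow>\<^sub>C complex" assume "z \<in> cball 0 t" "z' \<in> cball 0 t"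
      then have zz: "norm z \<le> t" "norm z' \<le> t" by simp_all
      show "dist (G z) (G z') \<le> 1/2 * dist z z'"
      proof (rule dist_bound)
        fix j
        have "dist (apply_bcontfun (G z) j) (apply_bcontfun (G z') j) = real j powr (3/2 + \<kappa>) * cmod (p (w z) j - p (w z') j)"
          unfolding G[OF zz(1)] G[OF zz(2)] dist_norm g_def right_diff_distrib[symmetric] norm_mult
          by simp
        also have "\<dots> \<le> \<Lambda> * (t * A) * C1_norm (\<lambda>s. w z s - w z' s)"
          by (intro lip w zz t1)
        also have "(\<lambda>s. w z s - w z' s) = (\<lambda>s. E z s - E z' s)" by (simp add: w_def)
        also have "\<Lambda> * (t * A) * C1_norm (\<lambda>s. E z s - E z' s) \<le> \<Lambda> * (t * A) * (\<sigma> * dist z z')"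
          using weighted_coeffs_C1(2)[OF \<kappa>, of z z'] \<Lambda> t A by (intro mult_left_mono) (auto simp: E_def \<sigma>_def)
        also have "\<dots> = (Q * t) * dist z z'" by (simp add: Q_def mult_ac)
        also have "\<dots> \<le> 1/2 * dist z z'" using t3 by (intro mult_right_mono) auto
        finally show "dist (apply_bcontfun (G z) j) (apply_bcontfun (G z') j) \<le> 1/2 * dist z z'" .
      qed
    qed auto
    then obtain z where z: "norm z \<le> t" "G z = z" by auto
    have "E z j = - complex_of_real (real j powr (1/2)) * (p tc j + p (w z) j)" if "j \<ge> 1" for j
    proof -
      have "E z j = complex_of_real (real j powr (- 1 - \<kappa>)) * g z j"
        using G[OF z(1)] z(2) by (simp add: E_def weighted_coeffs_def)
      also have "\<dots> = - complex_of_real (real j powr (- 1 - \<kappa>) * real j powr (3/2 + \<kappa>)) * (p tc j + p (w z) j)"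
        by (simp add: g_def)
      also have "real j powr (- 1 - \<kappa>) * real j powr (3/2 + \<kappa>) = real j powr (1/2)"
        by (simp add: powr_add[symmetric])
      finally show ?thesis .
    qed
    moreover have "C1_norm (E z) \<le> (\<sigma> * L) * t\<^sup>2"
    proof -
      have "norm z \<le> L * t\<^sup>2" using G_norm[OF z(1)] z(2) by simp
      then have "\<sigma> * norm z \<le> \<sigma> * (L * t\<^sup>2)" using \<sigma> by (rule mult_left_mono)
      then show ?thesis using E(2)[of z] by simp
    qed
    ultimately show ?thesis using E(1)[of z] unfolding tc_def w_def by blast
  qed
  show thesis by (rule that[of t0 "\<sigma> * L"]) (use t0 L \<sigma> main in auto)
qed

lemma zero_if_arbitrarily_small:
  fixes x :: real
  assumes "t0 > 0" "\<And>t. 0 < t \<Longrightarrow> t \<le> t0 \<Longrightarrow> \<bar>x\<bar> \<le> K * t"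
  shows "x = 0"
proof -
  have "\<bar>x\<bar> \<le> 0 + e" if "e > 0" for e
  proof -
    define t where "t = min t0 (e / (\<bar>K\<bar> + 1))"
    have "0 < t" "t \<le> t0" using assms(1) that by (auto simp: t_def)
    then have "\<bar>x\<bar> \<le> K * t" by (rule assms(2))
    also have "\<dots> \<le> (\<bar>K\<bar> + 1) * t" using \<open>0 < t\<close> by (intro mult_right_mono) auto
    also have "\<dots> \<le> (\<bar>K\<bar> + 1) * (e / (\<bar>K\<bar> + 1))" by (intro mult_left_mono) (auto simp: t_def)
    also have "\<dots> = e" by simp
    finally show ?thesis by simp
  qed
  then have "\<bar>x\<bar> \<le> 0" by (rule field_le_epsilon)
  then show ?thesis by simp
qed

lemma abs_integral_circ_le:
  fixes f :: "real \<Rightarrow> real"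
  assumes "continuous_on {0..2 * pi} f" "\<And>x. \<bar>f x\<bar> \<le> K"
  shows "\<bar>integral\<^sup>L circ f\<bar> \<le> 2 * pi * K"
proof -
  have "\<bar>integral\<^sup>L circ f\<bar> \<le> integral\<^sup>L circ (\<lambda>x. \<bar>f x\<bar>)"
    using integral_norm_bound[of circ f] by simp
  also have "\<dots> \<le> integral\<^sup>L circ (\<lambda>x. K)"
    using assms by (intro integral_mono integrable_circ_continuous continuous_intros) auto
  also have "\<dots> = 2 * pi * K" by (simp add: measure_restrict_space)
  finally show ?thesis .
qed

lemma C1_trig_series_bound:
  assumes "C1_coeffs c"
  shows "\<bar>trig_series c x\<bar> \<le> C1_norm c" "\<bar>trig_series (\<lambda>s. \<i> * real s * c s) x\<bar> \<le> C1_norm c"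
proof -
  have pi1: "sqrt pi \<ge> 1" using pi_ge_two by simp
  have div: "y / sqrt pi \<le> y" if "y \<ge> 0" for y
    using pi1 that by (simp add: divide_le_eq mult_le_cancel_left1)
  have "\<bar>trig_series c x\<bar> \<le> (\<Sum>s. cmod (c s)) / sqrt pi" by (rule trig_series_bound[OF C1_coeffs_summable[OF assms]])
  also have "\<dots> \<le> (\<Sum>s. cmod (c s))" by (intro div suminf_nonneg C1_coeffs_summable[OF assms]) auto
  also have "\<dots> \<le> C1_norm c" unfolding C1_norm_def
  proof (rule suminf_le)
    show "cmod (c s) \<le> real s * cmod (c s)" for s
      using assms by (cases "s = 0") (auto simp: C1_coeffs_def mult_le_cancel_right1)
  qed (use assms C1_coeffs_summable in \<open>auto simp: C1_coeffs_def\<close>)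
  finally show "\<bar>trig_series c x\<bar> \<le> C1_norm c" .
  have "\<bar>trig_series (\<lambda>s. \<i> * real s * c s) x\<bar> \<le> C1_norm c / sqrt pi"
    using trig_series_bound[OF C1_coeffs_summable_deriv[OF assms]] by (simp add: C1_norm_def norm_mult)
  also have "\<dots> \<le> C1_norm c" by (intro div C1_norm_nonneg assms)
  finally show "\<bar>trig_series (\<lambda>s. \<i> * real s * c s) x\<bar> \<le> C1_norm c" .
qed

text \<open>Both sides of the hypothesis \<open>eq\<close> are expanded. The quadratic terms in \<open>t c\<close> cancel and the cubic ones, of
  opposite sign, add up; the only other term of order \<open>t\<^sup>3\<close> is the scalar product of the derivatives,
  because \<open>e\<close> is of order \<open>t\<^sup>2\<close>.\<close>

lemma reflection_cubic_estimate:
  assumes c: "C1_coeffs c" and e: "C1_coeffs e" "C1_norm e \<le> L * t\<^sup>2" and t: "0 < t" "t \<le> 1" and L: "L \<ge> 0"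
    and eq: "h_KdV (trig_series (\<lambda>s. complex_of_real (- t) * c s + e s)) = h_KdV (trig_series (\<lambda>s. complex_of_real t * c s))"
  shows "\<bar>2 * t ^ 3 * integral\<^sup>L circ (\<lambda>x. trig_series c x ^ 3)
      - t / 4 * integral\<^sup>L circ (\<lambda>x. trig_series (\<lambda>s. \<i> * real s * c s) x * trig_series (\<lambda>s. \<i> * real s * e s) x)\<bar>
    \<le> 2 * pi * (L\<^sup>2 + 3 * (C1_norm c)\<^sup>2 * L + 3 * C1_norm c * L\<^sup>2 + L ^ 3) * t ^ 4"
proof -
  define u where "u = trig_series c"
  define u' where "u' = trig_series (\<lambda>s. \<i> * real s * c s)"
  define r where "r = trig_series e"
  define r' where "r' = trig_series (\<lambda>s. \<i> * real s * e s)"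
  define U where "U = C1_norm c"
  define I where "I f = integral\<^sup>L circ f" for f :: "real \<Rightarrow> real"
  note sc = C1_coeffs_summable[OF c] C1_coeffs_summable_deriv[OF c]
  note se = C1_coeffs_summable[OF e(1)] C1_coeffs_summable_deriv[OF e(1)]
  have cont: "continuous_on S u" "continuous_on S u'" "continuous_on S r" "continuous_on S r'" for S
    unfolding u_def u'_def r_def r'_def by (intro continuous_trig_series sc se)+
  have int: "integrable circ f" if "continuous_on {0..2 * pi} f" for f :: "real \<Rightarrow> real"
    using that by (rule integrable_circ_continuous)
  have i: "integrable circ (\<lambda>x. (u' x)\<^sup>2)" "integrable circ (\<lambda>x. u' x * r' x)" "integrable circ (\<lambda>x. (r' x)\<^sup>2)"
     "integrable circ (\<lambda>x. (u x)^3)" "integrable circ (\<lambda>x. (u x)\<^sup>2 * r x)" "integrable circ (\<lambda>x. u x * (r x)\<^sup>2)" "integrable circ (\<lambda>x. (r x)^3)"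
    by (intro int continuous_intros cont)+
  have C1_tc: "C1_coeffs (\<lambda>s. complex_of_real t * c s)" "C1_coeffs (\<lambda>s. complex_of_real (- t) * c s)" for t
    by (intro C1_coeffs_scale c)+
  have C1_w: "C1_coeffs (\<lambda>s. complex_of_real (- t) * c s + e s)" by (intro C1_coeffs_add C1_tc e)
  have f1: "trig_series (\<lambda>s. complex_of_real t * c s) x = t * u x" for x
    unfolding u_def by (rule trig_series_scale[OF sc(1)])
  have f2: "trig_series (\<lambda>s. \<i> * real s * (complex_of_real t * c s)) x = t * u' x" for x
    unfolding u'_def using trig_series_scale[OF sc(2), of t x] by (simp add: mult_ac)
  have f3: "trig_series (\<lambda>s. complex_of_real (- t) * c s + e s) x = - t * u x + r x" for x
    using trig_series_add[OF C1_coeffs_summable[OF C1_tc(2)[of t]] se(1)] trig_series_scale[OF sc(1), of "- t" x]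
    by (simp add: u_def r_def)
  have f4: "trig_series (\<lambda>s. \<i> * real s * (complex_of_real (- t) * c s + e s)) x = - t * u' x + r' x" for x
  proof -
    have "summable (\<lambda>s. cmod (complex_of_real (- t) * (\<i> * real s * c s)))"
      unfolding norm_mult[of "complex_of_real (- t)"] by (intro summable_mult sc)
    from trig_series_add[OF this se(2)] trig_series_scale[OF sc(2), of "- t" x]
    show ?thesis by (simp add: u'_def r'_def algebra_simps)
  qed
  have h1: "h_KdV (trig_series (\<lambda>s. complex_of_real t * c s)) = - (1/8) * (t\<^sup>2 * I (\<lambda>x. (u' x)\<^sup>2)) + t ^ 3 * I (\<lambda>x. u x ^ 3)"
    using C1_tc(1)[of t]
    by (subst h_KdV_trig_series) (simp_all only: C1_coeffs_def f1 f2 power_mult_distrib integral_mult_right_zero I_def)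
  have e2: "(- t * u' x + r' x)\<^sup>2 = t\<^sup>2 * (u' x)\<^sup>2 - 2 * t * (u' x * r' x) + (r' x)\<^sup>2" for x
    by (simp add: power2_eq_square algebra_simps)
  have e3: "(- t * u x + r x) ^ 3 = - (t ^ 3) * (u x) ^ 3 + 3 * t\<^sup>2 * ((u x)\<^sup>2 * r x) - 3 * t * (u x * (r x)\<^sup>2) + (r x) ^ 3" for x
    by (simp add: power2_eq_square power3_eq_cube algebra_simps)
  have "h_KdV (trig_series (\<lambda>s. complex_of_real (- t) * c s + e s)) =
      - (1/8) * I (\<lambda>x. (- t * u' x + r' x)\<^sup>2) + I (\<lambda>x. (- t * u x + r x) ^ 3)"
    using C1_w by (subst h_KdV_trig_series) (simp_all only: C1_coeffs_def f3 f4 I_def)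
  also have "I (\<lambda>x. (- t * u' x + r' x)\<^sup>2) = t\<^sup>2 * I (\<lambda>x. (u' x)\<^sup>2) - 2 * t * I (\<lambda>x. u' x * r' x) + I (\<lambda>x. (r' x)\<^sup>2)"
    unfolding I_def e2
    by (simp only: Bochner_Integration.integral_add Bochner_Integration.integral_diff
       Bochner_Integration.integrable_add Bochner_Integration.integrable_diff integrable_mult_right integral_mult_right_zero i)
  also have "I (\<lambda>x. (- t * u x + r x) ^ 3) = - (t ^ 3) * I (\<lambda>x. (u x) ^ 3) + 3 * t\<^sup>2 * I (\<lambda>x. (u x)\<^sup>2 * r x)
     - 3 * t * I (\<lambda>x. u x * (r x)\<^sup>2) + I (\<lambda>x. (r x) ^ 3)"
    unfolding I_def e3
    by (simp only: Bochner_Integration.integral_add Bochner_Integration.integral_diff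
       Bochner_Integration.integrable_add Bochner_Integration.integrable_diff integrable_mult_right integral_mult_right_zero i)
  finally have main: "2 * t ^ 3 * I (\<lambda>x. u x ^ 3) - t / 4 * I (\<lambda>x. u' x * r' x) =
      - (1/8) * I (\<lambda>x. (r' x)\<^sup>2) + 3 * t\<^sup>2 * I (\<lambda>x. (u x)\<^sup>2 * r x) - 3 * t * I (\<lambda>x. u x * (r x)\<^sup>2) + I (\<lambda>x. (r x) ^ 3)"
    using eq h1 by (simp add: algebra_simps)
  have U: "U \<ge> 0" using C1_norm_nonneg[OF c] by (simp add: U_def)
  have bu: "\<bar>u x\<bar> \<le> U" and br: "\<bar>r x\<bar> \<le> L * t\<^sup>2" and br': "\<bar>r' x\<bar> \<le> L * t\<^sup>2" for x
    using C1_trig_series_bound[OF c, of x] C1_trig_series_bound[OF e(1), of x] e(2)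
    by (auto simp: u_def r_def r'_def U_def)
  have b1: "\<bar>I (\<lambda>x. (r' x)\<^sup>2)\<bar> \<le> 2 * pi * (L * t\<^sup>2)\<^sup>2" unfolding I_def
    by (intro abs_integral_circ_le continuous_intros cont) (simp only: power_abs power_mono[OF br'] abs_ge_zero)
  have b2: "\<bar>I (\<lambda>x. (u x)\<^sup>2 * r x)\<bar> \<le> 2 * pi * (U\<^sup>2 * (L * t\<^sup>2))" unfolding I_def
    by (intro abs_integral_circ_le continuous_intros cont)
       (simp only: power_abs abs_mult, intro mult_mono power_mono bu br, auto)
  have b3: "\<bar>I (\<lambda>x. u x * (r x)\<^sup>2)\<bar> \<le> 2 * pi * (U * (L * t\<^sup>2)\<^sup>2)" unfolding I_def
    by (intro abs_integral_circ_le continuous_intros cont)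
       (simp only: power_abs abs_mult, intro mult_mono power_mono bu br, use U in auto)
  have b4: "\<bar>I (\<lambda>x. (r x) ^ 3)\<bar> \<le> 2 * pi * (L * t\<^sup>2) ^ 3" unfolding I_def
    by (intro abs_integral_circ_le continuous_intros cont) (simp only: power_abs power_mono[OF br] abs_ge_zero)
  have p5: "t ^ 5 \<le> t ^ 4" and p6: "t ^ 6 \<le> t ^ 4" using t by (auto intro!: power_decreasing)
  have "\<bar>2 * t ^ 3 * I (\<lambda>x. u x ^ 3) - t / 4 * I (\<lambda>x. u' x * r' x)\<bar>
      \<le> 1/8 * \<bar>I (\<lambda>x. (r' x)\<^sup>2)\<bar> + \<bar>3 * t\<^sup>2 * I (\<lambda>x. (u x)\<^sup>2 * r x)\<bar> + \<bar>3 * t * I (\<lambda>x. u x * (r x)\<^sup>2)\<bar> + \<bar>I (\<lambda>x. (r x) ^ 3)\<bar>"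
    unfolding main by linarith
  also have "\<dots> = 1/8 * \<bar>I (\<lambda>x. (r' x)\<^sup>2)\<bar> + 3 * t\<^sup>2 * \<bar>I (\<lambda>x. (u x)\<^sup>2 * r x)\<bar> + 3 * t * \<bar>I (\<lambda>x. u x * (r x)\<^sup>2)\<bar> + \<bar>I (\<lambda>x. (r x) ^ 3)\<bar>"
    using t by (simp add: abs_mult)
  also have "\<dots> \<le> 1 * (2 * pi * (L * t\<^sup>2)\<^sup>2) + 3 * t\<^sup>2 * (2 * pi * (U\<^sup>2 * (L * t\<^sup>2))) + 3 * t * (2 * pi * (U * (L * t\<^sup>2)\<^sup>2)) + 2 * pi * (L * t\<^sup>2) ^ 3"
    by (intro add_mono mult_mono b1 b2 b3 b4) (use t in auto)
  also have "\<dots> = 2 * pi * (L\<^sup>2 * t ^ 4 + 3 * U\<^sup>2 * L * t ^ 4 + 3 * U * L\<^sup>2 * t ^ 5 + L ^ 3 * t ^ 6)"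
    by (simp add: power_mult_distrib algebra_simps power_mult[symmetric] numeral_eq_Suc)
  also have "\<dots> \<le> 2 * pi * (L\<^sup>2 * t ^ 4 + 3 * U\<^sup>2 * L * t ^ 4 + 3 * U * L\<^sup>2 * t ^ 4 + L ^ 3 * t ^ 4)"
    using p5 p6 L U by (intro mult_left_mono add_mono order_refl) auto
  also have "\<dots> = 2 * pi * (L\<^sup>2 + 3 * U\<^sup>2 * L + 3 * U * L\<^sup>2 + L ^ 3) * t ^ 4"
    by (simp add: algebra_simps)
  finally show ?thesis by (simp only: I_def u_def u'_def r'_def U_def)
qed

text \<open>The correction \<open>e\<close> to the reflected point is \<open>- 2 t\<^sup>2 s\<^sup>1\<^sup>/\<^sup>2 Q\<^sub>s\<close> up to \<open>O(t\<^sup>3)\<close> in each coordinate, half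
  of it coming from \<open>p\<close> at \<open>t c\<close> and half from \<open>p\<close> near \<open>- t c\<close>, where \<open>p\<close> has the same quadratic
  part. Inserting this into the previous estimate and dividing by \<open>t\<^sup>3\<close> leaves the identity as
  \<open>t \<rightarrow> 0\<close>. Finiteness of the support of \<open>c\<close> makes the coordinatewise expansion sufficient.\<close>

lemma cubic_identity:
  fixes p :: "(nat \<Rightarrow> complex) \<Rightarrow> nat \<Rightarrow> complex"
  assumes \<kappa>: "\<kappa> > 1" and \<Lambda>: "\<Lambda> \<ge> 0" "\<rho>0 > 0" and p0: "\<And>j. p (\<lambda>_. 0) j = 0"
    and lip: "\<And>c d \<rho> j. C1_coeffs c \<Longrightarrow> C1_coeffs d \<Longrightarrow> C1_norm c \<le> \<rho> \<Longrightarrow> C1_norm d \<le> \<rho> \<Longrightarrow> \<rho> \<le> \<rho>0 \<Longrightarrow>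
       real j powr (3/2 + \<kappa>) * cmod (p c j - p d j) \<le> \<Lambda> * \<rho> * C1_norm (\<lambda>s. c s - d s)"
    and index0: "\<And>c. C1_coeffs c \<Longrightarrow> C1_norm c \<le> \<rho>0 \<Longrightarrow> p c 0 = 0"
    and inv: "\<And>c d. C1_coeffs c \<Longrightarrow> C1_coeffs d \<Longrightarrow> C1_norm c \<le> \<rho>0 \<Longrightarrow> C1_norm d \<le> \<rho>0 \<Longrightarrow>
       (\<And>j. cmod (complex_of_real (real j powr (- 1/2)) * c j + p c j) =
             cmod (complex_of_real (real j powr (- 1/2)) * d j + p d j)) \<Longrightarrow> h_KdV (trig_series c) = h_KdV (trig_series d)"
    and c: "C1_coeffs c" and fin: "finite {s. c s \<noteq> 0}"
    and quad: "t1 > 0" "\<And>t j. \<bar>t\<bar> \<le> t1 \<Longrightarrow>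
       real j powr (3/2 + \<kappa>) * cmod (p (\<lambda>s. complex_of_real t * c s) j - complex_of_real (t\<^sup>2) * Q j) \<le> K * \<bar>t\<bar> ^ 3"
  shows "integral\<^sup>L circ (\<lambda>x. trig_series c x ^ 3) = - 1/4 * (\<Sum>s | c s \<noteq> 0. real s powr (5/2) * Re (c s * cnj (Q s)))"
proof -
  obtain t0 L where t0: "t0 > 0" and L: "L \<ge> 0"
    and sol: "\<And>t. 0 < t \<Longrightarrow> t \<le> t0 \<Longrightarrow> \<exists>e. C1_coeffs e \<and> C1_norm e \<le> L * t\<^sup>2 \<and>
       (\<forall>j\<ge>1. e j = - complex_of_real (real j powr (1/2)) *
          (p (\<lambda>s. complex_of_real t * c s) j + p (\<lambda>s. complex_of_real (- t) * c s + e s) j))"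
    using antipodal_solution[of \<kappa> \<Lambda> \<rho>0 p c, OF \<kappa> \<Lambda> p0 lip c] by blast
  define S where "S = {s. c s \<noteq> 0}"
  have S: "finite S" "0 \<notin> S" using fin c by (auto simp: S_def C1_coeffs_def)
  define U where "U = C1_norm c"
  have U: "U \<ge> 0" using C1_norm_nonneg[OF c] by (simp add: U_def)
  define I3 where "I3 = integral\<^sup>L circ (\<lambda>x. trig_series c x ^ 3)"
  define W where "W = (\<Sum>s\<in>S. real s powr (5/2) * Re (c s * cnj (Q s)))"
  define K2 where "K2 = 2 * \<bar>K\<bar> + \<Lambda> * (U + L) * L"
  define K3 where "K3 = (\<Sum>s\<in>S. (real s)\<^sup>2 * cmod (c s) * real s powr (1/2)) * K2"
  define K4 where "K4 = 2 * pi * (L\<^sup>2 + 3 * U\<^sup>2 * L + 3 * U * L\<^sup>2 + L ^ 3)"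
  define t2 where "t2 = min (min t0 t1) (min 1 (\<rho>0 / (U + L + 1)))"
  have t2: "t2 > 0" using t0 quad(1) \<Lambda> U L by (simp add: t2_def)
  have "\<bar>2 * I3 + W / 2\<bar> \<le> (K4 + K3 / 4) * t" if t: "0 < t" "t \<le> t2" for t
  proof -
    have tle: "t \<le> t0" "t \<le> t1" "t \<le> 1" "t \<le> \<rho>0 / (U + L + 1)" using t(2) by (simp_all add: t2_def)
    have t\<rho>: "t * (U + L) \<le> \<rho>0"
    proof -
      have "t * (U + L + 1) \<le> \<rho>0" using tle(4) U L by (simp add: field_simps)
      then show ?thesis using t by (simp add: algebra_simps)
    qed
    obtain e where e: "C1_coeffs e" "C1_norm e \<le> L * t\<^sup>2"
      and ej: "\<And>j. j \<ge> 1 \<Longrightarrow> e j = - complex_of_real (real j powr (1/2)) *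
          (p (\<lambda>s. complex_of_real t * c s) j + p (\<lambda>s. complex_of_real (- t) * c s + e s) j)"
      using sol[OF t(1) tle(1)] by blast
    define a where "a = (\<lambda>s. complex_of_real t * c s)"
    define b where "b = (\<lambda>s. complex_of_real (- t) * c s)"
    define w where "w = (\<lambda>s. complex_of_real (- t) * c s + e s)"
    have C1: "C1_coeffs a" "C1_coeffs b" "C1_coeffs w" unfolding a_def b_def w_def
      by (intro C1_coeffs_add C1_coeffs_scale c e)+
    have "t\<^sup>2 \<le> t" using t tle by (simp add: power2_eq_square mult_left_le)
    then have eL: "C1_norm e \<le> t * L" using e(2) L by (metis mult.commute mult_left_mono order_trans)
    have na: "C1_norm a \<le> t * (U + L)" and nb: "C1_norm b \<le> t * (U + L)"
      using C1_coeffs_scale(2)[OF c, of t] C1_coeffs_scale(2)[OF c, of "-t"] t L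
      by (simp_all add: a_def b_def U_def mult_left_mono)
    have "C1_norm w \<le> C1_norm b + C1_norm e" unfolding w_def b_def
      by (intro C1_coeffs_add C1_coeffs_scale c e)
    then have nw: "C1_norm w \<le> t * (U + L)"
      using eL C1_coeffs_scale(2)[OF c, of "-t"] t by (simp add: b_def U_def algebra_simps)
    have heq: "h_KdV (trig_series w) = h_KdV (trig_series a)"
    proof (rule inv[OF C1(3,1)])
      show "C1_norm w \<le> \<rho>0" "C1_norm a \<le> \<rho>0" using nw na t\<rho> by linarith+
      fix j
      show "cmod (complex_of_real (real j powr (- 1/2)) * w j + p w j) = cmod (complex_of_real (real j powr (- 1/2)) * a j + p a j)"
      proof (cases "j = 0")
        case True
        then show ?thesis using index0 C1 nw na t\<rho> by simp
      next
        case False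
        have "real j powr (- 1/2) * real j powr (1/2) = 1" using False by (simp add: powr_add[symmetric])
        then have *: "complex_of_real (real j powr (- 1/2)) * complex_of_real (real j powr (1/2)) = 1"
          by (metis of_real_1 of_real_mult)
        have "complex_of_real (real j powr (- 1/2)) * e j =
            - (complex_of_real (real j powr (- 1/2)) * complex_of_real (real j powr (1/2))) * (p a j + p w j)"
          using ej[of j] False by (simp add: a_def w_def)
        then have "complex_of_real (real j powr (- 1/2)) * e j = - (p a j + p w j)" unfolding * by simp
        then have "complex_of_real (real j powr (- 1/2)) * w j + p w j = - (complex_of_real (real j powr (- 1/2)) * a j + p a j)"
          unfolding w_def[THEN fun_cong] a_def[THEN fun_cong] distrib_left by simp
        then show ?thesis by (simp only: norm_minus_cancel)
      qed
    qed
    define J where "J = integral\<^sup>L circ (\<lambda>x. trig_series (\<lambda>s. \<i> * real s * c s) x * trig_series (\<lambda>s. \<i> * real s * e s) x)"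
    have est1: "\<bar>2 * t ^ 3 * I3 - t / 4 * J\<bar> \<le> K4 * t ^ 4"
      using reflection_cubic_estimate[OF c e t(1) tle(3) L heq[unfolded w_def a_def]]
      by (simp only: I3_def J_def K4_def U_def)
    have J: "J = (\<Sum>s\<in>S. (real s)\<^sup>2 * Re (c s * cnj (e s)))"
    proof -
      have sumsJ: "(\<lambda>s. Re ((\<i> * real s * c s) * cnj (\<i> * real s * e s))) sums J"
        unfolding J_def by (rule parseval_trig_series) (use C1_coeffs_summable_deriv c e in auto)
      have rewr: "(\<lambda>s. Re ((\<i> * real s * c s) * cnj (\<i> * real s * e s))) = (\<lambda>s. (real s)\<^sup>2 * Re (c s * cnj (e s)))"
        by (simp add: fun_eq_iff power2_eq_square algebra_simps)
      have "(\<lambda>s. (real s)\<^sup>2 * Re (c s * cnj (e s))) sums (\<Sum>s\<in>S. (real s)\<^sup>2 * Re (c s * cnj (e s)))"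
        by (rule sums_finite[OF S(1)]) (simp add: S_def)
      then show ?thesis by (rule sums_unique2[OF sumsJ[unfolded rewr]])
    qed
    have es: "cmod (e s + complex_of_real (2 * t\<^sup>2 * real s powr (1/2)) * Q s) \<le> real s powr (1/2) * (K2 * t ^ 3)" if "s \<in> S" for s
    proof -
      have s1: "s \<ge> 1" using S(2) that by (cases s) auto
      have w1: "real s powr (3/2 + \<kappa>) \<ge> 1" using s1 \<kappa> by (intro ge_one_powr_ge_zero) auto
      have drop: "y \<le> z" if "real s powr (3/2 + \<kappa>) * y \<le> z" "y \<ge> 0" for y z
        using mult_right_mono[OF w1 that(2)] that(1) by linarith
      have q1: "cmod (p a s - complex_of_real (t\<^sup>2) * Q s) \<le> \<bar>K\<bar> * t ^ 3"
      proof -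
        have "K * t ^ 3 \<le> \<bar>K\<bar> * t ^ 3" using t by (intro mult_right_mono) auto
        moreover have "real s powr (3/2 + \<kappa>) * cmod (p a s - complex_of_real (t\<^sup>2) * Q s) \<le> K * t ^ 3"
          using quad(2)[of "t" s] t tle(2) by (simp add: a_def)
        ultimately show ?thesis by (intro drop[OF order_trans norm_ge_zero])
      qed
      have q2: "cmod (p b s - complex_of_real (t\<^sup>2) * Q s) \<le> \<bar>K\<bar> * t ^ 3"
      proof -
        have "K * t ^ 3 \<le> \<bar>K\<bar> * t ^ 3" using t by (intro mult_right_mono) auto
        moreover have "real s powr (3/2 + \<kappa>) * cmod (p b s - complex_of_real (t\<^sup>2) * Q s) \<le> K * t ^ 3"
          using quad(2)[of "-t" s] t tle(2) by (simp add: b_def)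
        ultimately show ?thesis by (intro drop[OF order_trans norm_ge_zero])
      qed
      have q3: "cmod (p w s - p b s) \<le> \<Lambda> * (U + L) * L * t ^ 3"
      proof (rule drop)
        have "real s powr (3/2 + \<kappa>) * cmod (p w s - p b s) \<le> \<Lambda> * (t * (U + L)) * C1_norm (\<lambda>s. w s - b s)"
          by (intro lip C1 nw nb t\<rho>)
        also have "(\<lambda>s. w s - b s) = e" by (simp add: w_def b_def)
        also have "\<Lambda> * (t * (U + L)) * C1_norm e \<le> \<Lambda> * (t * (U + L)) * (L * t\<^sup>2)"
          using \<Lambda> t U L e by (intro mult_left_mono) auto
        finally show "real s powr (3/2 + \<kappa>) * cmod (p w s - p b s) \<le> \<Lambda> * (U + L) * L * t ^ 3"
          by (simp add: power2_eq_square power3_eq_cube mult_ac)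
      qed simp
      have "e s + complex_of_real (2 * t\<^sup>2 * real s powr (1/2)) * Q s = - complex_of_real (real s powr (1/2)) *
          ((p a s - complex_of_real (t\<^sup>2) * Q s) + (p b s - complex_of_real (t\<^sup>2) * Q s) + (p w s - p b s))"
        unfolding ej[OF s1] by (simp add: a_def w_def algebra_simps)
      then have "cmod (e s + complex_of_real (2 * t\<^sup>2 * real s powr (1/2)) * Q s) = real s powr (1/2) *
          cmod ((p a s - complex_of_real (t\<^sup>2) * Q s) + (p b s - complex_of_real (t\<^sup>2) * Q s) + (p w s - p b s))"
        by (simp add: norm_mult)
      also have "\<dots> \<le> real s powr (1/2) * (\<bar>K\<bar> * t ^ 3 + \<bar>K\<bar> * t ^ 3 + \<Lambda> * (U + L) * L * t ^ 3)"
        by (intro mult_left_mono norm_triangle_mono q1 q2 q3) auto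
      finally show ?thesis by (simp add: K2_def algebra_simps)
    qed
    have JW: "\<bar>J + 2 * t\<^sup>2 * W\<bar> \<le> K3 * t ^ 3"
    proof -
      have "J + 2 * t\<^sup>2 * W = (\<Sum>s\<in>S. (real s)\<^sup>2 * Re (c s * cnj (e s + complex_of_real (2 * t\<^sup>2 * real s powr (1/2)) * Q s)))"
        unfolding J W_def sum_distrib_left sum.distrib[symmetric]
      proof (rule sum.cong[OF refl])
        fix s assume "s \<in> S"
        have "(real s)\<^sup>2 * real s powr (1/2) = real s powr (5/2)"
        proof -
          have "(real s)\<^sup>2 = real s powr 2" by (simp add: powr_numeral)
          then have "(real s)\<^sup>2 * real s powr (1/2) = real s powr (2 + 1/2)" by (simp only: powr_add)
          then show ?thesis by simp
        qed
        then show "(real s)\<^sup>2 * Re (c s * cnj (e s)) + 2 * t\<^sup>2 * (real s powr (5/2) * Re (c s * cnj (Q s))) =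
           (real s)\<^sup>2 * Re (c s * cnj (e s + complex_of_real (2 * t\<^sup>2 * real s powr (1/2)) * Q s))"
          by (auto simp: algebra_simps)
      qed
      also have "\<bar>\<dots>\<bar> \<le> (\<Sum>s\<in>S. ((real s)\<^sup>2 * cmod (c s) * real s powr (1/2)) * (K2 * t ^ 3))"
      proof (rule order_trans[OF sum_abs sum_mono])
        fix s assume s: "s \<in> S"
        have "\<bar>Re (c s * cnj (e s + complex_of_real (2 * t\<^sup>2 * real s powr (1/2)) * Q s))\<bar>
            \<le> cmod (c s) * cmod (e s + complex_of_real (2 * t\<^sup>2 * real s powr (1/2)) * Q s)"
          using abs_Re_le_cmod[of "c s * cnj (e s + complex_of_real (2 * t\<^sup>2 * real s powr (1/2)) * Q s)"]
          by (simp only: norm_mult complex_mod_cnj)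
        also have "\<dots> \<le> cmod (c s) * (real s powr (1/2) * (K2 * t ^ 3))"
          by (intro mult_left_mono es s) auto
        finally show "\<bar>(real s)\<^sup>2 * Re (c s * cnj (e s + complex_of_real (2 * t\<^sup>2 * real s powr (1/2)) * Q s))\<bar>
            \<le> ((real s)\<^sup>2 * cmod (c s) * real s powr (1/2)) * (K2 * t ^ 3)"
          unfolding abs_mult by (simp add: mult.assoc mult_left_mono)
      qed
      also have "\<dots> = K3 * t ^ 3" by (simp only: K3_def sum_distrib_right mult.assoc)
      finally show ?thesis .
    qed
    have "\<bar>2 * t ^ 3 * I3 + t ^ 3 * W / 2\<bar> \<le> \<bar>2 * t ^ 3 * I3 - t / 4 * J\<bar> + \<bar>t / 4 * (J + 2 * t\<^sup>2 * W)\<bar>"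
    proof -
      have "2 * t ^ 3 * I3 + t ^ 3 * W / 2 = (2 * t ^ 3 * I3 - t / 4 * J) + t / 4 * (J + 2 * t\<^sup>2 * W)"
        by (simp add: power2_eq_square power3_eq_cube algebra_simps)
      then show ?thesis by (metis abs_triangle_ineq)
    qed
    also have "\<dots> \<le> K4 * t ^ 4 + t / 4 * (K3 * t ^ 3)"
      unfolding abs_mult[of "t / 4"] using JW t by (intro add_mono est1 mult_mono) auto
    also have "\<dots> = t ^ 3 * ((K4 + K3 / 4) * t)" by (simp add: algebra_simps numeral_eq_Suc)
    finally have "\<bar>t ^ 3 * (2 * I3 + W / 2)\<bar> \<le> t ^ 3 * ((K4 + K3 / 4) * t)"
      by (simp add: algebra_simps)
    then show ?thesis using t by (simp add: abs_mult)
  qed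
  then have "2 * I3 + W / 2 = 0" by (rule zero_if_arbitrarily_small[OF t2])
  then show ?thesis by (simp add: I3_def W_def S_def)
qed

section \<open>The cubic form estimate and its violation by a concentrated bump\<close>

text \<open>Along a line on which the linear term vanishes the quadratic term is the leading one. The bound is
  uniform in the coordinate after weighting.\<close>

lemma (in germ_expansion) quadratic_part:
  assumes u: "u \<in> X" "\<And>t. (\<lambda>x. t * u x) \<in> X" "\<And>t. nX (\<lambda>x. t * u x) \<le> \<bar>t\<bar> * K"
    and M1: "\<And>j. M 1 [u] j = 0"
  obtains t1 where "t1 > 0" "\<And>t j. \<bar>t\<bar> \<le> t1 \<Longrightarrow>
    real j powr r * cmod (F (\<lambda>x. t * u x) j - complex_of_real (t\<^sup>2) * M 2 [u, u] j) \<le> 2 * B * (R * K) ^ 3 * \<bar>t\<bar> ^ 3"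
proof -
  have K: "K \<ge> 0" using u(3)[of 1] nX_nonneg[OF u(2)[of 1]] by simp
  define t1 where "t1 = min (\<delta> / (2 * (K + 1))) (1 / (2 * (R * (K + 1))))"
  have t1: "t1 > 0" using pos K by (simp add: t1_def)
  show thesis
  proof (rule that[OF t1])
    fix t j assume t: "\<bar>t\<bar> \<le> t1"
    define v where "v x = t * u x" for x
    have v: "v \<in> X" "nX v \<le> \<bar>t\<bar> * K" using u(2,3)[of t] by (simp_all add: v_def[abs_def])
    have "\<bar>t\<bar> * K \<le> \<bar>t\<bar> * (K + 1)" by (intro mult_left_mono) auto
    moreover have "\<bar>t\<bar> * (K + 1) \<le> \<delta> / 2" "R * (\<bar>t\<bar> * (K + 1)) \<le> 1 / 2"
    proof -
      have "\<bar>t\<bar> \<le> \<delta> / (2 * (K + 1))" "\<bar>t\<bar> \<le> 1 / (2 * (R * (K + 1)))" using t by (simp_all add: t1_def)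
      then have "\<bar>t\<bar> * (2 * (K + 1)) \<le> \<delta>" "\<bar>t\<bar> * (2 * (R * (K + 1))) \<le> 1"
        using K pos by (simp_all only: pos_le_divide_eq mult_pos_pos zero_less_numeral add_nonneg_pos zero_less_one)
      then show "\<bar>t\<bar> * (K + 1) \<le> \<delta> / 2" "R * (\<bar>t\<bar> * (K + 1)) \<le> 1 / 2" by (simp_all add: mult_ac)
    qed
    moreover have "R * (\<bar>t\<bar> * K) \<le> R * (\<bar>t\<bar> * (K + 1))"
      using pos by (intro mult_left_mono) auto
    ultimately have b: "\<bar>t\<bar> * K \<le> \<delta> / 2" "R * (\<bar>t\<bar> * K) \<le> 1 / 2"
      by linarith+
    have Rv: "R * nX v \<le> R * (\<bar>t\<bar> * K)" using v pos by simp
    have "real j powr r * cmod (F v j - (\<Sum>n<3. M n (replicate n v) j)) \<le> 2 * B * (R * nX v) ^ 3"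
      by (rule tail_bound[OF v(1) _ order_trans[OF Rv b(2)]]) (use v b pos in linarith)
    also have "\<dots> \<le> 2 * B * (R * (\<bar>t\<bar> * K)) ^ 3"
      using Rv pos nX_nonneg[OF v(1)] by (intro mult_left_mono power_mono) auto
    also have "(\<Sum>n<3. M n (replicate n v) j) = complex_of_real (t\<^sup>2) * M 2 [u, u] j"
    proof -
      have "M n (replicate n v) j = t ^ n *\<^sub>R M n (replicate n u) j" for n
        unfolding v_def[abs_def] using multilinear_on_replicate_scale[OF multilinear u(1,2)] by metis
      then show ?thesis using M0_eq_0 M1 by (simp add: numeral_3_eq_3 numeral_2_eq_2 scaleR_conv_of_real)
    qed
    finally show "real j powr r * cmod (F (\<lambda>x. t * u x) j - complex_of_real (t\<^sup>2) * M 2 [u, u] j) \<le> 2 * B * (R * K) ^ 3 * \<bar>t\<bar> ^ 3"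
      by (simp add: v_def[abs_def] power_mult_distrib mult_ac)
  qed
qed

lemma H0_norm_nonneg: "H0_norm m u \<ge> 0"
  by (simp add: H0_norm_def circle_L2_norm_circ)

lemma C1_trig_series_H0:
  assumes c: "C1_coeffs c" and m: "0 \<le> m" "m \<le> 1"
  shows "trig_series c \<in> H0 m" "H0_norm m (trig_series c) \<le> 2 * C1_norm c"
proof -
  have b: "real s powr m * cmod (c s) \<le> real s * cmod (c s)" for s
  proof (cases "s = 0")
    case False
    then have "real s powr m \<le> real s powr 1" using m by (intro powr_mono) auto
    then show ?thesis by (simp add: mult_right_mono)
  qed simp
  have sc: "summable (\<lambda>s. real s * cmod (c s))" "c 0 = 0" using c by (auto simp: C1_coeffs_def)
  have s: "summable (\<lambda>s. real s powr m * cmod (c s))"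
    by (rule summable_comparison_test'[OF sc(1)]) (use b in auto)
  show "trig_series c \<in> H0 m" by (rule trig_series_in_H0[OF m(1) sc(2) s])
  have "H0_norm m (trig_series c) \<le> sqrt 2 * (\<Sum>s. real s powr m * cmod (c s))"
    by (rule H0_norm_trig_series_le[OF m(1) sc(2) s])
  also have "\<dots> \<le> sqrt 2 * C1_norm c"
    unfolding C1_norm_def by (intro mult_left_mono suminf_le b s sc) auto
  also have "\<dots> \<le> 2 * C1_norm c"
    using C1_norm_nonneg[OF c] sqrt2_less_2 by (intro mult_right_mono) auto
  finally show "H0_norm m (trig_series c) \<le> 2 * C1_norm c" .
qed

lemma trig_series_zero: "trig_series (\<lambda>_. 0) = (\<lambda>_. 0)"
  by (simp add: trig_series_def fun_eq_iff)

lemma trig_series_scale_C1: "C1_coeffs c \<Longrightarrow> trig_series (\<lambda>s. complex_of_real t * c s) = (\<lambda>x. t * trig_series c x)"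
  using trig_series_scale[OF C1_coeffs_summable] by blast

lemma trig_series_diff_C1:
  assumes "C1_coeffs c" "C1_coeffs d"
  shows "trig_series (\<lambda>s. c s - d s) = (\<lambda>x. trig_series c x - trig_series d x)"
proof
  fix x
  note d = C1_coeffs_scale(1)[OF assms(2), of "-1"]
  show "trig_series (\<lambda>s. c s - d s) x = trig_series c x - trig_series d x"
    using trig_series_add[OF C1_coeffs_summable[OF assms(1)] C1_coeffs_summable[OF d]] trig_series_scale_C1[OF assms(2), of "-1"]
    by (simp add: fun_eq_iff)
qed

text \<open>Differentiability at the origin, read in one coordinate.\<close>

lemma remainder_small:
  assumes \<Psi>: "has_deriv_at_0 X nX (hseq r) (hseq_norm r) \<Psi> T_map" and r: "r \<ge> 0"
    and \<Psi>0: "\<Psi> (\<lambda>_. 0) = (\<lambda>_. 0)" and nX: "\<And>u. u \<in> X \<Longrightarrow> nX u \<ge> 0" and \<epsilon>: "\<epsilon> > 0"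
  shows "\<exists>\<eta>>0. \<forall>v\<in>X. nX v < \<eta> \<longrightarrow> cmod (\<Psi> v j - T_map v j) \<le> \<epsilon> * nX v"
proof -
  obtain \<eta> where \<eta>: "\<eta> > 0" and *: "\<And>u. u \<in> X \<Longrightarrow> nX u < \<eta> \<Longrightarrow>
        (\<lambda>t. \<Psi> u t - \<Psi> (\<lambda>_. 0) t - T_map u t) \<in> hseq r \<and>
        hseq_norm r (\<lambda>t. \<Psi> u t - \<Psi> (\<lambda>_. 0) t - T_map u t) \<le> \<epsilon> * nX u"
    using \<Psi> \<epsilon> unfolding has_deriv_at_0_def by meson
  have "cmod (\<Psi> v j - T_map v j) \<le> \<epsilon> * nX v" if v: "v \<in> X" "nX v < \<eta>" for v
  proof -
    define d where "d t = \<Psi> v t - T_map v t" for t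
    have d: "d \<in> hseq r" "hseq_norm r d \<le> \<epsilon> * nX v" using *[OF v] by (simp_all add: \<Psi>0 d_def[abs_def])
    show ?thesis
    proof (cases "j = 0")
      case True
      then show ?thesis using d(1) nX[OF v(1)] \<epsilon> by (simp add: hseq_def d_def)
    next
      case False
      then have "1 * cmod (d j) \<le> real j powr r * cmod (d j)"
        using r by (intro mult_right_mono ge_one_powr_ge_zero) auto
      also have "\<dots> \<le> \<epsilon> * nX v" using hseq_component_le[OF d(1), of j] d(2) by linarith
      finally show ?thesis by (simp add: d_def)
    qed
  qed
  then show ?thesis using \<eta> by blast
qed

lemma T_map_trig_series:
  assumes "C1_coeffs c"
  shows "T_map (trig_series c) j = complex_of_real (real j powr (- 1/2)) * c j"
  using fourier_coeff_trig_series[OF C1_coeffs_summable[OF assms], of j] by (simp add: T_map_def)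

text \<open>The expansion at \<open>m = 1\<close> serves to solve \<open>\<Psi>(w) = - \<Psi>(u)\<close> where \<open>h_KdV\<close> is defined, and the
  one at \<open>m = 0\<close> gives the bound on the quadratic part. Both expand the same function, so their
  quadratic parts agree.\<close>

lemma cubic_form_estimate:
  assumes \<kappa>: "\<kappa> > 1"
    and analytic: "\<And>m. m \<ge> 0 \<Longrightarrow> analytic_germ (H0 m) (H0_norm m) (hseq (m + 1/2)) (hseq_norm (m + 1/2)) \<Psi>"
    and deriv: "\<And>m. m \<ge> 0 \<Longrightarrow> has_deriv_at_0 (H0 m) (H0_norm m) (hseq (m + 1/2)) (hseq_norm (m + 1/2)) \<Psi> T_map"
    and smoothing: "\<And>m. m \<ge> 0 \<Longrightarrow> analytic_germ (H0 m) (H0_norm m) (hseq (m + 1/2 + \<kappa>)) (hseq_norm (m + 1/2 + \<kappa>))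
           (\<lambda>u j. \<Psi> u j - T_map u j)"
    and kdv: "\<delta>h > 0" "\<And>u. u \<in> H0 1 \<Longrightarrow> H0_norm 1 u < \<delta>h \<Longrightarrow> h_KdV u = f (\<lambda>j. 1/2 * (cmod (\<Psi> u j))\<^sup>2)"
  obtains C where "C \<ge> 0" "\<And>c. C1_coeffs c \<Longrightarrow> finite {s. c s \<noteq> 0} \<Longrightarrow>
    integral\<^sup>L circ (\<lambda>x. trig_series c x ^ 3) \<le>
      C * (H0_norm 0 (trig_series c))\<^sup>2 * sqrt (\<Sum>s | c s \<noteq> 0. (real s powr (2 - \<kappa>) * cmod (c s))\<^sup>2)"
proof -
  define P where "P = (\<lambda>u j. \<Psi> u j - T_map u j)"
  have zero: "C1_coeffs (\<lambda>_. 0)" "C1_norm (\<lambda>_. 0) = 0" by (auto simp: C1_coeffs_def C1_norm_def)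
  have zX: "(\<lambda>_. 0) \<in> H0 m" "H0_norm m (\<lambda>_. 0) = 0" if "0 \<le> m" "m \<le> 1" for m
    using C1_trig_series_H0[OF zero(1) that] H0_norm_nonneg[of m "\<lambda>_. 0"] by (simp_all add: trig_series_zero zero)
  have \<Psi>0: "\<Psi> (\<lambda>_. 0) = (\<lambda>_. 0)" using analytic[of 0] by (simp add: analytic_germ_def)
  obtain M0 B0 R0 \<delta>0 where "germ_expansion (H0 0) (H0_norm 0) (0 + 1/2 + \<kappa>) P M0 B0 R0 \<delta>0"
    unfolding P_def by (rule analytic_germ_expansion[OF smoothing[OF order_refl] H0_norm_nonneg]) (use zX in auto)
  then interpret E0: germ_expansion "H0 0" "H0_norm 0" "0 + 1/2 + \<kappa>" P M0 B0 R0 \<delta>0 .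
  obtain M1 B1 R1 \<delta>1 where "germ_expansion (H0 1) (H0_norm 1) (1 + 1/2 + \<kappa>) P M1 B1 R1 \<delta>1"
    unfolding P_def by (rule analytic_germ_expansion[OF smoothing[OF zero_le_one] H0_norm_nonneg]) (use zX in auto)
  then interpret E1: germ_expansion "H0 1" "H0_norm 1" "1 + 1/2 + \<kappa>" P M1 B1 R1 \<delta>1 .
  have small: "\<exists>\<eta>>0. \<forall>v\<in>H0 m. H0_norm m v < \<eta> \<longrightarrow> cmod (P v j) \<le> \<epsilon> * H0_norm m v" if "m \<ge> 0" "\<epsilon> > 0" for m \<epsilon> j
    unfolding P_def using remainder_small[OF deriv[OF that(1)] _ \<Psi>0 H0_norm_nonneg that(2)] that by simp
  have tX: "(\<lambda>x. t * trig_series c x) \<in> H0 m" "H0_norm m (\<lambda>x. t * trig_series c x) \<le> \<bar>t\<bar> * (2 * C1_norm c)"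
    if "C1_coeffs c" "0 \<le> m" "m \<le> 1" for c t m
    using C1_trig_series_H0[OF C1_coeffs_scale(1)[OF that(1), of t] that(2,3)]
    by (simp_all add: trig_series_scale_C1[OF that(1)] C1_coeffs_scale[OF that(1)])
  have lin0: "M0 1 [trig_series c] j = 0" if "C1_coeffs c" for c j
    by (rule E0.M1_eq_0[OF C1_trig_series_H0(1)[OF that] tX[OF that] small]) auto
  have lin1: "M1 1 [trig_series c] j = 0" if "C1_coeffs c" for c j
    by (rule E1.M1_eq_0[OF C1_trig_series_H0(1)[OF that] tX[OF that] small]) auto
  define p where "p c = P (trig_series c)" for c
  \<comment> \<open>The norm of \<open>H0 1\<close> is at most twice \<open>C1_norm\<close>, so the ball of radius \<open>\<rho>0\<close> lies in the domains of
      the expansion, of the Lipschitz bound and of the factorization of \<open>h_KdV\<close>.\<close>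
  define \<rho>0 where "\<rho>0 = Min {\<delta>1 / 4, 1 / (8 * R1), \<delta>h / 4}"
  have \<rho>0: "\<rho>0 > 0" "2 * \<rho>0 < \<delta>1" "R1 * (2 * \<rho>0) \<le> 1/4" "2 * \<rho>0 < \<delta>h"
  proof -
    have "\<rho>0 \<le> \<delta>1 / 4" "\<rho>0 \<le> 1 / (8 * R1)" "\<rho>0 \<le> \<delta>h / 4" by (simp_all add: \<rho>0_def)
    then show "2 * \<rho>0 < \<delta>1" "R1 * (2 * \<rho>0) \<le> 1/4" "2 * \<rho>0 < \<delta>h"
      using E1.pos kdv(1) by (auto simp: field_simps)
    show "\<rho>0 > 0" using E1.pos kdv(1) by (simp add: \<rho>0_def)
  qed
  define \<Lambda> where "\<Lambda> = 16 * B1 * R1\<^sup>2"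
  have \<Lambda>: "\<Lambda> \<ge> 0" using E1.pos by (simp add: \<Lambda>_def)
  have p0: "p (\<lambda>_. 0) j = 0" for j using E1.F_zero by (simp add: p_def trig_series_zero)
  have lip: "real j powr (3/2 + \<kappa>) * cmod (p c j - p d j) \<le> \<Lambda> * \<rho> * C1_norm (\<lambda>s. c s - d s)"
    if c: "C1_coeffs c" and d: "C1_coeffs d" and \<rho>: "C1_norm c \<le> \<rho>" "C1_norm d \<le> \<rho>" "\<rho> \<le> \<rho>0" for c d \<rho> j
  proof -
    have "real j powr (1 + 1/2 + \<kappa>) * cmod (P (trig_series c) j - P (trig_series d) j)
        \<le> 4 * B1 * R1\<^sup>2 * (2 * \<rho>) * (2 * C1_norm (\<lambda>s. c s - d s))"
    proof (rule E1.lipschitz_bound)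
      show "trig_series c \<in> H0 1" "trig_series d \<in> H0 1" using C1_trig_series_H0[of _ 1] c d by auto
      show "H0_norm 1 (trig_series c) \<le> 2 * \<rho>" "H0_norm 1 (trig_series d) \<le> 2 * \<rho>"
        using C1_trig_series_H0(2)[OF c, of 1] C1_trig_series_H0(2)[OF d, of 1] \<rho> by auto
      show "(\<lambda>x. trig_series c x - trig_series d x) \<in> H0 1" "H0_norm 1 (\<lambda>x. trig_series c x - trig_series d x) \<le> 2 * C1_norm (\<lambda>s. c s - d s)"
        using C1_trig_series_H0[OF C1_coeffs_diff[OF c d], of 1] by (simp_all add: trig_series_diff_C1[OF c d])
      show "2 * \<rho> < \<delta>1" using \<rho> \<rho>0 by linarith
      have "R1 * (2 * \<rho>) \<le> R1 * (2 * \<rho>0)" using E1.pos \<rho> by simp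
      then show "R1 * (2 * \<rho>) \<le> 1/4" using \<rho>0 by linarith
    qed (use lin1 c d in auto)
    then show ?thesis by (simp add: p_def \<Lambda>_def mult_ac)
  qed
  have in_ball: "H0_norm 1 (trig_series c) < \<delta>1 \<and> H0_norm 1 (trig_series c) < \<delta>h \<and> trig_series c \<in> H0 1"
    if "C1_coeffs c" "C1_norm c \<le> \<rho>0" for c
    using C1_trig_series_H0[OF that(1), of 1] that(2) \<rho>0 by auto
  have index0: "p c 0 = 0" if "C1_coeffs c" "C1_norm c \<le> \<rho>0" for c
    using E1.F_hseq[of "trig_series c"] in_ball[OF that] by (simp add: p_def hseq_def)
  have inv: "h_KdV (trig_series c) = h_KdV (trig_series d)"
    if c: "C1_coeffs c" "C1_norm c \<le> \<rho>0" and d: "C1_coeffs d" "C1_norm d \<le> \<rho>0"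
      and eq: "\<And>j. cmod (complex_of_real (real j powr (- 1/2)) * c j + p c j) =
             cmod (complex_of_real (real j powr (- 1/2)) * d j + p d j)" for c d
  proof -
    have "\<Psi> (trig_series a) j = complex_of_real (real j powr (- 1/2)) * a j + p a j" if "C1_coeffs a" for a j
      using T_map_trig_series[OF that, of j] by (simp add: p_def P_def)
    then show ?thesis using kdv(2) in_ball[OF c] in_ball[OF d] eq c d by simp
  qed
  have estimate: "integral\<^sup>L circ (\<lambda>x. trig_series c x ^ 3) \<le>
      (B0 * R0\<^sup>2) * (H0_norm 0 (trig_series c))\<^sup>2 * sqrt (\<Sum>s | c s \<noteq> 0. (real s powr (2 - \<kappa>) * cmod (c s))\<^sup>2)"
    if c: "C1_coeffs c" and fin: "finite {s. c s \<noteq> 0}" for c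
  proof -
    define u where "u = trig_series c"
    define Q where "Q = M0 2 [u, u]"
    define N where "N = 2 * C1_norm c"
    have u: "u \<in> H0 0" "u \<in> H0 1" unfolding u_def using C1_trig_series_H0[OF c] by auto
    obtain t1 where t1: "t1 > 0" "\<And>t j. \<bar>t\<bar> \<le> t1 \<Longrightarrow>
        real j powr (1 + 1/2 + \<kappa>) * cmod (P (\<lambda>x. t * u x) j - complex_of_real (t\<^sup>2) * M1 2 [u, u] j) \<le> 2 * B1 * (R1 * N) ^ 3 * \<bar>t\<bar> ^ 3"
      by (rule E1.quadratic_part[of u N]) (use u tX[OF c] lin1[OF c] in \<open>auto simp: u_def N_def\<close>)
    obtain t2 where t2: "t2 > 0" "\<And>t j. \<bar>t\<bar> \<le> t2 \<Longrightarrow>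
        real j powr (0 + 1/2 + \<kappa>) * cmod (P (\<lambda>x. t * u x) j - complex_of_real (t\<^sup>2) * Q j) \<le> 2 * B0 * (R0 * N) ^ 3 * \<bar>t\<bar> ^ 3"
      unfolding Q_def by (rule E0.quadratic_part[of u N]) (use u tX[OF c] lin0[OF c] in \<open>auto simp: u_def N_def\<close>)
    have same: "M1 2 [u, u] j = Q j" for j
    proof (cases "j = 0")
      case True
      then show ?thesis using E1.M_0_index[of "[u, u]" 2] E0.M_0_index[of "[u, u]" 2] u by (simp add: Q_def)
    next
      case False
      have drop: "y \<le> z" if "real j powr q * y \<le> z" "y \<ge> 0" "q \<ge> 0" for y z q
      proof -
        have "1 * y \<le> real j powr q * y" using False that by (intro mult_right_mono ge_one_powr_ge_zero) auto
        then show ?thesis using that by linarith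
      qed
      have "cmod (M1 2 [u, u] j - Q j) = 0"
      proof (rule zero_if_arbitrarily_small[of "min t1 t2"])
        show "min t1 t2 > 0" using t1 t2 by simp
        fix t assume t: "0 < t" "t \<le> min t1 t2"
        define x where "x = P (\<lambda>x. t * u x) j"
        have 1: "cmod (x - complex_of_real (t\<^sup>2) * M1 2 [u, u] j) \<le> 2 * B1 * (R1 * N) ^ 3 * t ^ 3"
          by (rule drop[of "1 + 1/2 + \<kappa>"]) (use t1(2)[of t j] t \<kappa> in \<open>auto simp: x_def\<close>)
        have 2: "cmod (x - complex_of_real (t\<^sup>2) * Q j) \<le> 2 * B0 * (R0 * N) ^ 3 * t ^ 3"
          by (rule drop[of "0 + 1/2 + \<kappa>"]) (use t2(2)[of t j] t \<kappa> in \<open>auto simp: x_def\<close>)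
        have "t\<^sup>2 * cmod (M1 2 [u, u] j - Q j) = cmod ((x - complex_of_real (t\<^sup>2) * Q j) - (x - complex_of_real (t\<^sup>2) * M1 2 [u, u] j))"
        proof -
          have "(x - complex_of_real (t\<^sup>2) * Q j) - (x - complex_of_real (t\<^sup>2) * M1 2 [u, u] j) = complex_of_real (t\<^sup>2) * (M1 2 [u, u] j - Q j)"
            by (simp add: algebra_simps)
          then show ?thesis by (simp only: norm_mult norm_of_real) simp
        qed
        also have "\<dots> \<le> 2 * B0 * (R0 * N) ^ 3 * t ^ 3 + 2 * B1 * (R1 * N) ^ 3 * t ^ 3"
          by (rule order_trans[OF norm_triangle_ineq4 add_mono[OF 2 1]])
        also have "\<dots> = t\<^sup>2 * ((2 * B0 * (R0 * N) ^ 3 + 2 * B1 * (R1 * N) ^ 3) * t)"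
          by (simp add: algebra_simps power2_eq_square power3_eq_cube)
        finally show "\<bar>cmod (M1 2 [u, u] j - Q j)\<bar> \<le> (2 * B0 * (R0 * N) ^ 3 + 2 * B1 * (R1 * N) ^ 3) * t"
          using t by simp
      qed
      then show ?thesis by simp
    qed
    have "integral\<^sup>L circ (\<lambda>x. trig_series c x ^ 3) = - 1/4 * (\<Sum>s | c s \<noteq> 0. real s powr (5/2) * Re (c s * cnj (Q s)))"
    proof (rule cubic_identity[OF \<kappa> \<Lambda> \<rho>0(1) p0 lip index0 inv c fin t1(1)])
      fix t j assume "\<bar>t\<bar> \<le> t1"
      then show "real j powr (3/2 + \<kappa>) * cmod (p (\<lambda>s. complex_of_real t * c s) j - complex_of_real (t\<^sup>2) * Q j) \<le> (2 * B1 * (R1 * N) ^ 3) * \<bar>t\<bar> ^ 3"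
        using t1(2)[of t j] by (simp add: p_def trig_series_scale_C1[OF c] same[unfolded u_def] u_def)
    qed
    also have "\<dots> \<le> (\<Sum>s | c s \<noteq> 0. \<bar>real s powr (2 - \<kappa>) * cmod (c s)\<bar> * \<bar>real s powr (1/2 + \<kappa>) * cmod (Q s)\<bar>)"
    proof -
      have pointwise: "- Re (c s * cnj (Q s)) * real s powr (5/2) \<le> \<bar>real s powr (2 - \<kappa>) * cmod (c s)\<bar> * \<bar>real s powr (1/2 + \<kappa>) * cmod (Q s)\<bar>" for s
      proof -
        have "- Re (c s * cnj (Q s)) \<le> cmod (c s) * cmod (Q s)"
          using abs_Re_le_cmod[of "c s * cnj (Q s)"] by (simp only: norm_mult complex_mod_cnj)
        then have "- Re (c s * cnj (Q s)) * real s powr (5/2) \<le> cmod (c s) * cmod (Q s) * real s powr (5/2)"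
          by (rule mult_right_mono) simp
        also have "\<dots> = \<bar>real s powr (2 - \<kappa>) * cmod (c s)\<bar> * \<bar>real s powr (1/2 + \<kappa>) * cmod (Q s)\<bar>"
        proof -
          have "real s powr (5/2) = real s powr (2 - \<kappa>) * real s powr (1/2 + \<kappa>)"
            by (simp add: powr_add[symmetric])
          then show ?thesis by (simp add: abs_mult mult_ac)
        qed
        finally show ?thesis .
      qed
      have "- 1/4 * (\<Sum>s | c s \<noteq> 0. real s powr (5/2) * Re (c s * cnj (Q s)))
          = 1/4 * (\<Sum>s | c s \<noteq> 0. - Re (c s * cnj (Q s)) * real s powr (5/2))"
        unfolding sum_distrib_left by (intro sum.cong refl) (simp add: algebra_simps)
      also have "\<dots> \<le> 1/4 * (\<Sum>s | c s \<noteq> 0. \<bar>real s powr (2 - \<kappa>) * cmod (c s)\<bar> * \<bar>real s powr (1/2 + \<kappa>) * cmod (Q s)\<bar>)"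
        by (intro mult_left_mono sum_mono pointwise) auto
      also have "\<dots> \<le> 1 * (\<Sum>s | c s \<noteq> 0. \<bar>real s powr (2 - \<kappa>) * cmod (c s)\<bar> * \<bar>real s powr (1/2 + \<kappa>) * cmod (Q s)\<bar>)"
        by (intro mult_right_mono sum_nonneg) auto
      finally show ?thesis by simp
    qed
    also have "\<dots> \<le> sqrt (\<Sum>s | c s \<noteq> 0. (real s powr (2 - \<kappa>) * cmod (c s))\<^sup>2) * sqrt (\<Sum>s | c s \<noteq> 0. (real s powr (1/2 + \<kappa>) * cmod (Q s))\<^sup>2)"
      using L2_set_mult_ineq by (simp only: L2_set_def)
    also have "\<dots> \<le> sqrt (\<Sum>s | c s \<noteq> 0. (real s powr (2 - \<kappa>) * cmod (c s))\<^sup>2) * ((B0 * R0\<^sup>2) * (H0_norm 0 (trig_series c))\<^sup>2)"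
    proof (rule mult_left_mono)
      have QH: "Q \<in> hseq (0 + 1/2 + \<kappa>)" unfolding Q_def by (rule E0.M_hseq) (use u in auto)
      have "(\<Sum>s | c s \<noteq> 0. (real s powr (1/2 + \<kappa>) * cmod (Q s))\<^sup>2) = (\<Sum>s | c s \<noteq> 0. real s powr (2 * (0 + 1/2 + \<kappa>)) * (cmod (Q s))\<^sup>2)"
        by (intro sum.cong refl) (simp add: power_mult_distrib power2_eq_square powr_add[symmetric])
      also have "\<dots> \<le> (\<Sum>s. real s powr (2 * (0 + 1/2 + \<kappa>)) * (cmod (Q s))\<^sup>2)"
        using QH fin by (intro sum_le_suminf) (auto simp: hseq_def)
      finally have "sqrt (\<Sum>s | c s \<noteq> 0. (real s powr (1/2 + \<kappa>) * cmod (Q s))\<^sup>2) \<le> hseq_norm (0 + 1/2 + \<kappa>) Q"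
        by (simp add: hseq_norm_def)
      also have "\<dots> \<le> B0 * R0 ^ 2 * prod_list (map (H0_norm 0) [u, u])"
        unfolding Q_def by (rule E0.M_norm) (use u in auto)
      finally show "sqrt (\<Sum>s | c s \<noteq> 0. (real s powr (1/2 + \<kappa>) * cmod (Q s))\<^sup>2) \<le> (B0 * R0\<^sup>2) * (H0_norm 0 (trig_series c))\<^sup>2"
        by (simp add: u_def power2_eq_square)
    qed (simp add: sum_nonneg)
    finally show ?thesis by (simp add: mult_ac)
  qed
  show thesis by (rule that[of "B0 * R0\<^sup>2"]) (use E0.pos estimate in auto)
qed

definition cosine_coeffs :: "nat \<Rightarrow> nat \<Rightarrow> complex" where
  "cosine_coeffs N s = (if 1 \<le> s \<and> s \<le> N then sqrt pi else 0)"

lemma cosine_coeffs_support: "{s. cosine_coeffs N s \<noteq> 0} = {1..N}"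
  by (auto simp: cosine_coeffs_def)

lemma cosine_coeffs_C1: "C1_coeffs (cosine_coeffs N)"
proof -
  have "summable (\<lambda>s. real s * cmod (cosine_coeffs N s))"
    by (rule summable_finite[of "{1..N}"]) (auto simp: cosine_coeffs_def)
  then show ?thesis by (simp add: C1_coeffs_def cosine_coeffs_def)
qed

lemma trig_series_cosine_coeffs: "trig_series (cosine_coeffs N) x = (\<Sum>s=1..N. cos (real s * x))"
proof -
  have "(\<Sum>s. Re (cosine_coeffs N s * cis (real s * x))) = (\<Sum>s=1..N. Re (cosine_coeffs N s * cis (real s * x)))"
    by (rule suminf_finite) (auto simp: cosine_coeffs_def)
  also have "\<dots> = sqrt pi * (\<Sum>s=1..N. cos (real s * x))"
    unfolding sum_distrib_left by (intro sum.cong refl) (auto simp: cosine_coeffs_def)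
  finally show ?thesis by (simp add: trig_series_def)
qed

lemma H0_norm_0_cosine_coeffs: "(H0_norm 0 (trig_series (cosine_coeffs N)))\<^sup>2 = real N * pi"
proof -
  have "(\<Sum>s. (cmod (cosine_coeffs N s))\<^sup>2) = (\<Sum>s=1..N. (cmod (cosine_coeffs N s))\<^sup>2)"
    by (rule suminf_finite) (auto simp: cosine_coeffs_def)
  also have "\<dots> = (\<Sum>s=1..N. pi)" by (intro sum.cong refl) (auto simp: cosine_coeffs_def)
  finally have *: "(\<Sum>s. (cmod (cosine_coeffs N s))\<^sup>2) = real N * pi" by simp
  have "H0_norm 0 (trig_series (cosine_coeffs N)) = sqrt (real N * pi)"
    using H0_norm_0_trig_series[of "cosine_coeffs N", OF _ C1_coeffs_summable[OF cosine_coeffs_C1]]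
      cosine_coeffs_C1[of N, unfolded C1_coeffs_def]
    by (simp add: *)
  then show ?thesis by simp
qed

text \<open>Four times the product is the sum of the cosines of \<open>(j \<plusminus> k \<plusminus> l) x\<close>, and each of these has integral
  \<open>0\<close> or \<open>2 \<pi>\<close>.\<close>

lemma integral_cos_cos_cos:
  fixes j k l :: nat
  shows "integral\<^sup>L circ (\<lambda>x. cos (real j * x) * cos (real k * x) * cos (real l * x)) \<ge> 0"
    and "l = j + k \<Longrightarrow> integral\<^sup>L circ (\<lambda>x. cos (real j * x) * cos (real k * x) * cos (real l * x)) \<ge> pi / 2"
proof -
  define C where "C n = integral\<^sup>L circ (\<lambda>x. cos (real_of_int n * x))" for n
  have C: "C n \<ge> 0" "C 0 = 2 * pi" for n
    unfolding C_def integral_circ_cos_int by auto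
  have i: "integrable circ (\<lambda>x. cos (real_of_int n * x))" for n
    by (intro integrable_circ_continuous continuous_intros)
  have e: "cos (real j * x) * cos (real k * x) * cos (real l * x) =
     (1/4) * cos (real_of_int (int j + int k + int l) * x) + (1/4) * cos (real_of_int (int j + int k - int l) * x)
     + (1/4) * cos (real_of_int (int j - int k + int l) * x) + (1/4) * cos (real_of_int (int j - int k - int l) * x)" for x
    by (simp add: algebra_simps cos_add cos_diff sin_add sin_diff)
  have *: "integral\<^sup>L circ (\<lambda>x. cos (real j * x) * cos (real k * x) * cos (real l * x)) =
      (1/4) * C (int j + int k + int l) + (1/4) * C (int j + int k - int l)
      + (1/4) * C (int j - int k + int l) + (1/4) * C (int j - int k - int l)"
    unfolding e C_def
    by (simp only: Bochner_Integration.integral_add Bochner_Integration.integrable_add integrable_mult_right integral_mult_right_zero i)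
  show "integral\<^sup>L circ (\<lambda>x. cos (real j * x) * cos (real k * x) * cos (real l * x)) \<ge> 0"
    unfolding * by (intro add_nonneg_nonneg mult_nonneg_nonneg C) auto
  assume "l = j + k"
  then have "int j + int k - int l = 0" by simp
  then show "integral\<^sup>L circ (\<lambda>x. cos (real j * x) * cos (real k * x) * cos (real l * x)) \<ge> pi / 2"
    unfolding * using C(1)[of "int j + int k + int l"] C(1)[of "int j - int k + int l"] C(1)[of "int j - int k - int l"] C(2)
    by simp
qed

text \<open>All terms of the expanded cube have nonnegative integrals. The \<open>n\<^sup>2\<close> terms with \<open>j, k \<le> n\<close> and
  \<open>l = j + k\<close> already give the bound.\<close>

lemma integral_cosine_sum_cubed:
  "integral\<^sup>L circ (\<lambda>x. trig_series (cosine_coeffs (2 * n)) x ^ 3) \<ge> (real n)\<^sup>2 * (pi / 2)"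
proof -
  define I where "I j k l = integral\<^sup>L circ (\<lambda>x. cos (real j * x) * cos (real k * x) * cos (real l * x))" for j k l :: nat
  have I0: "I j k l \<ge> 0" for j k l unfolding I_def by (rule integral_cos_cos_cos)
  have i: "integrable circ (\<lambda>x. cos (real j * x) * cos (real k * x) * cos (real l * x))" for j k l :: nat
    by (intro integrable_circ_continuous continuous_intros)
  have cube: "trig_series (cosine_coeffs (2 * n)) x ^ 3 = (\<Sum>j=1..2*n. \<Sum>k=1..2*n. \<Sum>l=1..2*n. cos (real j * x) * cos (real k * x) * cos (real l * x))" for x
    unfolding trig_series_cosine_coeffs power3_eq_cube
    by (subst sum_product) (simp only: sum_distrib_right, simp only: sum_distrib_left)
  have "(real n)\<^sup>2 * (pi / 2) = (\<Sum>j=1..n. \<Sum>k=1..n. pi / 2)" by (simp add: power2_eq_square)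
  also have "\<dots> \<le> (\<Sum>j=1..n. \<Sum>k=1..n. \<Sum>l=1..2*n. I j k l)"
  proof (intro sum_mono)
    fix j k assume jk: "j \<in> {1..n}" "k \<in> {1..n}"
    have "pi / 2 \<le> I j k (j + k)" unfolding I_def by (rule integral_cos_cos_cos(2)) simp
    also have "\<dots> \<le> (\<Sum>l=1..2*n. I j k l)" using jk I0 by (intro member_le_sum) auto
    finally show "pi / 2 \<le> (\<Sum>l=1..2*n. I j k l)" .
  qed
  also have "\<dots> \<le> (\<Sum>j=1..n. \<Sum>k=1..2*n. \<Sum>l=1..2*n. I j k l)"
    by (intro sum_mono sum_mono2 sum_nonneg I0) auto
  also have "\<dots> \<le> (\<Sum>j=1..2*n. \<Sum>k=1..2*n. \<Sum>l=1..2*n. I j k l)"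
    by (intro sum_mono2 sum_nonneg I0) auto
  also have "\<dots> = integral\<^sup>L circ (\<lambda>x. trig_series (cosine_coeffs (2 * n)) x ^ 3)"
    unfolding cube I_def
    by (simp only: Bochner_Integration.integral_sum Bochner_Integration.integrable_sum i)
  finally show ?thesis .
qed

theorem proposition2p2:
  fixes \<kappa> :: real
  assumes "\<kappa> \<ge> 0"
    and "\<exists>\<Psi> :: (real \<Rightarrow> real) \<Rightarrow> nat \<Rightarrow> complex.
      (\<forall>m\<ge>0.
         analytic_germ (H0 m) (H0_norm m) (hseq (m + 1/2)) (hseq_norm (m + 1/2)) \<Psi> \<and>
         has_deriv_at_0 (H0 m) (H0_norm m) (hseq (m + 1/2)) (hseq_norm (m + 1/2)) \<Psi> T_map) \<and>
      (\<forall>m\<ge>0.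
         analytic_germ (H0 m) (H0_norm m) (hseq (m + 1/2 + \<kappa>)) (hseq_norm (m + 1/2 + \<kappa>))
           (\<lambda>u j. \<Psi> u j - T_map u j)) \<and>
      (\<exists>f :: (nat \<Rightarrow> real) \<Rightarrow> real. \<forall>m\<ge>1. \<exists>\<delta>>0. \<forall>u\<in>H0 m.
         H0_norm m u < \<delta> \<longrightarrow> h_KdV u = f (\<lambda>j. 1/2 * (cmod (\<Psi> u j))\<^sup>2))"
  shows "\<kappa> \<le> 3/2"
proof (rule ccontr)
  assume "\<not> \<kappa> \<le> 3/2"
  then have \<kappa>: "\<kappa> > 3/2" by simp
  from assms(2) obtain \<Psi> :: "(real \<Rightarrow> real) \<Rightarrow> nat \<Rightarrow> complex" where
    \<Psi>: "\<And>m. m \<ge> 0 \<Longrightarrow> analytic_germ (H0 m) (H0_norm m) (hseq (m + 1/2)) (hseq_norm (m + 1/2)) \<Psi>"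
      "\<And>m. m \<ge> 0 \<Longrightarrow> has_deriv_at_0 (H0 m) (H0_norm m) (hseq (m + 1/2)) (hseq_norm (m + 1/2)) \<Psi> T_map"
      "\<And>m. m \<ge> 0 \<Longrightarrow> analytic_germ (H0 m) (H0_norm m) (hseq (m + 1/2 + \<kappa>)) (hseq_norm (m + 1/2 + \<kappa>))
           (\<lambda>u j. \<Psi> u j - T_map u j)"
    and ex: "\<exists>f :: (nat \<Rightarrow> real) \<Rightarrow> real. \<forall>m\<ge>1. \<exists>\<delta>>0. \<forall>u\<in>H0 m.
         H0_norm m u < \<delta> \<longrightarrow> h_KdV u = f (\<lambda>j. 1/2 * (cmod (\<Psi> u j))\<^sup>2)"
    by auto
  from ex obtain f where f: "\<forall>m\<ge>1. \<exists>\<delta>>0. \<forall>u\<in>H0 m.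
         H0_norm m u < \<delta> \<longrightarrow> h_KdV u = f (\<lambda>j. 1/2 * (cmod (\<Psi> u j))\<^sup>2)" by (elim exE)
  obtain \<delta> where \<delta>: "\<delta> > 0" "\<And>u. u \<in> H0 1 \<Longrightarrow> H0_norm 1 u < \<delta> \<Longrightarrow> h_KdV u = f (\<lambda>j. 1/2 * (cmod (\<Psi> u j))\<^sup>2)"
    using f[rule_format, OF order_refl] by auto
  have "\<kappa> > 1" using \<kappa> by simp
  obtain C where C: "C \<ge> 0" and est: "\<And>c. C1_coeffs c \<Longrightarrow> finite {s. c s \<noteq> 0} \<Longrightarrow>
    integral\<^sup>L circ (\<lambda>x. trig_series c x ^ 3) \<le>
      C * (H0_norm 0 (trig_series c))\<^sup>2 * sqrt (\<Sum>s | c s \<noteq> 0. (real s powr (2 - \<kappa>) * cmod (c s))\<^sup>2)"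
    using cubic_form_estimate[OF \<open>\<kappa> > 1\<close> \<Psi> \<delta>] by blast
  \<comment> \<open>For \<open>\<kappa> > 2\<close> the weight \<open>s\<^sup>2\<^sup>-\<^sup>\<kappa>\<close> decays and is bounded by \<open>1\<close>.\<close>
  define \<theta> where "\<theta> = max 0 (2 - \<kappa>)"
  have \<theta>: "0 \<le> \<theta>" "\<theta> < 1/2" "2 - \<kappa> \<le> \<theta>" using \<kappa> by (auto simp: \<theta>_def max_def)
  have bound: "real (2 * n) powr (1/2 - \<theta>) \<le> 8 * C * sqrt pi" if n: "n \<ge> 1" for n :: nat
  proof -
    define N where "N = real (2 * n)"
    have N: "N > 0" using n by (simp add: N_def)
    have "(\<Sum>s | cosine_coeffs (2 * n) s \<noteq> 0. (real s powr (2 - \<kappa>) * cmod (cosine_coeffs (2 * n) s))\<^sup>2)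
        \<le> (\<Sum>s | cosine_coeffs (2 * n) s \<noteq> 0. (N powr \<theta> * sqrt pi)\<^sup>2)"
      unfolding cosine_coeffs_support
    proof (rule sum_mono)
      fix s assume s: "s \<in> {1..2 * n}"
      have "real s powr (2 - \<kappa>) \<le> real s powr \<theta>" using s \<theta> by (intro powr_mono) auto
      also have "\<dots> \<le> N powr \<theta>" using s \<theta> by (intro powr_mono2) (auto simp: N_def)
      finally show "(real s powr (2 - \<kappa>) * cmod (cosine_coeffs (2 * n) s))\<^sup>2 \<le> (N powr \<theta> * sqrt pi)\<^sup>2"
        using s by (intro power_mono mult_mono) (auto simp: cosine_coeffs_def)
    qed
    also have "\<dots> = N * (N powr \<theta> * sqrt pi)\<^sup>2" by (simp add: cosine_coeffs_support N_def)
    finally have "sqrt (\<Sum>s | cosine_coeffs (2 * n) s \<noteq> 0. (real s powr (2 - \<kappa>) * cmod (cosine_coeffs (2 * n) s))\<^sup>2)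
        \<le> sqrt (N * (N powr \<theta> * sqrt pi)\<^sup>2)" by (rule real_sqrt_le_mono)
    also have "\<dots> = N powr (1/2 + \<theta>) * sqrt pi"
      using N by (simp add: real_sqrt_mult powr_add powr_half_sqrt)
    finally have S: "sqrt (\<Sum>s | cosine_coeffs (2 * n) s \<noteq> 0. (real s powr (2 - \<kappa>) * cmod (cosine_coeffs (2 * n) s))\<^sup>2)
        \<le> N powr (1/2 + \<theta>) * sqrt pi" .
    have "N\<^sup>2 * (pi / 8) = (real n)\<^sup>2 * (pi / 2)" by (simp add: N_def power_mult_distrib)
    also have "\<dots> \<le> integral\<^sup>L circ (\<lambda>x. trig_series (cosine_coeffs (2 * n)) x ^ 3)"
      by (rule integral_cosine_sum_cubed)
    also have "\<dots> \<le> C * (N * pi) * sqrt (\<Sum>s | cosine_coeffs (2 * n) s \<noteq> 0. (real s powr (2 - \<kappa>) * cmod (cosine_coeffs (2 * n) s))\<^sup>2)"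
      using est[OF cosine_coeffs_C1, of "2 * n"] unfolding H0_norm_0_cosine_coeffs
      by (simp add: cosine_coeffs_support N_def)
    also have "\<dots> \<le> C * (N * pi) * (N powr (1/2 + \<theta>) * sqrt pi)"
      using C N by (intro mult_left_mono S) auto
    finally have "N * N * (pi / 8) \<le> N * (C * pi * sqrt pi * N powr (1/2 + \<theta>))" by (simp add: power2_eq_square mult_ac)
    then have "N * (pi / 8) \<le> C * pi * sqrt pi * N powr (1/2 + \<theta>)" using N by (simp add: mult.assoc)
    moreover have "N powr (1/2 - \<theta>) * N powr (1/2 + \<theta>) = N" using N by (simp add: powr_add[symmetric])
    then have "(N powr (1/2 - \<theta>) * (pi / 8)) * N powr (1/2 + \<theta>) = N * (pi / 8)"
      by (metis mult.assoc mult.commute)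
    ultimately have "(N powr (1/2 - \<theta>) * (pi / 8)) * N powr (1/2 + \<theta>) \<le> (C * pi * sqrt pi) * N powr (1/2 + \<theta>)"
      by simp
    then have "N powr (1/2 - \<theta>) * (pi / 8) \<le> C * pi * sqrt pi" using N by simp
    then have "pi * N powr (1/2 - \<theta>) \<le> pi * (8 * C * sqrt pi)" by (simp add: field_simps)
    then show ?thesis by (simp add: N_def)
  qed
  define D where "D = 8 * C * sqrt pi"
  have D: "D \<ge> 0" using C by (simp add: D_def)
  obtain n :: nat where n: "(D + 1) powr (1 / (1/2 - \<theta>)) < real n" using reals_Archimedean2 by blast
  have "n \<ge> 1" using n D by (cases n) (auto simp: not_less)
  have "D + 1 = ((D + 1) powr (1 / (1/2 - \<theta>))) powr (1/2 - \<theta>)"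
    using D \<theta> by (simp add: powr_powr)
  also have "\<dots> \<le> real (2 * n) powr (1/2 - \<theta>)"
    using n \<theta> by (intro powr_mono2) auto
  also have "\<dots> \<le> D" unfolding D_def by (rule bound[OF \<open>n \<ge> 1\<close>])
  finally show False by simp
qed

end
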